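(* For every free abelian group $A$ of finite rank and every finitely generated abelian group $T$, the wreath product $A\wr T$ can be embedded into a (finitely presented) metabelian group with exponential Dehn function. In particular, any free metabelian group of finite rank is isomorphic to a subgroup of a (finitely presented) metabelian group with exponential Dehn function.
   Context: The wreath product $A\wr T$ is the semidirect product of $\bigoplus_{t\in T}A^t$ by $T$, with $T$ permuting the copies of $A$ by translation. The free metabelian group of rank $r$ is $F/F''$ with $F$ free of rank $r$. For a finite presentation $\mathcal P=\langle X\mid R\rangle$ of a group $G$ and a word $w$ over $X^{\pm1}$ with $w=_G1$, $\mathrm{Area}_{\mathcal P}(w)$ is the least $l$ such that $w=\prod_{i=1}^l f_i^{-1}r_if_i$ in $F(X)$ with $r_i\in R\cup R^{-1}$, $f_i\in F(X)$; the Dehn function is $\delta_{\mathcal P}(n)=\sup\{\mathrm{Area}_{\mathcal P}(w): w=_G1,|w|\le n\}$. For functions $f,g:\mathbb N\to\mathbb N$, $f\preccurlyeq g$ means there is $C>0$ with $f(n)\le Cg(Cn)+Cn+C$ for all $n$; $f\approx g$ means $f\preccurlyeq g$ and $g\preccurlyeq f$. Up to $\approx$ the Dehn function depends only on the group; it is called exponential if it is $\approx 2^n$. *)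

theory Defs
  imports "HOL-Algebra.Free_Abelian_Groups" "HOL-Algebra.Generated_Groups"
begin

section \<open>Free groups\<close>

text \<open>A letter \<open>(x, True)\<close> stands for \<open>x\<close> and \<open>(x, False)\<close> for the formal inverse of \<open>x\<close>.\<close>

type_synonym 'x word = "('x \<times> bool) list"

definition words :: "'x set \<Rightarrow> 'x word set"
  where "words X = lists (X \<times> UNIV)"

definition inv_letter :: "'x \<times> bool \<Rightarrow> 'x \<times> bool"
  where "inv_letter a = (fst a, \<not> snd a)"

definition reduced :: "'x word \<Rightarrow> bool"
  where "reduced w \<longleftrightarrow> successively (\<lambda>a b. b \<noteq> inv_letter a) w"

definition cancel_cons :: "'x \<times> bool \<Rightarrow> 'x word \<Rightarrow> 'x word"
  where "cancel_cons a w = (if w \<noteq> [] \<and> hd w = inv_letter a then tl w else a # w)"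

text \<open>\<open>reduce w\<close> is the freely reduced form of \<open>w\<close>, i.e. the element of the free group
  represented by the word \<open>w\<close>.\<close>

definition reduce :: "'x word \<Rightarrow> 'x word"
  where "reduce w = foldr cancel_cons w []"

definition free_group :: "'x set \<Rightarrow> 'x word monoid"
  where "free_group X =
    \<lparr>carrier = {w \<in> words X. reduced w}, monoid.mult = (\<lambda>u v. reduce (u @ v)), one = []\<rparr>"

lemma inv_letter_invol [simp]: "inv_letter (inv_letter a) = a"
  by (simp add: inv_letter_def)

lemma reduced_Nil [simp]: "reduced []"
  by (simp add: reduced_def)

lemma reduced_Cons: "reduced (a # w) \<longleftrightarrow> (w = [] \<or> hd w \<noteq> inv_letter a) \<and> reduced w"
  by (cases w) (auto simp: reduced_def)

lemma reduced_cancel_cons: "reduced w \<Longrightarrow> reduced (cancel_cons a w)"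
  by (cases w) (auto simp: cancel_cons_def reduced_Cons)

lemma cancel_cons_inverse: "reduced w \<Longrightarrow> cancel_cons a (cancel_cons (inv_letter a) w) = w"
  by (cases w) (auto simp: cancel_cons_def reduced_Cons)

lemma reduced_foldr: "reduced v \<Longrightarrow> reduced (foldr cancel_cons u v)"
  by (induction u) (auto simp: reduced_cancel_cons)

lemma reduced_reduce [simp]: "reduced (reduce w)"
  by (simp add: reduce_def reduced_foldr)

lemma reduce_id: "reduced w \<Longrightarrow> reduce w = w"
  by (induction w) (auto simp: reduce_def reduced_Cons cancel_cons_def)

lemma reduce_append: "reduce (u @ v) = foldr cancel_cons u (reduce v)"
  by (simp add: reduce_def)

lemma foldr_cancel_cons:
  assumes "reduced v"
  shows "foldr cancel_cons (cancel_cons a w) v = cancel_cons a (foldr cancel_cons w v)"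
proof (cases "w \<noteq> [] \<and> hd w = inv_letter a")
  case True
  then obtain w' where "w = inv_letter a # w'" by (cases w) auto
  then show ?thesis
    using cancel_cons_inverse[OF reduced_foldr[OF assms]] by (simp add: cancel_cons_def[of a "_ # _"])
next
  case False
  then show ?thesis by (auto simp: cancel_cons_def[of a w])
qed

lemma foldr_reduce: "reduced v \<Longrightarrow> foldr cancel_cons (reduce u) v = foldr cancel_cons u v"
proof (induction u)
  case (Cons a u)
  have "reduce (a # u) = cancel_cons a (reduce u)" by (simp add: reduce_def)
  then show ?case using Cons by (simp add: foldr_cancel_cons)
qed (simp add: reduce_def)

lemma reduce_append_left [simp]: "reduce (reduce u @ v) = reduce (u @ v)"
  by (simp add: reduce_append foldr_reduce)

lemma reduce_append_right [simp]: "reduce (u @ reduce v) = reduce (u @ v)"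
  by (simp add: reduce_append reduce_id)

lemma cancel_cons_words: "a \<in> X \<times> UNIV \<Longrightarrow> w \<in> words X \<Longrightarrow> cancel_cons a w \<in> words X"
  by (cases w) (auto simp: cancel_cons_def words_def)

lemma reduce_words: "w \<in> words X \<Longrightarrow> reduce w \<in> words X"
proof (induction w)
  case (Cons a w)
  then show ?case
    using cancel_cons_words[of a X "reduce w"] by (auto simp: reduce_def words_def)
qed (simp add: reduce_def)

lemma append_words: "u \<in> words X \<Longrightarrow> v \<in> words X \<Longrightarrow> u @ v \<in> words X"
  by (simp add: words_def)

lemma reduce_inverse: "reduce (rev (map inv_letter w) @ w) = []"
proof (induction w)
  case (Cons a w)
  have "cancel_cons (inv_letter a) (cancel_cons a (reduce w)) = reduce w"
    using cancel_cons_inverse[of "reduce w" "inv_letter a"] by simp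
  then have "reduce ([inv_letter a] @ a # w) = reduce w"
    by (simp add: reduce_def)
  then have "reduce (rev (map inv_letter w) @ ([inv_letter a] @ a # w))
    = reduce (rev (map inv_letter w) @ w)"
    by (metis reduce_append_right)
  then show ?case using Cons by simp
qed (simp add: reduce_def)

lemma inv_words: "w \<in> words X \<Longrightarrow> rev (map inv_letter w) \<in> words X"
  by (induction w) (auto simp: words_def inv_letter_def)

lemma group_free_group: "group (free_group X)"
proof (rule groupI)
  fix x y z
  assume "x \<in> carrier (free_group X)" "y \<in> carrier (free_group X)" "z \<in> carrier (free_group X)"
  show "x \<otimes>\<^bsub>free_group X\<^esub> y \<otimes>\<^bsub>free_group X\<^esub> z
    = x \<otimes>\<^bsub>free_group X\<^esub> (y \<otimes>\<^bsub>free_group X\<^esub> z)"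
    by (simp add: free_group_def)
next
  fix x assume x: "x \<in> carrier (free_group X)"
  have "reduce (rev (map inv_letter x)) \<in> carrier (free_group X)"
    using x inv_words[of x X] by (simp add: free_group_def reduce_words)
  moreover have "reduce (rev (map inv_letter x)) \<otimes>\<^bsub>free_group X\<^esub> x = \<one>\<^bsub>free_group X\<^esub>"
    by (simp add: free_group_def reduce_inverse)
  ultimately show "\<exists>y\<in>carrier (free_group X). y \<otimes>\<^bsub>free_group X\<^esub> x = \<one>\<^bsub>free_group X\<^esub>"
    by blast
qed (auto simp: free_group_def reduce_words append_words reduce_id, simp add: words_def)

section \<open>Presentations and Dehn functions\<close>

definition normal_closure :: "('a, 'b) monoid_scheme \<Rightarrow> 'a set \<Rightarrow> 'a set"
  where "normal_closure G R = \<Inter>{N. N \<lhd> G \<and> R \<subseteq> N}"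

text \<open>The presentation \<open>\<langle>X | R\<rangle>\<close> is finite, and it presents \<open>G\<close>.\<close>

definition finite_presentation ::
    "'x set \<Rightarrow> 'x word set \<Rightarrow> ('a, 'b) monoid_scheme \<Rightarrow> bool"
  where "finite_presentation X R G \<longleftrightarrow>
    finite X \<and> finite R \<and> R \<subseteq> carrier (free_group X) \<and>
    G \<cong> free_group X Mod normal_closure (free_group X) R"

text \<open>The words over \<open>X\<close> and inverses, not necessarily reduced, that represent the identity of
  the group presented by \<open>\<langle>X | R\<rangle>\<close>.\<close>

definition null_words :: "'x set \<Rightarrow> 'x word set \<Rightarrow> 'x word set"
  where "null_words X R = {w \<in> words X. reduce w \<in> normal_closure (free_group X) R}"

definition area :: "'x set \<Rightarrow> 'x word set \<Rightarrow> 'x word \<Rightarrow> nat"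
  where "area X R w = (LEAST l. \<exists>ps. length ps = l \<and>
    set ps \<subseteq> carrier (free_group X) \<times> (R \<union> m_inv (free_group X) ` R) \<and>
    reduce w = foldr (\<otimes>\<^bsub>free_group X\<^esub>)
      (map (\<lambda>(f, r). inv\<^bsub>free_group X\<^esub> f \<otimes>\<^bsub>free_group X\<^esub> r \<otimes>\<^bsub>free_group X\<^esub> f) ps)
      \<one>\<^bsub>free_group X\<^esub>)"

text \<open>For finite \<open>X\<close> this is a supremum over a finite set of natural numbers, nonempty because
  the empty word is null.\<close>

definition dehn_function :: "'x set \<Rightarrow> 'x word set \<Rightarrow> nat \<Rightarrow> nat"
  where "dehn_function X R n = (SUP w \<in> {w \<in> null_words X R. length w \<le> n}. area X R w)"

definition growth_le :: "(nat \<Rightarrow> nat) \<Rightarrow> (nat \<Rightarrow> nat) \<Rightarrow> bool"  (infix \<open>\<preceq>\<close> 50)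
  where "f \<preceq> g \<longleftrightarrow> (\<exists>C>0. \<forall>n. f n \<le> C * g (C * n) + C * n + C)"

definition growth_equiv :: "(nat \<Rightarrow> nat) \<Rightarrow> (nat \<Rightarrow> nat) \<Rightarrow> bool"
  where "growth_equiv f g \<longleftrightarrow> f \<preceq> g \<and> g \<preceq> f"

text \<open>Generators of a finite presentation can be renamed to natural numbers. The Dehn functions of
  any two finite presentations of \<open>G\<close> are equivalent, so it does not matter which finite
  presentation is used to define \<open>exponential_dehn_function\<close>. Finitely presented groups are countable,
  so asking for such a group of type \<open>nat monoid\<close> loses no generality.\<close>

definition finitely_presented :: "('a, 'b) monoid_scheme \<Rightarrow> bool"
  where "finitely_presented G \<longleftrightarrow> (\<exists>(X :: nat set) R. finite_presentation X R G)"

definition exponential_dehn_function :: "('a, 'b) monoid_scheme \<Rightarrow> bool"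
  where "exponential_dehn_function G \<longleftrightarrow>
    (\<exists>(X :: nat set) R. finite_presentation X R G \<and>
      growth_equiv (dehn_function X R) (\<lambda>n. 2 ^ n))"

section \<open>Metabelian, free abelian and finitely generated groups\<close>

definition metabelian :: "('a, 'b) monoid_scheme \<Rightarrow> bool"
  where "metabelian G \<longleftrightarrow> group G \<and> derived G (derived G (carrier G)) = {\<one>\<^bsub>G\<^esub>}"

definition free_metabelian_of_rank :: "nat \<Rightarrow> ('a, 'b) monoid_scheme \<Rightarrow> bool"
  where "free_metabelian_of_rank r M \<longleftrightarrow> group M \<and>
    (let F = free_group {..<r} in M \<cong> F Mod derived F (derived F (carrier F)))"

definition free_abelian_of_rank :: "nat \<Rightarrow> ('a, 'b) monoid_scheme \<Rightarrow> bool"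
  where "free_abelian_of_rank n A \<longleftrightarrow> comm_group A \<and> A \<cong> free_Abelian_group {..<n}"

definition finitely_generated :: "('a, 'b) monoid_scheme \<Rightarrow> bool"
  where "finitely_generated G \<longleftrightarrow>
    (\<exists>S. finite S \<and> S \<subseteq> carrier G \<and> generate G S = carrier G)"

section \<open>Wreath products\<close>

definition semidirect_product ::
    "('a, 'b) monoid_scheme \<Rightarrow> ('h, 'c) monoid_scheme \<Rightarrow> ('h \<Rightarrow> 'a \<Rightarrow> 'a) \<Rightarrow> ('a \<times> 'h) monoid"
  where "semidirect_product N H \<phi> =
    \<lparr>carrier = carrier N \<times> carrier H,
     monoid.mult = (\<lambda>(a, s) (b, t). (a \<otimes>\<^bsub>N\<^esub> \<phi> s b, s \<otimes>\<^bsub>H\<^esub> t)),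
     one = (\<one>\<^bsub>N\<^esub>, \<one>\<^bsub>H\<^esub>)\<rparr>"

text \<open>\<open>translate T s\<close> moves the copy of \<open>A\<close> indexed by \<open>u\<close> to the copy indexed by \<open>s u\<close>.\<close>

definition translate :: "('t, 'c) monoid_scheme \<Rightarrow> 't \<Rightarrow> ('t \<Rightarrow> 'a) \<Rightarrow> 't \<Rightarrow> 'a"
  where "translate T s f = (\<lambda>u\<in>carrier T. f (inv\<^bsub>T\<^esub> s \<otimes>\<^bsub>T\<^esub> u))"

definition wreath_product ::
    "('a, 'b) monoid_scheme \<Rightarrow> ('t, 'c) monoid_scheme \<Rightarrow> (('t \<Rightarrow> 'a) \<times> 't) monoid"
  where "wreath_product A T =
    semidirect_product (sum_group (carrier T) (\<lambda>_. A)) T (translate T)"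

lemma group_wreath_product:
  assumes A: "group A" and T: "group T"
  shows "group (wreath_product A T)"
proof -
  interpret A: group A by fact
  interpret T: group T by fact
  define S where "S = sum_group (carrier T) (\<lambda>_. A)"
  interpret S: group S unfolding S_def by (simp add: A)
  have carr: "carrier S = {x \<in> carrier T \<rightarrow>\<^sub>E carrier A. finite {i \<in> carrier T. x i \<noteq> \<one>\<^bsub>A\<^esub>}}"
    by (simp add: S_def carrier_sum_group A)
  have closed: "translate T s f \<in> carrier S" if s: "s \<in> carrier T" and f: "f \<in> carrier S" for s f
  proof -
    have "{i \<in> carrier T. f (inv\<^bsub>T\<^esub> s \<otimes>\<^bsub>T\<^esub> i) \<noteq> \<one>\<^bsub>A\<^esub>}
      \<subseteq> (\<lambda>i. s \<otimes>\<^bsub>T\<^esub> i) ` {i \<in> carrier T. f i \<noteq> \<one>\<^bsub>A\<^esub>}"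
    proof
      fix i assume i: "i \<in> {i \<in> carrier T. f (inv\<^bsub>T\<^esub> s \<otimes>\<^bsub>T\<^esub> i) \<noteq> \<one>\<^bsub>A\<^esub>}"
      then have "i = s \<otimes>\<^bsub>T\<^esub> (inv\<^bsub>T\<^esub> s \<otimes>\<^bsub>T\<^esub> i)"
        using s by (simp add: T.m_assoc[symmetric])
      with i s show "i \<in> (\<lambda>i. s \<otimes>\<^bsub>T\<^esub> i) ` {i \<in> carrier T. f i \<noteq> \<one>\<^bsub>A\<^esub>}"
        by blast
    qed
    then have "finite {i \<in> carrier T. f (inv\<^bsub>T\<^esub> s \<otimes>\<^bsub>T\<^esub> i) \<noteq> \<one>\<^bsub>A\<^esub>}"
      using f by (auto simp: carr intro: finite_subset)
    moreover have "{i \<in> carrier T. translate T s f i \<noteq> \<one>\<^bsub>A\<^esub>}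
      = {i \<in> carrier T. f (inv\<^bsub>T\<^esub> s \<otimes>\<^bsub>T\<^esub> i) \<noteq> \<one>\<^bsub>A\<^esub>}"
      by (auto simp: translate_def)
    ultimately show ?thesis
      using s f by (auto simp: carr translate_def)
  qed
  have mult: "translate T s (f \<otimes>\<^bsub>S\<^esub> g) = translate T s f \<otimes>\<^bsub>S\<^esub> translate T s g"
    if "s \<in> carrier T" for s f g
    using that by (auto simp: S_def translate_def)
  have comp: "translate T (s \<otimes>\<^bsub>T\<^esub> t) f = translate T s (translate T t f)"
    if "s \<in> carrier T" "t \<in> carrier T" for s t f
    using that by (auto simp: translate_def T.inv_mult_group T.m_assoc)
  have one: "translate T \<one>\<^bsub>T\<^esub> f = f" if "f \<in> carrier S" for f
    using that by (auto simp: carr translate_def PiE_iff extensional_def)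
  have W: "wreath_product A T = semidirect_product S T (translate T)"
    by (simp add: wreath_product_def S_def)
  show ?thesis unfolding W
  proof (rule groupI)
    fix x assume x: "x \<in> carrier (semidirect_product S T (translate T))"
    obtain f s where xf: "x = (f, s)" "f \<in> carrier S" "s \<in> carrier T"
      using x by (auto simp: semidirect_product_def)
    let ?y = "(translate T (inv\<^bsub>T\<^esub> s) (inv\<^bsub>S\<^esub> f), inv\<^bsub>T\<^esub> s)"
    have "translate T (inv\<^bsub>T\<^esub> s) (inv\<^bsub>S\<^esub> f \<otimes>\<^bsub>S\<^esub> f) = translate T (inv\<^bsub>T\<^esub> s) \<one>\<^bsub>S\<^esub>"
      using xf by simp
    also have "\<dots> = \<one>\<^bsub>S\<^esub>"
      using xf by (auto simp: translate_def S_def)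
    finally have "translate T (inv\<^bsub>T\<^esub> s) (inv\<^bsub>S\<^esub> f) \<otimes>\<^bsub>S\<^esub> translate T (inv\<^bsub>T\<^esub> s) f = \<one>\<^bsub>S\<^esub>"
      using mult[of "inv\<^bsub>T\<^esub> s" "inv\<^bsub>S\<^esub> f" f] xf by (metis T.inv_closed)
    then have "?y \<otimes>\<^bsub>semidirect_product S T (translate T)\<^esub> x
      = \<one>\<^bsub>semidirect_product S T (translate T)\<^esub>"
      using xf by (simp add: semidirect_product_def)
    moreover have "?y \<in> carrier (semidirect_product S T (translate T))"
      using xf by (simp add: semidirect_product_def closed)
    ultimately show "\<exists>y\<in>carrier (semidirect_product S T (translate T)).
        y \<otimes>\<^bsub>semidirect_product S T (translate T)\<^esub> x = \<one>\<^bsub>semidirect_product S T (translate T)\<^esub>"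
      by blast
  qed (auto simp: semidirect_product_def closed mult comp one S.m_assoc T.m_assoc)
qed

end

theory Submission
  imports Defs Complex_Main
begin

text \<open>The group is a variant of Baumslag's. Write \<open>T\<close> as a subgroup of a product of cyclic groups generated by
  \<open>t\<^sub>j\<close>, add one infinite direction to make room for a basis of \<open>A\<close>, and adjoin to the
  wreath product of \<open>\<int>\<close> by this product a commuting letter \<open>u\<^sub>j\<close> for every infinite direction, acting on the base as
  multiplication by \<open>1 + t\<^sub>j\<close>. The relation \<open>a\<^sup>u = a a\<^sup>t\<close> propagates the commutation of conjugates of \<open>a\<close>
  from a finite box to all of the lattice, so that finitely many relators suffice; each
  step costs a bounded factor, and so does the expansion of a conjugate by \<open>u\<^sub>j\<close> into conjugates
  by the \<open>t\<^sub>i\<close>. This gives the exponential upper bound; completeness of the procedure is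
  witnessed by the action on Laurent series, in which \<open>1 + t\<^sub>j\<close> is invertible. The lower bound
  comes from the map onto the Baumslag--Solitar group in which \<open>u a u\<^sup>-\<^sup>1 = a\<^sup>2\<close>. Free metabelian
  groups embed into wreath products of lattices by the Magnus embedding.\<close>

section \<open>Fillings and areas\<close>

text \<open>The obstacle: in a wreath product with infinite top group the relations
  \<open>[a, a^v] = 1\<close> do not follow from finitely many of them. The letters
  \<open>u_j\<close> make them follow, but at a price: \<open>1 + t_j\<close> becomes invertible on
  the base, and a negative power of \<open>u_j\<close> has no expansion into finitely many
  conjugates by \<open>t\<close>-words. Null words are therefore conjugated by a large power of
  every \<open>u_j\<close> before they are rewritten, so that only nonnegative
  \<open>u\<close>-exponents ever meet a letter \<open>a\<close>. The rewriting leaves at most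
  exponentially many conjugates of \<open>a\<close>, and these cancel in pairs when their
  coefficients in the group ring vanish. That the coefficients of a null word do vanish is a fact
  about the group, not about the rewriting, and needs a module on which the whole group acts:
  Laurent series invert \<open>1 + t_j\<close> and still contain the group ring. The lower bound
  evaluates a function on edges around a loop: every relator contributes at most 1, so the sum
  around the loop bounds the area from below.\<close>

inductive filling :: "'g::group_add set \<Rightarrow> nat \<Rightarrow> 'g \<Rightarrow> bool" for R where
  filling_zero: "filling R 0 0"
| filling_pos: "r \<in> R \<Longrightarrow> filling R l g \<Longrightarrow> filling R (Suc l) (- f + r + f + g)"
| filling_neg: "r \<in> R \<Longrightarrow> filling R l g \<Longrightarrow> filling R (Suc l) (- f + - r + f + g)"

lemmas group_normalize = add.assoc diff_conv_add_uminus minus_add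

lemma filling_add: "filling R l g \<Longrightarrow> filling R m h \<Longrightarrow> filling R (l + m) (g + h)"
proof (induction rule: filling.induct)
  case (filling_pos r l g f)
  then show ?case
    using filling.filling_pos[of r R "l + m" "g + h" f] by (simp add: add.assoc)
next
  case (filling_neg r l g f)
  then show ?case
    using filling.filling_neg[of r R "l + m" "g + h" f]
    by (simp add: group_normalize del: add_uminus_conv_diff)
qed simp

lemma filling_conj: "filling R l g \<Longrightarrow> filling R l (f + g - f)"
proof (induction rule: filling.induct)
  case (filling_pos r l g h)
  have "f + (- h + r + h + g) - f = - (h - f) + r + (h - f) + (f + g - f)"
    by (simp add: group_normalize del: add_uminus_conv_diff)
  then show ?case using filling_pos by (metis filling.filling_pos)
next
  case (filling_neg r l g h)
  have "f + (- h + - r + h + g) - f = - (h - f) + - r + (h - f) + (f + g - f)"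
    by (simp add: group_normalize del: add_uminus_conv_diff)
  then show ?case using filling_neg by (metis filling.filling_neg)
qed (simp add: filling_zero)

lemma filling_minus: "filling R l g \<Longrightarrow> filling R l (- g)"
proof (induction rule: filling.induct)
  case (filling_pos r l g h)
  have "- (- h + r + h + g) = - g + (- h + - r + h + 0)"
    by (simp add: group_normalize del: add_uminus_conv_diff)
  then show ?case
    using filling_add[OF filling_pos.IH filling_neg[OF filling_pos.hyps(1) filling_zero, of h]]
    by (simp del: add_uminus_conv_diff)
next
  case (filling_neg r l g h)
  have "- (- h + - r + h + g) = - g + (- h + r + h + 0)"
    by (simp add: group_normalize del: add_uminus_conv_diff)
  then show ?case
    using filling_add[OF filling_neg.IH filling_pos[OF filling_neg.hyps(1) filling_zero, of h]]
    by (simp del: add_uminus_conv_diff)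
qed (simp add: filling_zero)

lemma filling_rel: "r \<in> R \<Longrightarrow> filling R 1 r"
  using filling_pos[OF _ filling_zero, of r R 0] by simp

text \<open>A filling has an exact number of relators, as \<open>area\<close> demands. The bound is
  relaxed here so that costs can be added and rounded up.\<close>

definition cost_equiv :: "'g::group_add set \<Rightarrow> nat \<Rightarrow> 'g \<Rightarrow> 'g \<Rightarrow> bool"
  where "cost_equiv R l x y \<longleftrightarrow> (\<exists>m\<le>l. filling R m (x - y))"

lemma cost_equiv_refl [simp]: "cost_equiv R l x x"
  unfolding cost_equiv_def using filling_zero by auto

lemma cost_equiv_mono: "cost_equiv R l x y \<Longrightarrow> l \<le> m \<Longrightarrow> cost_equiv R m x y"
  unfolding cost_equiv_def by (meson le_trans)

lemma cost_equiv_sym: "cost_equiv R l x y \<Longrightarrow> cost_equiv R l y x"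
  unfolding cost_equiv_def using filling_minus by (metis minus_diff_eq)

lemma cost_equiv_trans [trans]:
  "cost_equiv R l x y \<Longrightarrow> cost_equiv R m y z \<Longrightarrow> cost_equiv R (l + m) x z"
proof -
  have "x - z = (x - y) + (y - z)"
    by (simp add: group_normalize del: add_uminus_conv_diff)
  then show "cost_equiv R l x y \<Longrightarrow> cost_equiv R m y z \<Longrightarrow> cost_equiv R (l + m) x z"
    unfolding cost_equiv_def using filling_add[of R _ "x - y" _ "y - z"] by (metis add_le_mono)
qed

lemma cost_equiv_conj: "cost_equiv R l x y \<Longrightarrow> cost_equiv R l (f + x - f) (f + y - f)"
proof -
  have "f + x - f - (f + y - f) = f + (x - y) - f"
    by (simp add: group_normalize del: add_uminus_conv_diff)
  then show "cost_equiv R l x y \<Longrightarrow> cost_equiv R l (f + x - f) (f + y - f)"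
    unfolding cost_equiv_def using filling_conj by metis
qed

lemma cost_equiv_right: "cost_equiv R l (x + z) (y + z) \<longleftrightarrow> cost_equiv R l x y"
proof -
  have "x + z - (y + z) = x - y"
    by (simp add: group_normalize del: add_uminus_conv_diff)
  then show ?thesis unfolding cost_equiv_def by simp
qed

lemma cost_equiv_left: "cost_equiv R l (z + x) (z + y) \<longleftrightarrow> cost_equiv R l x y"
proof -
  have *: "cost_equiv R l (z + x) (z + y)" if "cost_equiv R l x y" for x y z
    using cost_equiv_conj[OF that, of z] cost_equiv_right[of R l "z + x - z" z "z + y - z"] by simp
  show ?thesis using *[of x y z] *[of "z + x" "z + y" "- z"] by (auto simp flip: add.assoc)
qed

lemma cost_equiv_add:
  "cost_equiv R l x y \<Longrightarrow> cost_equiv R m x' y' \<Longrightarrow> cost_equiv R (l + m) (x + x') (y + y')"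
  using cost_equiv_trans[of R l "x + x'" "y + x'" m "y + y'"]
  by (simp add: cost_equiv_left cost_equiv_right)

lemma cost_equiv_minus: "cost_equiv R l x y \<Longrightarrow> cost_equiv R l (- x) (- y)"
proof -
  assume "cost_equiv R l x y"
  then have "cost_equiv R l (- x + x + - y) (- x + y + - y)"
    by (simp only: cost_equiv_left cost_equiv_right add.assoc)
  then show "cost_equiv R l (- x) (- y)"
    by (simp add: add.assoc cost_equiv_sym)
qed

lemma cost_equiv_cancel:
  assumes "cost_equiv R l x y"
  shows "cost_equiv R l (x - y) 0" "cost_equiv R l (- x + y) 0"
  using assms cost_equiv_sym[OF assms] cost_equiv_right[of R l "x - y" y 0]
    cost_equiv_left[of R l x "- x + y" 0] by simp_all

lemma cost_equiv_rel: "x - y \<in> R \<Longrightarrow> cost_equiv R 1 x y"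
  unfolding cost_equiv_def using filling_rel by blast

text \<open>The factor 2: \<open>g\<close> is replaced by \<open>h\<close> on both sides of
  \<open>x\<close>.\<close>

lemma cost_equiv_conj_arg:
  assumes "cost_equiv R l g h"
  shows "cost_equiv R (2 * l) (g + x - g) (h + x - h)"
  using cost_equiv_add[OF cost_equiv_add[OF assms cost_equiv_refl[of R 0 x]] cost_equiv_minus[OF assms]]
  by (simp add: mult_2)

section \<open>Commuting at bounded cost\<close>

definition commute_cost :: "'g::group_add set \<Rightarrow> nat \<Rightarrow> 'g \<Rightarrow> 'g \<Rightarrow> bool"
  where "commute_cost R l x y \<longleftrightarrow> cost_equiv R l (x + y) (y + x)"

lemma commute_cost_mono: "commute_cost R l x y \<Longrightarrow> l \<le> m \<Longrightarrow> commute_cost R m x y"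
  unfolding commute_cost_def by (rule cost_equiv_mono)

lemma commute_cost_sym: "commute_cost R l x y \<Longrightarrow> commute_cost R l y x"
  unfolding commute_cost_def by (rule cost_equiv_sym)

lemma commute_cost_self [simp]: "commute_cost R l x x" "commute_cost R l x 0" "commute_cost R l 0 x"
  unfolding commute_cost_def by simp_all

lemma commute_cost_add:
  assumes "commute_cost R l x y" "commute_cost R m x z"
  shows "commute_cost R (l + m) x (y + z)"
proof -
  have "cost_equiv R l (x + y + z) (y + x + z)"
    using assms(1) by (simp only: commute_cost_def cost_equiv_right)
  moreover have "cost_equiv R m (y + (x + z)) (y + (z + x))"
    using assms(2) by (simp only: commute_cost_def cost_equiv_left)
  ultimately show ?thesis
    unfolding commute_cost_def by (metis cost_equiv_trans add.assoc)
qed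

lemma commute_cost_minus: "commute_cost R l x (- y) \<longleftrightarrow> commute_cost R l x y"
proof -
  have *: "commute_cost R l x (- y)" if "commute_cost R l x y" for x y
  proof -
    have "cost_equiv R l (- y + (x + y) + - y) (- y + (y + x) + - y)"
      using that by (simp only: commute_cost_def cost_equiv_left cost_equiv_right)
    then show ?thesis
      unfolding commute_cost_def using cost_equiv_sym
      by (metis add.assoc add.right_inverse add.right_neutral left_minus add.left_neutral)
  qed
  show ?thesis using *[of x y] *[of x "- y"] by auto
qed

lemma commute_cost_minus_left: "commute_cost R l (- x) y \<longleftrightarrow> commute_cost R l x y"
  using commute_cost_minus commute_cost_sym by metis

lemma commute_cost_conj: "commute_cost R l (g + x - g) (g + y - g) \<longleftrightarrow> commute_cost R l x y"
proof -
  have "g + x - g + (g + y - g) = g + (x + y) + - g" "g + y - g + (g + x - g) = g + (y + x) + - g"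
    by (simp_all add: group_normalize del: add_uminus_conv_diff)
  then show ?thesis
    unfolding commute_cost_def by (simp only: cost_equiv_left cost_equiv_right)
qed

lemma commute_cost_cong:
  assumes "cost_equiv R l y y'" "commute_cost R m x y'"
  shows "commute_cost R (m + 2 * l) x y"
proof -
  have "cost_equiv R l (x + y) (x + y')" "cost_equiv R l (y' + x) (y + x)"
    using assms(1) by (simp_all add: cost_equiv_left cost_equiv_right cost_equiv_sym)
  then have "cost_equiv R (l + m + l) (x + y) (y + x)"
    using assms(2) unfolding commute_cost_def by (meson cost_equiv_trans)
  moreover have "l + m + l = m + 2 * l" by simp
  ultimately show ?thesis unfolding commute_cost_def by metis
qed

section \<open>Free groups as a type\<close>

text \<open>Free on all letters of the type, so that \<open>group_add\<close> supplies the algebra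
  without carrier conditions. Words over a subset of letters are related to it by the retraction in
  \<open>conj_product_filling\<close>.\<close>

typedef 'x fgroup = "{w :: 'x word. reduced w}"
  morphisms word_of Abs_fgroup
  by (rule exI[of _ "[]"]) simp

definition fg :: "'x word \<Rightarrow> 'x fgroup"
  where "fg w = Abs_fgroup (reduce w)"

lemma word_of_fg [simp]: "word_of (fg w) = reduce w"
  by (simp add: fg_def Abs_fgroup_inverse)

lemma reduced_word_of [simp]: "reduced (word_of g)"
  using word_of[of g] by simp

lemma fg_word_of [simp]: "fg (word_of g) = g"
  by (simp add: fg_def reduce_id word_of_inverse)

lemma fg_eq_iff: "fg u = fg v \<longleftrightarrow> reduce u = reduce v"
  by (metis word_of_fg fg_word_of word_of_inject)

lemma fg_reduce [simp]: "fg (reduce w) = fg w"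
  by (simp add: fg_eq_iff reduce_id)

abbreviation inv_word :: "'x word \<Rightarrow> 'x word"
  where "inv_word w \<equiv> rev (map inv_letter w)"

instantiation fgroup :: (type) group_add
begin

definition "0 = fg []"
definition "g + h = fg (word_of g @ word_of h)"
definition "- g = fg (inv_word (word_of g))"
definition "(g :: 'a fgroup) - h = g + - h"

instance
proof
  fix a b c :: "'a fgroup"
  show "a + b + c = a + (b + c)" by (simp add: plus_fgroup_def fg_eq_iff)
  show "0 + a = a" "a + 0 = a" by (simp_all add: plus_fgroup_def zero_fgroup_def reduce_def)
  show "- a + a = 0"
    by (simp add: plus_fgroup_def zero_fgroup_def uminus_fgroup_def fg_eq_iff reduce_inverse)
       (simp add: reduce_def)
  show "a + - b = a - b" by (simp add: minus_fgroup_def)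
qed

end

lemma fg_Nil [simp]: "fg [] = 0"
  by (simp add: zero_fgroup_def)

lemma word_of_zero [simp]: "word_of 0 = []"
  using word_of_fg[of "[]"] by (simp add: reduce_def del: word_of_fg)

lemma fg_append: "fg (u @ v) = fg u + fg v"
  by (simp add: plus_fgroup_def fg_eq_iff)

lemma fg_Cons: "fg (a # v) = fg [a] + fg v"
  using fg_append[of "[a]" v] by simp

lemma fg_inv_word: "fg (inv_word w) = - fg w"
proof -
  have "fg (inv_word w) + fg w = 0"
    by (simp flip: fg_append fg_Nil add: fg_eq_iff reduce_inverse del: fg_Nil) (simp add: reduce_def)
  then show ?thesis by (simp add: eq_neg_iff_add_eq_0)
qed

lemma fg_inv_letter: "fg [inv_letter a] = - fg [a]"
  using fg_inv_word[of "[a]"] by simp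

lemma fg_False: "fg [(i, False)] = - fg [(i, True)]"
  using fg_inv_letter[of "(i, True)"] by (simp add: inv_letter_def)

text \<open>The universal property of the free group for permutations of \<open>S\<close>:
  \<open>step_inverse\<close> for a letter and for its inverse makes both steps bijective. It serves
  for the Laurent series and for the Baumslag--Solitar group.\<close>

locale letter_action =
  fixes S :: "'s set" and step :: "'x \<times> bool \<Rightarrow> 's \<Rightarrow> 's"
  assumes step_closed: "s \<in> S \<Longrightarrow> step a s \<in> S"
    and step_inverse: "s \<in> S \<Longrightarrow> step a (step (inv_letter a) s) = s"
begin

definition act :: "'x fgroup \<Rightarrow> 's \<Rightarrow> 's"
  where "act g = foldr step (word_of g)"

lemma foldr_closed: "s \<in> S \<Longrightarrow> foldr step w s \<in> S"
  by (induction w) (auto simp: step_closed)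

lemma foldr_cancel_cons_step: "s \<in> S \<Longrightarrow> foldr step (cancel_cons a w) s = step a (foldr step w s)"
  by (cases w) (auto simp: cancel_cons_def step_inverse foldr_closed)

lemma foldr_reduce_step: "s \<in> S \<Longrightarrow> foldr step (reduce w) s = foldr step w s"
proof (induction w)
  case (Cons a w)
  then show ?case by (simp add: reduce_def foldr_cancel_cons_step)
qed (simp add: reduce_def)

lemma act_fg: "s \<in> S \<Longrightarrow> act (fg w) s = foldr step w s"
  by (simp add: act_def foldr_reduce_step)

lemma act_closed: "s \<in> S \<Longrightarrow> act g s \<in> S"
  by (simp add: act_def foldr_closed)

lemma act_zero [simp]: "s \<in> S \<Longrightarrow> act 0 s = s"
  using act_fg[of s "[]"] by simp

lemma act_add: "s \<in> S \<Longrightarrow> act (g + h) s = act g (act h s)"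
  by (simp add: plus_fgroup_def act_fg) (simp add: act_def)

lemma act_minus_cancel: "s \<in> S \<Longrightarrow> act (- g) (act g s) = s" "s \<in> S \<Longrightarrow> act g (act (- g) s) = s"
  by (simp_all flip: act_add)

end

section \<open>Comparison with the area of a presentation\<close>

definition conj_product :: "'x set \<Rightarrow> ('x word \<times> 'x word) list \<Rightarrow> 'x word"
  where "conj_product X ps = foldr (\<otimes>\<^bsub>free_group X\<^esub>)
      (map (\<lambda>(f, r). inv\<^bsub>free_group X\<^esub> f \<otimes>\<^bsub>free_group X\<^esub> r \<otimes>\<^bsub>free_group X\<^esub> f) ps)
      \<one>\<^bsub>free_group X\<^esub>"

lemma inv_free_group:
  assumes "w \<in> carrier (free_group X)"
  shows "inv\<^bsub>free_group X\<^esub> w = reduce (inv_word w)"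
proof (rule group.inv_equality[OF group_free_group _ assms])
  show "reduce (inv_word w) \<otimes>\<^bsub>free_group X\<^esub> w = \<one>\<^bsub>free_group X\<^esub>"
    by (simp add: free_group_def reduce_inverse)
  show "reduce (inv_word w) \<in> carrier (free_group X)"
    using assms inv_words[of w X] by (simp add: free_group_def reduce_words)
qed

lemma mult_free_group: "u \<otimes>\<^bsub>free_group X\<^esub> v = reduce (u @ v)"
  by (simp add: free_group_def)

lemma one_free_group: "\<one>\<^bsub>free_group X\<^esub> = []"
  by (simp add: free_group_def)

lemma carrier_free_group: "w \<in> carrier (free_group X) \<longleftrightarrow> w \<in> words X \<and> reduced w"
  by (simp add: free_group_def)

lemma fg_mult: "fg (u \<otimes>\<^bsub>free_group X\<^esub> v) = fg u + fg v"
  by (simp add: free_group_def fg_append)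

lemma fg_inv: "w \<in> carrier (free_group X) \<Longrightarrow> fg (inv\<^bsub>free_group X\<^esub> w) = - fg w"
  by (simp add: inv_free_group fg_inv_word)

lemma filling_conj_product:
  assumes "R \<subseteq> carrier (free_group X)"
    and "set ps \<subseteq> carrier (free_group X) \<times> (R \<union> m_inv (free_group X) ` R)"
  shows "filling (fg ` R) (length ps) (fg (conj_product X ps))"
  using assms(2)
proof (induction ps)
  case Nil
  then show ?case by (simp add: conj_product_def one_free_group filling_zero)
next
  case (Cons p ps)
  obtain f r where p: "p = (f, r)" by force
  have IH: "filling (fg ` R) (length ps) (fg (conj_product X ps))"
    using Cons by simp
  have f: "f \<in> carrier (free_group X)" using Cons.prems p by auto
  have eq: "fg (conj_product X (p # ps)) = - fg f + fg r + fg f + fg (conj_product X ps)"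
    using f by (simp add: conj_product_def p fg_mult fg_inv)
  consider "r \<in> R" | r' where "r' \<in> R" "r = inv\<^bsub>free_group X\<^esub> r'"
    using Cons.prems p by auto
  then show ?case
  proof cases
    case 1
    then show ?thesis using filling_pos[OF _ IH] eq by auto
  next
    case 2
    then have "fg r = - fg r'" using assms(1) by (auto intro: fg_inv)
    then show ?thesis using filling_neg[OF _ IH, of "fg r'" "fg f"] eq 2 by auto
  qed
qed

text \<open>A filling in \<open>fgroup\<close> may use conjugators with letters outside
  \<open>X\<close>. Deleting those letters is a homomorphism onto \<open>free_group X\<close> that
  fixes the relators and \<open>g\<close>, so it turns the filling into one over \<open>X\<close> of
  the same size.\<close>

lemma conj_product_filling:
  assumes R: "R \<subseteq> carrier (free_group X)" and "filling (fg ` R) l g" "word_of g \<in> words X"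
  shows "\<exists>ps. length ps = l \<and> set ps \<subseteq> carrier (free_group X) \<times> (R \<union> m_inv (free_group X) ` R) \<and>
    word_of g = conj_product X ps"
proof -
  let ?keep = "\<lambda>a :: 'a \<times> bool. fst a \<in> X"
  define \<rho> where "\<rho> w = reduce (filter ?keep w)" for w :: "'a word"
  have \<rho>_words: "\<rho> w \<in> carrier (free_group X)" for w
    unfolding \<rho>_def carrier_free_group
    by (auto intro!: reduce_words) (auto simp: words_def)
  \<comment> \<open>A letter and its inverse are kept or deleted together, so deletion respects free
    cancellation.\<close>
  have cc: "reduce (filter ?keep (cancel_cons a w)) = reduce (filter ?keep (a # w))" for a w
  proof (cases "w \<noteq> [] \<and> hd w = inv_letter a")
    case True
    then obtain w' where w: "w = inv_letter a # w'" by (cases w) auto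
    have "fg (a # inv_letter a # u) = fg u" for u
      by (subst fg_Cons, subst (2) fg_Cons) (simp add: fg_inv_letter flip: add.assoc)
    then show ?thesis using w by (simp add: cancel_cons_def fg_eq_iff) (simp add: inv_letter_def)
  qed (auto simp: cancel_cons_def)
  have "\<rho> (reduce w) = \<rho> w" for w
  proof (induction w)
    case (Cons a w)
    have "\<rho> (reduce (a # w)) = reduce (filter ?keep (a # reduce w))"
      using cc[of a "reduce w"] by (simp add: \<rho>_def reduce_def)
    moreover have "reduce (filter ?keep (a # u)) = reduce (filter ?keep [a] @ \<rho> u)" for u
      using reduce_append_right[of "filter ?keep [a]" "filter ?keep u"] by (simp add: \<rho>_def)
    ultimately show ?case using Cons by (metis \<rho>_def)
  qed (simp add: \<rho>_def reduce_def)
  note \<rho>_reduce = this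
  define \<sigma> where "\<sigma> g = \<rho> (word_of g)" for g
  have \<sigma>_closed: "\<sigma> g \<in> carrier (free_group X)" for g
    by (simp add: \<sigma>_def \<rho>_words)
  have \<sigma>_add: "\<sigma> (g + h) = \<sigma> g \<otimes>\<^bsub>free_group X\<^esub> \<sigma> h" for g h
    by (simp add: \<sigma>_def plus_fgroup_def \<rho>_reduce mult_free_group) (simp add: \<rho>_def)
  have \<sigma>_minus: "\<sigma> (- g) = inv\<^bsub>free_group X\<^esub> (\<sigma> g)" for g
  proof (rule group.inv_equality[OF group_free_group, symmetric])
    show "\<sigma> (- g) \<otimes>\<^bsub>free_group X\<^esub> \<sigma> g = \<one>\<^bsub>free_group X\<^esub>"
      unfolding \<sigma>_add[symmetric] by (simp add: \<sigma>_def \<rho>_def one_free_group reduce_def)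
  qed (simp_all add: \<sigma>_def \<rho>_words)
  have \<sigma>_words: "\<sigma> (fg w) = w" if "w \<in> carrier (free_group X)" for w
  proof -
    have "filter ?keep w = w" using that by (auto simp: carrier_free_group words_def filter_id_conv)
    then show ?thesis using that by (simp add: \<sigma>_def \<rho>_reduce) (simp add: \<rho>_def carrier_free_group reduce_id)
  qed
  have "\<exists>ps. length ps = l \<and> set ps \<subseteq> carrier (free_group X) \<times> (R \<union> m_inv (free_group X) ` R) \<and>
    \<sigma> g = conj_product X ps"
    using assms(2)
  proof (induction rule: filling.induct)
    case filling_zero
    show ?case
      by (rule exI[of _ "[]"]) (simp add: conj_product_def \<sigma>_def \<rho>_def one_free_group reduce_def)
  next
    case (filling_pos r l g f)
    then obtain ps r' where ps: "length ps = l" "\<sigma> g = conj_product X ps"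
        "set ps \<subseteq> carrier (free_group X) \<times> (R \<union> m_inv (free_group X) ` R)" "r' \<in> R" "r = fg r'"
      by blast
    then have "\<sigma> r = r'" using R \<sigma>_words by blast
    then have "\<sigma> (- f + r + f + g) = conj_product X ((\<sigma> f, r') # ps)"
      unfolding \<sigma>_add \<sigma>_minus ps(2) by (simp add: conj_product_def)
    then show ?case
      using ps \<sigma>_closed by (intro exI[of _ "(\<sigma> f, r') # ps"]) simp
  next
    case (filling_neg r l g f)
    then obtain ps r' where ps: "length ps = l" "\<sigma> g = conj_product X ps"
        "set ps \<subseteq> carrier (free_group X) \<times> (R \<union> m_inv (free_group X) ` R)" "r' \<in> R" "r = fg r'"
      by blast
    then have "\<sigma> r = r'" using R \<sigma>_words by blast
    then have "\<sigma> (- f + - r + f + g) = conj_product X ((\<sigma> f, inv\<^bsub>free_group X\<^esub> r') # ps)"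
      unfolding \<sigma>_add \<sigma>_minus ps(2) by (simp add: conj_product_def)
    then show ?case
      using ps \<sigma>_closed by (intro exI[of _ "(\<sigma> f, inv\<^bsub>free_group X\<^esub> r') # ps"]) simp
  qed
  moreover have "\<sigma> g = word_of g"
    using \<sigma>_words[of "word_of g"] assms(3) by (simp add: carrier_free_group)
  ultimately show ?thesis by simp
qed

lemma conj_product_iff_filling:
  assumes "R \<subseteq> carrier (free_group X)" "w \<in> words X"
  shows "(\<exists>ps. length ps = l \<and> set ps \<subseteq> carrier (free_group X) \<times> (R \<union> m_inv (free_group X) ` R) \<and>
    reduce w = conj_product X ps) \<longleftrightarrow> filling (fg ` R) l (fg w)"
  using filling_conj_product[OF assms(1)] conj_product_filling[OF assms(1), of l "fg w"] assms(2)
  by (auto simp: reduce_words) (metis fg_reduce)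

lemma area_eq_Least_filling:
  assumes "R \<subseteq> carrier (free_group X)" "w \<in> words X"
  shows "area X R w = (LEAST l. filling (fg ` R) l (fg w))"
  unfolding area_def using conj_product_iff_filling[OF assms]
  by (simp add: conj_product_def)

lemma normal_fillings:
  assumes R: "R \<subseteq> carrier (free_group X)"
  shows "{w \<in> carrier (free_group X). \<exists>l. filling (fg ` R) l (fg w)} \<lhd> free_group X" (is "?N \<lhd> _")
proof -
  interpret F: group "free_group X" by (rule group_free_group)
  show ?thesis
  proof (rule F.normal_invI)
    show "subgroup ?N (free_group X)"
    proof (rule F.subgroupI)
      show "?N \<noteq> {}"
        using filling_zero[of "fg ` R"] fg_Nil F.one_closed unfolding one_free_group by force
    next
      fix u assume "u \<in> ?N"
      then show "inv\<^bsub>free_group X\<^esub> u \<in> ?N" by (auto simp: fg_inv intro: filling_minus)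
    next
      fix u v assume "u \<in> ?N" "v \<in> ?N"
      then show "u \<otimes>\<^bsub>free_group X\<^esub> v \<in> ?N" by (auto simp: fg_mult dest: filling_add)
    qed auto
  next
    fix x h assume "x \<in> carrier (free_group X)" "h \<in> ?N"
    then show "x \<otimes>\<^bsub>free_group X\<^esub> h \<otimes>\<^bsub>free_group X\<^esub> inv\<^bsub>free_group X\<^esub> x \<in> ?N"
      using filling_conj[of "fg ` R" _ "fg h" "fg x"] by (auto simp: fg_mult fg_inv)
  qed
qed

lemma normal_closure_iff_filling:
  assumes R: "R \<subseteq> carrier (free_group X)" and w: "w \<in> carrier (free_group X)"
  shows "w \<in> normal_closure (free_group X) R \<longleftrightarrow> (\<exists>l. filling (fg ` R) l (fg w))"
proof
  assume "w \<in> normal_closure (free_group X) R"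
  moreover have "R \<subseteq> {w \<in> carrier (free_group X). \<exists>l. filling (fg ` R) l (fg w)}"
    using R filling_rel[of _ "fg ` R"] by blast
  ultimately show "\<exists>l. filling (fg ` R) l (fg w)"
    using normal_fillings[OF R] unfolding normal_closure_def by blast
next
  interpret F: group "free_group X" by (rule group_free_group)
  assume "\<exists>l. filling (fg ` R) l (fg w)"
  then obtain l where l: "filling (fg ` R) l (fg w)" by blast
  obtain ps where ps: "set ps \<subseteq> carrier (free_group X) \<times> (R \<union> m_inv (free_group X) ` R)"
      "w = conj_product X ps"
    using conj_product_filling[OF R l] w by (auto simp: carrier_free_group reduce_id)
  have "conj_product X ps \<in> N" if N: "N \<lhd> free_group X" "R \<subseteq> N" for N
    using ps(1)
  proof (induction ps)
    case Nil
    show ?case using N normal_imp_subgroup[OF N(1)] by (simp add: conj_product_def subgroup.one_closed)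
  next
    case (Cons p ps)
    obtain f r where p: "p = (f, r)" by force
    have sg: "subgroup N (free_group X)" using N normal_imp_subgroup by blast
    have "r \<in> N" using Cons.prems N sg by (auto simp: p intro: subgroup.m_inv_closed)
    then have "inv\<^bsub>free_group X\<^esub> f \<otimes>\<^bsub>free_group X\<^esub> r \<otimes>\<^bsub>free_group X\<^esub> f \<in> N"
      using normal.inv_op_closed1[OF N(1)] Cons.prems by (simp add: p)
    then show ?case
      using Cons sg by (simp add: conj_product_def p subgroup.m_closed)
  qed
  then show "w \<in> normal_closure (free_group X) R"
    unfolding normal_closure_def using ps by auto
qed

lemma normal_normal_closure:
  assumes R: "R \<subseteq> carrier (free_group X)"
  shows "normal_closure (free_group X) R \<lhd> free_group X"
proof -
  have "normal_closure (free_group X) R \<subseteq> carrier (free_group X)"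
    using normal_fillings[OF R] R filling_rel[of _ "fg ` R"] unfolding normal_closure_def by blast
  then have "normal_closure (free_group X) R
      = {w \<in> carrier (free_group X). \<exists>l. filling (fg ` R) l (fg w)}"
    using normal_closure_iff_filling[OF R] by blast
  then show ?thesis using normal_fillings[OF R] by simp
qed

lemma null_words_iff:
  assumes "R \<subseteq> carrier (free_group X)"
  shows "w \<in> null_words X R \<longleftrightarrow> w \<in> words X \<and> (\<exists>l. filling (fg ` R) l (fg w))"
  using normal_closure_iff_filling[OF assms, of "reduce w"]
  by (auto simp: null_words_def carrier_free_group reduce_words)

section \<open>The presentation\<close>

fun signed_count :: "'x \<Rightarrow> 'x word \<Rightarrow> int" where
  "signed_count i [] = 0"
| "signed_count i ((j, s) # w) = (if j = i then if s then 1 else - 1 else 0) + signed_count i w"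

lemma signed_count_append [simp]: "signed_count i (u @ v) = signed_count i u + signed_count i v"
  by (induction i u rule: signed_count.induct) auto

lemma signed_count_inv_word [simp]: "signed_count i (inv_word w) = - signed_count i w"
  by (induction i w rule: signed_count.induct) (auto simp: inv_letter_def)

lemma signed_count_notin: "i \<notin> fst ` set w \<Longrightarrow> signed_count i w = 0"
  by (induction i w rule: signed_count.induct) auto

lemma signed_count_remove1:
  "a \<in> set w \<Longrightarrow> signed_count i (remove1 a w) = signed_count i w - signed_count i [a]"
  by (induction i w rule: signed_count.induct) auto

lemma signed_count_nonneg: "(i, False) \<notin> set w \<Longrightarrow> 0 \<le> signed_count i w"
  by (induction i w rule: signed_count.induct) auto

lemma signed_count_nonpos: "(i, True) \<notin> set w \<Longrightarrow> signed_count i w \<le> 0"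
  by (induction i w rule: signed_count.induct) auto

lemma sum_abs_signed_count_le:
  assumes "finite I"
  shows "(\<Sum>i\<in>I. \<bar>signed_count i w\<bar>) \<le> int (length w)"
proof (induction w)
  case (Cons a w)
  obtain j s where a: "a = (j, s)" by force
  have "(\<Sum>i\<in>I. \<bar>signed_count i (a # w)\<bar>) \<le> (\<Sum>i\<in>I. (if i = j then 1 else 0) + \<bar>signed_count i w\<bar>)"
    by (intro sum_mono) (auto simp: a)
  also have "\<dots> \<le> 1 + (\<Sum>i\<in>I. \<bar>signed_count i w\<bar>)"
    using assms by (simp add: sum.distrib)
  finally show ?case using Cons by simp
qed simp

definition letter_power :: "'x \<Rightarrow> int \<Rightarrow> 'x word"
  where "letter_power i c = replicate (nat \<bar>c\<bar>) (i, 0 \<le> c)"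

lemma length_letter_power [simp]: "length (letter_power i c) = nat \<bar>c\<bar>"
  by (simp add: letter_power_def)

lemma signed_count_replicate: "signed_count i (replicate n (j, s)) = (if i = j then if s then int n else - int n else 0)"
  by (induction n) auto

lemma signed_count_letter_power [simp]: "signed_count i (letter_power j c) = (if i = j then c else 0)"
  by (simp add: letter_power_def signed_count_replicate)

lemma letter_power_zero [simp]: "letter_power i 0 = []"
  by (simp add: letter_power_def)

lemma letter_power_words: "i \<in> Y \<Longrightarrow> letter_power i c \<in> words Y"
  by (auto simp: letter_power_def words_def)

abbreviation gen :: "'x \<Rightarrow> 'x fgroup"
  where "gen i \<equiv> fg [(i, True)]"

lemma fg_letter: "fg [(i, s)] = (if s then gen i else - gen i)"
  by (simp add: fg_False)

lemma fg_letter_power_Suc: "fg (letter_power i (c + 1)) = gen i + fg (letter_power i c)"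
proof (cases "c \<ge> 0")
  case True
  then have "letter_power i (c + 1) = (i, True) # letter_power i c"
    by (simp add: letter_power_def nat_add_distrib)
  then show ?thesis by (metis fg_Cons)
next
  case False
  then have "nat \<bar>c\<bar> = Suc (nat \<bar>c + 1\<bar>)" by linarith
  then have "letter_power i c = (i, False) # replicate (nat \<bar>c + 1\<bar>) (i, False)"
    using False by (simp add: letter_power_def)
  moreover have "replicate (nat \<bar>c + 1\<bar>) (i, False) = letter_power i (c + 1)"
    using False by (cases "c = - 1") (auto simp: letter_power_def)
  ultimately have "fg (letter_power i c) = - gen i + fg (letter_power i (c + 1))"
    by (metis fg_Cons fg_False)
  then show ?thesis by simp
qed

lemma fg_letter_power_add: "fg (letter_power i (c + d)) = fg (letter_power i c) + fg (letter_power i d)"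
proof (induction c rule: int_induct[where k = 0])
  case (step1 c)
  then show ?case using fg_letter_power_Suc[of i "c + d"] fg_letter_power_Suc[of i c]
    by (simp add: add.assoc add.commute[of d])
next
  case (step2 c)
  have "gen i + fg (letter_power i (c - 1 + d)) = gen i + (fg (letter_power i (c - 1)) + fg (letter_power i d))"
    using fg_letter_power_Suc[of i "c - 1 + d"] fg_letter_power_Suc[of i "c - 1"] step2
    by (simp add: add.assoc[symmetric])
  then show ?case by simp
qed simp

lemma fg_letter_add_power:
  "fg [(i, s)] + fg (letter_power i c) = fg (letter_power i ((if s then 1 else - 1) + c))"
  using fg_letter_power_add[of i "if s then 1 else - 1" c] by (auto simp: letter_power_def)

definition tlet :: "nat \<Rightarrow> nat" where "tlet j = 2 * j + 1"
definition ulet :: "nat \<Rightarrow> nat" where "ulet j = 2 * j + 2"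

lemma let_eq [simp]: "tlet i = tlet j \<longleftrightarrow> i = j" "ulet i = ulet j \<longleftrightarrow> i = j"
  "tlet i \<noteq> ulet j" "ulet j \<noteq> tlet i" "tlet i \<noteq> 0" "ulet i \<noteq> 0" "0 \<noteq> tlet i" "0 \<noteq> ulet i"
  unfolding tlet_def ulet_def by presburger+

text \<open>Letter \<open>0\<close> stands for \<open>a\<close>, and \<open>m j\<close> is the order of \<open>t\<^sub>j\<close>, with \<open>0\<close> for infinite order. The
  letter \<open>u\<^sub>j\<close> is used only if \<open>m j = 0\<close>; it acts on the base as \<open>1 + t\<^sub>j\<close>.\<close>

locale presentation =
  fixes k :: nat and m :: "nat \<Rightarrow> nat"
begin

definition inf_idx :: "nat set" where "inf_idx = {j. j < k \<and> m j = 0}"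
definition tlets :: "nat set" where "tlets = tlet ` {..<k}"
definition qlets :: "nat set" where "qlets = tlets \<union> ulet ` inf_idx"
definition lets :: "nat set" where "lets = insert 0 qlets"
definition modulus :: "nat \<Rightarrow> nat" where "modulus i = (if odd i then m (i div 2) else 0)"

lemma modulus_simps [simp]: "modulus (tlet j) = m j" "modulus (ulet j) = 0"
  by (simp_all add: modulus_def tlet_def ulet_def)

definition tword :: "(nat \<Rightarrow> int) \<Rightarrow> nat word"
  where "tword \<alpha> = concat (map (\<lambda>j. letter_power (tlet j) (\<alpha> j)) [0..<k])"

text \<open>The finite set from which commutation is propagated. In an infinite direction it holds
  the exponents at which the induction with \<open>u_j\<close> stops; in a finite direction it meets
  every residue class.\<close>

definition box :: "(nat \<Rightarrow> int) set"
  where "box = PiE {..<k} (\<lambda>j. {- int (max 1 (m j)) .. int (max 1 (m j))})"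

text \<open>For a letter of infinite order the power relator is the empty word, so that one family
  covers both kinds of letters. Only the last family depends on \<open>box\<close>; all other
  relations \<open>[a, a^v] = 1\<close> are derived in \<open>commute_conj_a\<close>.\<close>

definition rels :: "nat word set"
  where "rels =
    (\<lambda>(i, j). [(i, True), (j, True), (i, False), (j, False)]) ` (qlets \<times> qlets) \<union>
    (\<lambda>i. letter_power i (int (modulus i))) ` qlets \<union>
    (\<lambda>j. [(ulet j, True), (0, True), (ulet j, False)]
          @ inv_word [(0, True), (tlet j, True), (0, True), (tlet j, False)]) ` inf_idx \<union>
    (\<lambda>\<alpha>. [(0, True)] @ (tword \<alpha> @ [(0, True)] @ inv_word (tword \<alpha>))
          @ [(0, False)] @ (tword \<alpha> @ [(0, False)] @ inv_word (tword \<alpha>))) ` box"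

text \<open>The carrier of \<open>free_group\<close> consists of reduced words, while some words in
  \<open>rels\<close> are not reduced, such as the box relator at the zero vector. By
  \<open>fg_R\<close> the two sets agree in \<open>fgroup\<close>.\<close>

definition R :: "nat word set" where "R = reduce ` rels"

lemma finite_lets: "finite lets" "finite qlets" "finite inf_idx"
  by (simp_all add: lets_def qlets_def tlets_def inf_idx_def)

lemma finite_R: "finite R"
  unfolding R_def rels_def box_def using finite_lets by (auto intro!: finite_PiE)

lemma words_mono: "A \<subseteq> B \<Longrightarrow> w \<in> words A \<Longrightarrow> w \<in> words B"
  unfolding words_def by (auto dest: lists_mono)

lemma tword_words: "tword \<alpha> \<in> words tlets"
proof -
  have "letter_power (tlet j) c \<in> lists (tlets \<times> UNIV)" if "j < k" for j c
    using that letter_power_words[of "tlet j" tlets] by (simp add: tlets_def words_def)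
  then show ?thesis unfolding tword_def words_def lists_eq_set by fastforce
qed

lemma tword_lets: "tword \<alpha> \<in> words lets"
  using tword_words by (rule words_mono[rotated]) (auto simp: lets_def qlets_def)

lemma qlets_letter_power: "i \<in> qlets \<Longrightarrow> letter_power i c \<in> words lets"
  by (rule letter_power_words) (simp add: lets_def)

lemma R_carrier: "R \<subseteq> carrier (free_group lets)"
proof -
  have "rels \<subseteq> words lets"
    unfolding rels_def using tword_lets inv_words[OF tword_lets]
    by (auto intro: qlets_letter_power simp: inv_letter_def)
      (auto simp: words_def lets_def qlets_def inf_idx_def tlets_def)
  then show ?thesis unfolding R_def by (auto simp: carrier_free_group reduce_words)
qed

abbreviation ce :: "nat \<Rightarrow> nat fgroup \<Rightarrow> nat fgroup \<Rightarrow> bool" where "ce \<equiv> cost_equiv (fg ` R)"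
abbreviation cc :: "nat \<Rightarrow> nat fgroup \<Rightarrow> nat fgroup \<Rightarrow> bool" where "cc \<equiv> commute_cost (fg ` R)"

lemma fg_R: "fg ` R = fg ` rels"
  by (auto simp: R_def image_image)

section \<open>Sorting words in the letters \<open>t\<close> and \<open>u\<close>\<close>

lemma gen_commute: "i \<in> qlets \<Longrightarrow> j \<in> qlets \<Longrightarrow> cc 1 (gen i) (gen j)"
proof -
  assume ij: "i \<in> qlets" "j \<in> qlets"
  let ?w = "[(i, True), (j, True), (i, False), (j, False)]"
  have "?w \<in> rels" unfolding rels_def using ij by force
  moreover have "fg ?w = gen i + gen j - (gen j + gen i)"
    by (subst fg_Cons, subst fg_Cons, subst (3) fg_Cons)
      (simp add: fg_False group_normalize del: add_uminus_conv_diff)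
  ultimately show ?thesis unfolding commute_cost_def
    using cost_equiv_rel[of _ _ "fg ` R"] by (metis fg_R image_eqI)
qed

lemma letter_commute:
  "i \<in> qlets \<Longrightarrow> j \<in> qlets \<Longrightarrow> cc 1 (fg [(i, s)]) (fg [(j, s')])"
  using gen_commute[of i j] commute_cost_sym commute_cost_minus
  by (smt (verit) fg_letter)

lemma letter_word_commute:
  "i \<in> qlets \<Longrightarrow> v \<in> words qlets \<Longrightarrow> cc (length v) (fg [(i, s)]) (fg v)"
proof (induction v)
  case (Cons a v)
  obtain j s' where a: "a = (j, s')" by force
  have "cc (1 + length v) (fg [(i, s)]) (fg [a] + fg v)"
    using Cons by (intro commute_cost_add) (auto simp: words_def a intro: letter_commute simp del: One_nat_def)
  then show ?case by (simp flip: fg_Cons)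
qed simp

definition normal_word :: "nat list \<Rightarrow> nat word \<Rightarrow> nat word"
  where "normal_word xs v = concat (map (\<lambda>i. letter_power i (signed_count i v)) xs)"

lemma length_normal_word: "distinct xs \<Longrightarrow> length (normal_word xs v) \<le> length v"
proof -
  assume d: "distinct xs"
  have "int (length (normal_word xs v)) = (\<Sum>i\<in>set xs. \<bar>signed_count i v\<bar>)"
    using d by (simp add: normal_word_def length_concat o_def sum_list_distinct_conv_sum_set)
  then show ?thesis using sum_abs_signed_count_le[of "set xs" v] by simp
qed

lemma normal_word_words: "set xs \<subseteq> Y \<Longrightarrow> normal_word xs v \<in> words Y"
proof -
  assume "set xs \<subseteq> Y"
  then have "letter_power i c \<in> lists (Y \<times> UNIV)" if "i \<in> set xs" for i c
    using that letter_power_words[of i Y] by (auto simp: words_def)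
  then show ?thesis unfolding normal_word_def words_def lists_eq_set by fastforce
qed

text \<open>The quadratic Dehn function of an abelian group: each new letter is carried past at most
  \<open>length v\<close> letters to its block.\<close>

lemma cost_normal_word:
  assumes "distinct xs" "set xs = qlets"
  shows "v \<in> words qlets \<Longrightarrow> ce (length v * length v) (fg v) (fg (normal_word xs v))"
proof (induction v)
  case (Cons a v)
  obtain i s where a: "a = (i, s)" by force
  have i: "i \<in> qlets" and v: "v \<in> words qlets" using Cons.prems by (auto simp: a words_def)
  obtain xs1 xs2 where xs: "xs = xs1 @ i # xs2" "i \<notin> set xs1" "i \<notin> set xs2"
    using i assms by (metis split_list distinct_append distinct.simps(2) not_distinct_conv_prefix split_list_first)
  have nw: "normal_word xs w = normal_word xs1 w @ letter_power i (signed_count i w) @ normal_word xs2 w" for w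
    by (simp add: xs normal_word_def)
  have same: "normal_word xs1 (a # v) = normal_word xs1 v" "normal_word xs2 (a # v) = normal_word xs2 v"
    unfolding normal_word_def using xs(2,3) by (auto simp: a intro!: arg_cong[of _ _ concat])
  let ?B = "fg (normal_word xs1 v)" and ?P = "fg (letter_power i (signed_count i v))"
    and ?C = "fg (normal_word xs2 v)" and ?a = "fg [(i, s)]"
  have len: "length (normal_word xs1 v) \<le> length v"
    using assms(1) xs by (intro length_normal_word) simp
  have P: "fg (letter_power i (signed_count i (a # v))) = ?a + ?P"
    by (simp only: a signed_count.simps simp_thms if_True fg_letter_add_power)
  have "ce (length v * length v) (?a + fg v) (?a + (?B + ?P + ?C))"
    using Cons.IH[OF v] by (simp add: cost_equiv_left nw fg_append add.assoc)
  also have "ce (length v) (?a + ?B + (?P + ?C)) (?B + ?a + (?P + ?C))"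
  proof -
    have "cc (length (normal_word xs1 v)) ?a ?B"
      by (rule letter_word_commute[OF i]) (use assms xs in \<open>auto intro!: normal_word_words\<close>)
    then show ?thesis using len
      by (simp add: cost_equiv_right commute_cost_def) (erule cost_equiv_mono, simp)
  qed
  then have "ce (length v) (?a + (?B + ?P + ?C)) (?B + ?a + (?P + ?C))"
    by (simp add: add.assoc)
  also have "?B + ?a + (?P + ?C) = fg (normal_word xs (a # v))"
    by (simp add: nw same fg_append P add.assoc)
  finally have "ce (length v * length v + length v) (fg (a # v)) (fg (normal_word xs (a # v)))"
    by (simp add: a fg_Cons[of "(i, s)" v])
  then show ?case by (rule cost_equiv_mono) simp
qed (simp add: normal_word_def letter_power_def map_replicate_const concat_replicate_trivial)

lemma cost_letter_power_multiple:
  assumes "i \<in> qlets"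
  shows "ce (nat \<bar>q\<bar>) (fg (letter_power i (int (modulus i) * q))) 0"
proof -
  let ?p = "\<lambda>q. fg (letter_power i (int (modulus i) * q))"
  have one: "ce 1 (fg (letter_power i (int (modulus i)))) 0"
  proof (rule cost_equiv_rel)
    show "fg (letter_power i (int (modulus i))) - 0 \<in> fg ` R"
      using assms unfolding fg_R rels_def by auto
  qed
  have split: "?p (q + 1) = fg (letter_power i (int (modulus i))) + ?p q" for q
    using fg_letter_power_add[of i "int (modulus i)" "int (modulus i) * q"]
    by (simp add: algebra_simps)
  show ?thesis
  proof (induction q rule: int_induct[where k = 0])
    case (step1 q)
    have "ce (1 + nat \<bar>q\<bar>) (?p (q + 1)) (0 + 0)"
      unfolding split by (rule cost_equiv_add[OF one step1.IH])
    moreover have "nat \<bar>q + 1\<bar> = 1 + nat \<bar>q\<bar>" using step1 by linarith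
    ultimately show ?case by (metis add_0)
  next
    case (step2 q)
    have "?p (q - 1) = - fg (letter_power i (int (modulus i))) + ?p q"
      using split[of "q - 1"] by simp
    moreover have "ce (1 + nat \<bar>q\<bar>) (- fg (letter_power i (int (modulus i))) + ?p q) (- 0 + 0)"
      by (rule cost_equiv_add[OF cost_equiv_minus[OF one] step2.IH])
    moreover have "nat \<bar>q - 1\<bar> = 1 + nat \<bar>q\<bar>" using step2 by linarith
    ultimately show ?case by (metis add_0 minus_zero)
  qed simp
qed

text \<open>Sorting takes at most \<open>n * n\<close> relators and deleting the sorted blocks at
  most \<open>n\<close>: a block of \<open>q\<close> full periods of positive length has at least
  \<open>q\<close> letters, and a block with modulus 0 is empty.\<close>

lemma cost_null_word:
  assumes v: "v \<in> words qlets" and null: "\<And>i. i \<in> qlets \<Longrightarrow> int (modulus i) dvd signed_count i v"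
  shows "ce ((length v + 1)\<^sup>2) (fg v) 0"
proof -
  obtain xs where xs: "set xs = qlets" "distinct xs"
    using finite_distinct_list[OF finite_lets(2)] by blast
  have *: "ce (length (normal_word js v)) (fg (normal_word js v)) 0" if "set js \<subseteq> qlets" for js
    using that
  proof (induction js)
    case (Cons i js)
    obtain q where q: "signed_count i v = int (modulus i) * q"
      using null[of i] Cons.prems by (auto elim: dvdE)
    have "nat \<bar>q\<bar> \<le> nat \<bar>signed_count i v\<bar> \<or> modulus i = 0"
      using mult_right_mono[of 1 "int (modulus i)" "\<bar>q\<bar>"] by (auto simp: q abs_mult)
    then have "ce (nat \<bar>signed_count i v\<bar>) (fg (letter_power i (signed_count i v))) 0"
      using cost_letter_power_multiple[of i q] Cons.prems q by (auto elim: cost_equiv_mono)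
    then have "ce (nat \<bar>signed_count i v\<bar> + length (normal_word js v))
        (fg (letter_power i (signed_count i v)) + fg (normal_word js v)) (0 + 0)"
      using Cons by (intro cost_equiv_add) auto
    then show ?case by (simp add: normal_word_def fg_append)
  qed (simp add: normal_word_def)
  have "ce (length v * length v + length (normal_word xs v)) (fg v) 0"
    using cost_equiv_trans[OF cost_normal_word[OF xs(2,1) v] *] xs by simp
  then show ?thesis
    by (rule cost_equiv_mono) (use length_normal_word[OF xs(2), of v] in \<open>simp add: power2_eq_square\<close>)
qed

lemma cost_qword:
  assumes "v \<in> words qlets" "v' \<in> words qlets"
    and "\<And>i. i \<in> qlets \<Longrightarrow> int (modulus i) dvd signed_count i v - signed_count i v'"
    and "length v + length v' \<le> n"
  shows "ce ((n + 1)\<^sup>2) (fg v) (fg v')"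
proof -
  have "ce ((length (v @ inv_word v') + 1)\<^sup>2) (fg (v @ inv_word v')) 0"
    using assms by (intro cost_null_word append_words inv_words) auto
  then have "ce ((length v + length v' + 1)\<^sup>2) (fg v - fg v') 0"
    by (simp add: fg_append fg_inv_word)
  then have "ce ((length v + length v' + 1)\<^sup>2) (fg v) (fg v')"
    using cost_equiv_right[of _ _ "fg v - fg v'" "fg v'" 0] by simp
  then show ?thesis by (rule cost_equiv_mono) (use assms in \<open>auto intro: power_mono\<close>)
qed

end

section \<open>Commuting conjugates\<close>

text \<open>Lets the quadratic sorting costs be absorbed into the base 6 of the commutation
  bound.\<close>

lemma square_le_six_power: "(2 * n + 1)\<^sup>2 \<le> 2 * 6 ^ n" for n :: nat
proof (induction n)
  case (Suc n)
  have "(2 * Suc n + 1)\<^sup>2 = (2 * n + 1)\<^sup>2 + 8 * n + 8" by (simp add: power2_eq_square)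
  moreover have "8 * n + 8 \<le> 10 * 6 ^ n"
    by (induction n) auto
  moreover have "(6::nat) ^ Suc n = 6 * 6 ^ n" by simp
  ultimately show ?case using Suc.IH by linarith
qed simp

lemma words_remove1: "w \<in> words Y \<Longrightarrow> remove1 a w \<in> words Y"
  unfolding words_def lists_eq_set using set_remove1_subset[of a w] by auto

lemma words_Cons [simp]: "a # w \<in> words Y \<longleftrightarrow> fst a \<in> Y \<and> w \<in> words Y"
  by (cases a) (simp add: words_def)

lemma words_Nil [simp]: "[] \<in> words Y"
  by (simp add: words_def)

lemma words_append [simp]: "u @ v \<in> words Y \<longleftrightarrow> u \<in> words Y \<and> v \<in> words Y"
  by (auto simp: words_def)

text \<open>As \<open>p\<close> commutes with \<open>x\<close> and \<open>y\<close>, it can be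
  removed from \<open>p + q\<close>, leaving \<open>q\<close> commuting with \<open>x + y\<close>;
  as \<open>y\<close> commutes with \<open>q\<close>, it can be removed from \<open>x + y\<close>.
  This extracts one commutator from four once the other three are known.\<close>

lemma commute_cost_cancel:
  assumes "commute_cost R a (x + y) (p + q)" "commute_cost R b x p" "commute_cost R c y p"
    and "commute_cost R d y q"
  shows "commute_cost R (a + b + c + d) x q"
proof -
  have "commute_cost R (b + c) (x + y) p"
    using commute_cost_add[OF assms(2,3)[THEN commute_cost_sym]] by (rule commute_cost_sym)
  then have "commute_cost R (b + c + a) (x + y) (- p + (p + q))"
    using assms(1) by (intro commute_cost_add) (simp add: commute_cost_minus)
  then have "commute_cost R (b + c + a) q (x + y)"
    using commute_cost_sym by (simp flip: add.assoc)
  moreover have "commute_cost R d q (- y)"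
    using assms(4) by (simp add: commute_cost_minus commute_cost_sym)
  ultimately have "commute_cost R (b + c + a + d) q (x + y + - y)"
    by (rule commute_cost_add)
  then have "commute_cost R (b + c + a + d) q x" by (simp add: add.assoc)
  then show ?thesis using commute_cost_sym by (metis add.commute add.assoc)
qed

context presentation
begin

abbreviation conj_a :: "nat word \<Rightarrow> nat fgroup"
  where "conj_a v \<equiv> fg v + gen 0 - fg v"

lemma conj_a_append: "conj_a (v @ w) = fg v + conj_a w - fg v"
  by (simp add: fg_append group_normalize del: add_uminus_conv_diff)

lemma tlets_qlets: "w \<in> words tlets \<Longrightarrow> w \<in> words qlets"
  using words_mono[of tlets qlets] by (simp add: qlets_def)

lemma signed_count_tword_concat:
  "distinct js \<Longrightarrow> signed_count (tlet j) (concat (map (\<lambda>j. letter_power (tlet j) (\<alpha> j)) js))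
    = (if j \<in> set js then \<alpha> j else 0)"
  by (induction js) auto

lemma signed_count_tword [simp]: "j < k \<Longrightarrow> signed_count (tlet j) (tword \<alpha>) = \<alpha> j"
  unfolding tword_def by (subst signed_count_tword_concat) auto

lemma signed_count_ulet [simp]: "w \<in> words tlets \<Longrightarrow> signed_count (ulet j) w = 0"
  by (rule signed_count_notin) (auto simp: words_def tlets_def)

lemma cost_tword_eq:
  assumes "v \<in> words tlets" "v' \<in> words tlets"
    and "\<And>j. j < k \<Longrightarrow> int (m j) dvd signed_count (tlet j) v - signed_count (tlet j) v'"
    and "length v + length v' \<le> n"
  shows "ce ((n + 1)\<^sup>2) (fg v) (fg v')"
proof (rule cost_qword)
  fix i assume "i \<in> qlets"
  then consider j where "i = tlet j" "j < k" | j where "i = ulet j"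
    unfolding qlets_def tlets_def by blast
  then show "int (modulus i) dvd signed_count i v - signed_count i v'"
    by cases (use assms in auto)
qed (use assms tlets_qlets in auto)

lemma cost_box:
  assumes "\<alpha> \<in> box"
  shows "cc 1 (gen 0) (conj_a (tword \<alpha>))"
proof -
  let ?t = "fg (tword \<alpha>)"
  let ?w = "[(0, True)] @ (tword \<alpha> @ [(0, True)] @ inv_word (tword \<alpha>))
          @ [(0, False)] @ (tword \<alpha> @ [(0, False)] @ inv_word (tword \<alpha>))"
  have "fg ?w = gen 0 + (?t + gen 0 + - ?t) + - gen 0 + (?t + - gen 0 + - ?t)"
    by (simp only: fg_append fg_inv_word fg_False add.assoc)
  also have "\<dots> = gen 0 + (?t + gen 0 - ?t) - ((?t + gen 0 - ?t) + gen 0)"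
    by (simp add: group_normalize del: add_uminus_conv_diff)
  finally have "fg ?w = \<dots>" .
  moreover have "?w \<in> rels" using assms unfolding rels_def by blast
  ultimately show ?thesis
    unfolding commute_cost_def by (intro cost_equiv_rel) (metis fg_R image_eqI)
qed

lemma cost_u:
  assumes "j \<in> inf_idx"
  shows "ce 1 (gen (ulet j) + gen 0 - gen (ulet j)) (gen 0 + conj_a [(tlet j, True)])"
proof -
  let ?v = "[(ulet j, True), (0, True), (ulet j, False)]"
    and ?w = "[(0, True), (tlet j, True), (0, True), (tlet j, False)]"
  have "fg (?v @ inv_word ?w) = fg ?v - fg ?w"
    by (simp only: fg_append fg_inv_word add_uminus_conv_diff)
  moreover have "fg ?v = gen (ulet j) + gen 0 - gen (ulet j)"
    by (subst fg_Cons, subst (2) fg_Cons)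
      (simp add: fg_False group_normalize del: add_uminus_conv_diff)
  moreover have "fg ?w = gen 0 + (gen (tlet j) + gen 0 - gen (tlet j))"
    by (subst fg_Cons, subst (2) fg_Cons, subst (3) fg_Cons)
      (simp add: fg_False group_normalize del: add_uminus_conv_diff)
  moreover have "?v @ inv_word ?w \<in> rels" using assms unfolding rels_def by blast
  ultimately show ?thesis by (intro cost_equiv_rel) (metis fg_R image_eqI)
qed

definition box_len :: nat where "box_len = (\<Sum>j<k. max 1 (m j))"
text \<open>The square pays for sorting a word into its representative in \<open>box\<close>; the
  factor 100 is chosen for the induction step \<open>commute_conj_a_step\<close>.\<close>

definition commute_const :: nat where "commute_const = 100 * (box_len + 1)\<^sup>2"

lemma length_tword: "\<alpha> \<in> box \<Longrightarrow> length (tword \<alpha>) \<le> box_len"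
proof -
  assume \<alpha>: "\<alpha> \<in> box"
  have "length (tword \<alpha>) = (\<Sum>j<k. nat \<bar>\<alpha> j\<bar>)"
    by (simp add: tword_def length_concat o_def sum_list_distinct_conv_sum_set atLeast_upt)
  also have "\<dots> \<le> box_len" unfolding box_len_def
  proof (rule sum_mono)
    fix j assume "j \<in> {..<k}"
    then have "\<alpha> j \<in> {- int (max 1 (m j)) .. int (max 1 (m j))}"
      using \<alpha> unfolding box_def by (rule PiE_mem[rotated])
    then show "nat \<bar>\<alpha> j\<bar> \<le> max 1 (m j)" by auto
  qed
  finally show ?thesis .
qed

lemma commute_conj_a_base:
  assumes v: "v \<in> words tlets" and small: "\<And>j. j \<in> inf_idx \<Longrightarrow> \<bar>signed_count (tlet j) v\<bar> \<le> 1"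
  shows "cc (commute_const * 6 ^ length v) (gen 0) (conj_a v)"
proof -
  \<comment> \<open>Reduction modulo 0 is the identity: infinite directions keep their exponent,
    which is at most 1 in absolute value, and finite ones are reduced.\<close>
  define \<alpha> where "\<alpha> = (\<lambda>j\<in>{..<k}. signed_count (tlet j) v mod int (m j))"
  have box: "\<alpha> \<in> box" unfolding box_def \<alpha>_def
  proof (intro restrict_PiE_iff[THEN iffD2] ballI)
    fix j assume j: "j \<in> {..<k}"
    show "signed_count (tlet j) v mod int (m j) \<in> {- int (max 1 (m j)) .. int (max 1 (m j))}"
    proof (cases "m j = 0")
      case True
      then show ?thesis using small[of j] j by (auto simp: inf_idx_def)
    next
      case False
      then have "int (max 1 (m j)) = int (m j)" "0 \<le> signed_count (tlet j) v mod int (m j)"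
          "signed_count (tlet j) v mod int (m j) < int (m j)"
        by simp_all
      then show ?thesis unfolding atLeastAtMost_iff by linarith
    qed
  qed
  have "ce ((length v + box_len + 1)\<^sup>2) (fg v) (fg (tword \<alpha>))"
  proof (rule cost_tword_eq[OF v tword_words])
    show "int (m j) dvd signed_count (tlet j) v - signed_count (tlet j) (tword \<alpha>)" if "j < k" for j
      using that by (simp add: \<alpha>_def minus_mod_eq_mult_div)
  qed (simp add: length_tword[OF box])
  from commute_cost_cong[OF cost_equiv_conj_arg[OF this] cost_box[OF box]]
  have "cc (1 + 2 * (2 * (length v + box_len + 1)\<^sup>2)) (gen 0) (conj_a v)" .
  moreover have "1 + 2 * (2 * (length v + box_len + 1)\<^sup>2) \<le> commute_const * 6 ^ length v"
  proof -
    have "length v + box_len + 1 \<le> (2 * length v + 1) * (box_len + 1)"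
      by (simp add: algebra_simps)
    then have "(length v + box_len + 1)\<^sup>2 \<le> (2 * length v + 1)\<^sup>2 * (box_len + 1)\<^sup>2"
      by (metis power_mono power_mult_distrib zero_le)
    also have "\<dots> \<le> 2 * 6 ^ length v * (box_len + 1)\<^sup>2"
      by (intro mult_right_mono square_le_six_power) simp
    finally have "4 * (length v + box_len + 1)\<^sup>2 \<le> 8 * ((box_len + 1)\<^sup>2 * 6 ^ length v)" by simp
    moreover have "1 \<le> (box_len + 1)\<^sup>2 * 6 ^ length v" by simp
    ultimately show ?thesis unfolding commute_const_def by linarith
  qed
  ultimately show ?thesis by (rule commute_cost_mono)
qed

text \<open>Conjugating \<open>[a, a\<^bsup>v'\<^esup>] = 1\<close> by \<open>u\<^sub>j\<close> yields a relation between four commutators, three of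
  which involve shorter conjugators than \<open>v = t\<^sub>j v' = t\<^sub>j\<^sup>2 v''\<close>.\<close>

lemma commute_conj_a_step:
  assumes v: "v \<in> words tlets" and j: "j \<in> inf_idx" and two: "2 \<le> signed_count (tlet j) v"
    and IH: "\<And>w. length w < length v \<Longrightarrow> w \<in> words tlets \<Longrightarrow>
      cc (commute_const * 6 ^ length w) (gen 0) (conj_a w)"
  shows "cc (commute_const * 6 ^ length v) (gen 0) (conj_a v)"
proof -
  let ?t = "(tlet j, True)" and ?u = "(ulet j, True)"
  define v' where "v' = remove1 ?t v"
  define v'' where "v'' = remove1 ?t v'"
  have in1: "?t \<in> set v" using signed_count_nonpos[of "tlet j" v] two by fastforce
  have c': "signed_count i v' = signed_count i v - signed_count i [?t]" for i
    using in1 by (simp add: v'_def signed_count_remove1)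
  have in2: "?t \<in> set v'" using signed_count_nonpos[of "tlet j" v'] two c'[of "tlet j"] by fastforce
  have c'': "signed_count i v'' = signed_count i v' - signed_count i [?t]" for i
    using in2 by (simp add: v''_def signed_count_remove1)
  have w: "v' \<in> words tlets" "v'' \<in> words tlets" "tlet j \<in> tlets" "ulet j \<in> qlets" "tlet j \<in> qlets"
    using v j by (auto simp: v'_def v''_def words_remove1 qlets_def tlets_def inf_idx_def)
  have pos: "length v > 0" "length v' > 0" using in1 in2 by auto
  have len: "length v' = length v - 1" "length v'' = length v - 2"
    using in1 in2 by (auto simp: v'_def v''_def length_remove1)
  obtain n where n: "length v = Suc (Suc n)" "length v' = Suc n" "length v'' = n"
    using len pos by (cases "length v"; cases "length v - 1") auto
  define Q where "Q = (2 * length v + 1)\<^sup>2"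
  have Q: "ce Q (fg w1) (fg w2)"
    if "w1 \<in> words qlets" "w2 \<in> words qlets" "\<And>i. signed_count i w1 = signed_count i w2"
      "length w1 + length w2 \<le> 2 * length v" for w1 w2
    unfolding Q_def by (rule cost_qword) (use that in auto)
  let ?y = "conj_a [?t]" and ?p = "conj_a v'" and ?q = "conj_a (?t # v')"
  \<comment> \<open>The three known commutators: \<open>[a, a^v']\<close>; its conjugate by
    \<open>t\<close>, which is \<open>[a^t, a^(t v')]\<close>; and \<open>[a^t, a^v']\<close>, which
    becomes a conjugate of \<open>[a, a^v'']\<close> once \<open>v'\<close> is sorted into
    \<open>t v''\<close>.\<close>
  have xp: "cc (commute_const * 6 ^ Suc n) (gen 0) ?p"
    using IH[of v'] w n by simp
  have q: "?q = gen (tlet j) + ?p - gen (tlet j)"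
    using conj_a_append[of "[?t]" v'] by simp
  have yq: "cc (commute_const * 6 ^ Suc n) ?y ?q"
    unfolding q commute_cost_conj by (rule xp)
  have "cc (commute_const * 6 ^ n) ?y (gen (tlet j) + conj_a v'' - gen (tlet j))"
    unfolding commute_cost_conj using IH[of v''] w n by simp
  moreover have "ce (2 * Q) ?p (gen (tlet j) + conj_a v'' - gen (tlet j))"
    using cost_equiv_conj_arg[OF Q[of v' "?t # v''"], of "gen 0"] w n
      conj_a_append[of "[?t]" v''] by (simp add: c'' tlets_qlets)
  ultimately have yp: "cc (commute_const * 6 ^ n + 2 * (2 * Q)) ?y ?p"
    by (rule commute_cost_cong[rotated])
  let ?u = "(ulet j, True)"
  have "ce (2 * Q) (conj_a (?u # v')) (conj_a (v' @ [?u]))"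
    by (rule cost_equiv_conj_arg, rule Q) (use w n in \<open>auto simp: tlets_qlets\<close>)
  also have "conj_a (v' @ [?u]) = fg v' + (gen (ulet j) + gen 0 - gen (ulet j)) - fg v'"
    by (rule conj_a_append)
  also have "ce 1 \<dots> (fg v' + (gen 0 + ?y) - fg v')"
    by (rule cost_equiv_conj[OF cost_u[OF j]])
  also have "fg v' + (gen 0 + ?y) - fg v' = ?p + conj_a (v' @ [?t])"
    unfolding conj_a_append by (simp add: group_normalize del: add_uminus_conv_diff)
  also have "ce (2 * Q) \<dots> (?p + ?q)"
    unfolding cost_equiv_left
    by (rule cost_equiv_conj_arg, rule Q) (use w n in \<open>auto simp: tlets_qlets\<close>)
  finally have up: "ce (2 * Q + 1 + 2 * Q) (gen (ulet j) + ?p - gen (ulet j)) (?p + ?q)"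
    using conj_a_append[of "[?u]" v'] by simp
  have "cc (commute_const * 6 ^ Suc n) (gen (ulet j) + gen 0 - gen (ulet j)) (gen (ulet j) + ?p - gen (ulet j))"
    unfolding commute_cost_conj by (rule xp)
  from commute_cost_cong[OF cost_equiv_sym[OF up] this]
  have "cc (commute_const * 6 ^ Suc n + 2 * (2 * Q + 1 + 2 * Q)) (?p + ?q) (gen (ulet j) + gen 0 - gen (ulet j))"
    by (rule commute_cost_sym)
  from commute_cost_cong[OF cost_equiv_sym[OF cost_u[OF j]] this]
  have "cc (commute_const * 6 ^ Suc n + 2 * (2 * Q + 1 + 2 * Q) + 2 * 1) (gen 0 + ?y) (?p + ?q)"
    by (rule commute_cost_sym)
  from commute_cost_cancel[OF this xp yp yq]
  have xq: "cc (commute_const * 6 ^ Suc n + 2 * (2 * Q + 1 + 2 * Q) + 2 * 1 + commute_const * 6 ^ Suc n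
      + (commute_const * 6 ^ n + 2 * (2 * Q)) + commute_const * 6 ^ Suc n) (gen 0) ?q" .
  have "ce (2 * Q) (conj_a v) ?q"
    by (rule cost_equiv_conj_arg, rule Q) (use w n v c' in \<open>auto simp: tlets_qlets\<close>)
  from commute_cost_cong[OF this xq] show ?thesis
  proof (rule commute_cost_mono)
    \<comment> \<open>With \<open>length v = n + 2\<close> the bound is \<open>36 * 6 ^ n\<close>
      times the constant. The earlier commutators use \<open>3 * 6 + 1 = 19\<close> of these 36
      units and leave 17 for sorting. As \<open>Q\<close> is at most \<open>72 * 6 ^ n\<close> and
      \<open>20 * 72 + 4 = 1444\<close> is less than \<open>17 * 100\<close>, a constant of at least
      100 suffices.\<close>
    have "Q \<le> 2 * 6 ^ length v" unfolding Q_def by (rule square_le_six_power)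
    then have "Q \<le> 72 * 6 ^ n" using n by simp
    moreover have "100 * 6 ^ n \<le> commute_const * 6 ^ n"
      unfolding commute_const_def by simp
    moreover have "1 \<le> (6::nat) ^ n" by simp
    ultimately have "20 * Q + 4 \<le> 17 * (commute_const * 6 ^ n)" by linarith
    then show "commute_const * 6 ^ Suc n + 2 * (2 * Q + 1 + 2 * Q) + 2 * 1 + commute_const * 6 ^ Suc n
      + (commute_const * 6 ^ n + 2 * (2 * Q)) + commute_const * 6 ^ Suc n + 2 * (2 * Q) \<le> commute_const * 6 ^ length v"
      unfolding n by simp
  qed
qed

lemma commute_conj_a:
  "v \<in> words tlets \<Longrightarrow> cc (commute_const * 6 ^ length v) (gen 0) (conj_a v)"
proof (induction "length v" arbitrary: v rule: less_induct)
  case less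
  have "\<bar>x\<bar> \<le> 1 \<or> 2 \<le> x \<or> 2 \<le> - x" for x :: int by linarith
  then consider "\<And>j. j \<in> inf_idx \<Longrightarrow> \<bar>signed_count (tlet j) v\<bar> \<le> 1"
    | j where "j \<in> inf_idx" "2 \<le> signed_count (tlet j) v"
    | j where "j \<in> inf_idx" "2 \<le> - signed_count (tlet j) v"
    by blast
  then show ?case
  proof cases
    case 1
    then show ?thesis by (rule commute_conj_a_base[OF less.prems])
  next
    case 2
    then show ?thesis by (rule commute_conj_a_step[OF less.prems]) (rule less.hyps)
  next
    case 3
    \<comment> \<open>A large negative exponent is treated through the inverse word: conjugating
      \<open>[a, a^(v^-1)]\<close> by \<open>v\<close> gives \<open>[a^v, a]\<close>.\<close>
    have "cc (commute_const * 6 ^ length (inv_word v)) (gen 0) (conj_a (inv_word v))"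
      by (rule commute_conj_a_step[of _ j]) (use 3 less.prems inv_words in \<open>auto intro: less.hyps\<close>)
    then have "cc (commute_const * 6 ^ length v) (fg v + gen 0 - fg v)
        (fg v + conj_a (inv_word v) - fg v)"
      unfolding commute_cost_conj by simp
    moreover have "fg v + conj_a (inv_word v) - fg v = gen 0"
      unfolding fg_inv_word by (simp add: group_normalize del: add_uminus_conv_diff)
    ultimately show ?thesis using commute_cost_sym by simp
  qed
qed

lemma conj_a_commute:
  assumes "v \<in> words tlets" "w \<in> words tlets" "length v \<le> N" "length w \<le> N"
  shows "cc (commute_const * 6 ^ (2 * N)) (conj_a v) (conj_a w)"
proof -
  have "cc (commute_const * 6 ^ length (inv_word v @ w)) (gen 0) (conj_a (inv_word v @ w))"
    by (rule commute_conj_a) (use assms inv_words in simp)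
  then have "cc (commute_const * 6 ^ length (inv_word v @ w)) (conj_a v) (fg v + conj_a (inv_word v @ w) - fg v)"
    unfolding commute_cost_conj .
  moreover have "fg v + conj_a (inv_word v @ w) - fg v = conj_a w"
    unfolding fg_inv_word fg_append by (simp add: group_normalize del: add_uminus_conv_diff)
  moreover have "commute_const * 6 ^ length (inv_word v @ w) \<le> commute_const * 6 ^ (2 * N)"
    using assms by (intro mult_left_mono power_increasing) auto
  ultimately show ?thesis by (simp only: commute_cost_mono)
qed


section \<open>Products of conjugates\<close>

definition sconj :: "nat word \<times> bool \<Rightarrow> nat fgroup"
  where "sconj e = (if snd e then conj_a (fst e) else - conj_a (fst e))"

definition conj_sum :: "(nat word \<times> bool) list \<Rightarrow> nat fgroup"
  where "conj_sum L = sum_list (map sconj L)"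

lemma conj_sum_simps [simp]: "conj_sum [] = 0" "conj_sum (e # L) = sconj e + conj_sum L"
  "conj_sum (L @ L') = conj_sum L + conj_sum L'"
  by (simp_all add: conj_sum_def)

definition short_twords :: "nat \<Rightarrow> (nat word \<times> bool) list \<Rightarrow> bool"
  where "short_twords N L \<longleftrightarrow> (\<forall>e\<in>set L. fst e \<in> words tlets \<and> length (fst e) \<le> N)"

lemma short_twords_simps [simp]: "short_twords N []"
  "short_twords N (e # L) \<longleftrightarrow> fst e \<in> words tlets \<and> length (fst e) \<le> N \<and> short_twords N L"
  "short_twords N (L @ L') \<longleftrightarrow> short_twords N L \<and> short_twords N L'"
  by (auto simp: short_twords_def)

definition flip :: "(nat word \<times> bool) list \<Rightarrow> (nat word \<times> bool) list"
  where "flip L = rev (map (\<lambda>(v, s). (v, \<not> s)) L)"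

lemma conj_sum_flip: "conj_sum (flip L) = - conj_sum L"
  by (induction L) (auto simp: flip_def sconj_def minus_add diff_conv_add_uminus simp del: add_uminus_conv_diff)

lemma short_twords_flip [simp]: "short_twords N (flip L) \<longleftrightarrow> short_twords N L"
  by (auto simp: flip_def short_twords_def)

lemma length_flip [simp]: "length (flip L) = length L"
  by (simp add: flip_def)

definition congr :: "(nat \<Rightarrow> int) \<Rightarrow> (nat \<Rightarrow> int) \<Rightarrow> bool"
  where "congr x y \<longleftrightarrow> (\<forall>j<k. int (m j) dvd x j - y j)"

lemma congr_refl [simp]: "congr x x"
  by (simp add: congr_def)

lemma congr_sym: "congr x y \<Longrightarrow> congr y x"
  unfolding congr_def using dvd_diff_commute by blast

lemma congr_trans: "congr x y \<Longrightarrow> congr y z \<Longrightarrow> congr x z"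
  unfolding congr_def
proof (intro allI impI)
  fix j assume "\<forall>j<k. int (m j) dvd x j - y j" "\<forall>j<k. int (m j) dvd y j - z j" "j < k"
  then show "int (m j) dvd x j - z j" using dvd_add[of "int (m j)" "x j - y j" "y j - z j"] by simp
qed

definition cvec :: "nat word \<Rightarrow> nat \<Rightarrow> int"
  where "cvec v j = signed_count (tlet j) v"

text \<open>Elements of the group ring of the product of cyclic groups are encoded as functions on
  integer vectors that are constant on classes modulo \<open>m\<close>; this one is plus or minus a
  single group element. No quotient type is needed.\<close>

definition delta :: "nat word \<times> bool \<Rightarrow> (nat \<Rightarrow> int) \<Rightarrow> int"
  where "delta e x = (if congr x (cvec (fst e)) then if snd e then 1 else - 1 else 0)"

definition total :: "(nat word \<times> bool) list \<Rightarrow> (nat \<Rightarrow> int) \<Rightarrow> int"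
  where "total L x = (\<Sum>e\<leftarrow>L. delta e x)"

lemma total_simps [simp]: "total [] x = 0" "total (e # L) x = delta e x + total L x"
  "total (L @ L') x = total L x + total L' x"
  by (simp_all add: total_def)

lemma total_flip [simp]: "total (flip L) x = - total L x"
  by (induction L) (auto simp: flip_def delta_def)

lemma sconj_commute:
  assumes "short_twords N [e]" "short_twords N [e']"
  shows "cc (commute_const * 6 ^ (2 * N)) (sconj e) (sconj e')"
proof -
  have "cc (commute_const * 6 ^ (2 * N)) (conj_a (fst e)) (conj_a (fst e'))"
    using assms by (intro conj_a_commute) auto
  then show ?thesis
    by (simp add: sconj_def commute_cost_minus commute_cost_minus_left del: minus_diff_eq)
qed

lemma sconj_conj_sum_commute:
  "short_twords N [e] \<Longrightarrow> short_twords N L \<Longrightarrow>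
    cc (length L * (commute_const * 6 ^ (2 * N))) (sconj e) (conj_sum L)"
proof (induction L)
  case (Cons e' L)
  then have "cc (commute_const * 6 ^ (2 * N) + length L * (commute_const * 6 ^ (2 * N)))
      (sconj e) (sconj e' + conj_sum L)"
    by (intro commute_cost_add sconj_commute) auto
  then show ?case by simp
qed simp

text \<open>The head of the list has a partner in the same class with the opposite sign. Moving the
  head up to its partner costs one commutation per conjugate passed, and the pair cancels after
  sorting the two conjugators; two terms are gone.\<close>

lemma cost_conj_sum_zero:
  "short_twords N L \<Longrightarrow> (\<And>x. total L x = 0) \<Longrightarrow>
    ce (length L * (length L * (commute_const * 6 ^ (2 * N)) + 2 * (2 * N + 1)\<^sup>2)) (conj_sum L) 0"
proof (induction "length L" arbitrary: L rule: less_induct)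
  case less
  define K where "K = commute_const * 6 ^ (2 * N)"
  show ?case
  proof (cases L)
    case (Cons e L')
    obtain v s where e: "e = (v, s)" by force
    have "\<exists>e'\<in>set L'. congr (cvec v) (cvec (fst e')) \<and> snd e' \<noteq> s"
    proof (rule ccontr)
      assume "\<not> ?thesis"
      \<comment> \<open>If all terms in the class of \<open>v\<close> had the sign of the head,
        their contributions to the coefficient at \<open>v\<close> could not sum to zero.\<close>
      then have same: "\<forall>e'\<in>set L'. congr (cvec v) (cvec (fst e')) \<longrightarrow> snd e' = s" by blast
      have "(if s then 1 else - 1) * total L' (cvec v) \<ge> 0"
        using same by (induction L') (auto simp: delta_def)
      moreover have "(if s then 1 else - 1) + total L' (cvec v) = 0"
        using less.prems(2)[of "cvec v"] by (simp add: Cons e delta_def)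
      ultimately show False by (cases s) auto
    qed
    then obtain e' L1 L2 where L': "L' = L1 @ e' # L2"
        and e': "congr (cvec v) (cvec (fst e'))" "snd e' \<noteq> s"
      by (metis in_set_conv_decomp)
    have st: "short_twords N [e]" "short_twords N [e']" "short_twords N L1" "short_twords N L2"
      using less.prems(1) by (auto simp: Cons L')
    have "total (L1 @ L2) x = 0" for x
    proof -
      have "congr x (cvec v) \<longleftrightarrow> congr x (cvec (fst e'))"
        using e'(1) congr_sym congr_trans by blast
      then have "delta e x + delta e' x = 0" using e'(2) by (auto simp: delta_def e)
      then show ?thesis using less.prems(2)[of x] by (simp add: Cons L')
    qed
    then have IH: "ce (length (L1 @ L2) * (length (L1 @ L2) * K + 2 * (2 * N + 1)\<^sup>2)) (conj_sum (L1 @ L2)) 0"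
      unfolding K_def using st by (intro less.hyps) (auto simp: Cons L')
    have "ce ((2 * N + 1)\<^sup>2) (fg v) (fg (fst e'))"
      using st e'(1) by (intro cost_tword_eq) (auto simp: e congr_def cvec_def)
    then have c: "ce (2 * (2 * N + 1)\<^sup>2) (conj_a v) (conj_a (fst e'))"
      by (rule cost_equiv_conj_arg)
    have opp: "ce (2 * (2 * N + 1)\<^sup>2) (sconj e + sconj e') 0"
      using cost_equiv_cancel[OF c] e'(2) by (cases s) (simp_all add: sconj_def e del: minus_diff_eq)
    have "cc (length L1 * K) (sconj e) (conj_sum L1)"
      unfolding K_def by (rule sconj_conj_sum_commute[OF st(1,3)])
    then have "ce (length L1 * K) (sconj e + conj_sum L1 + (sconj e' + conj_sum L2))
        (conj_sum L1 + sconj e + (sconj e' + conj_sum L2))"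
      unfolding cost_equiv_right commute_cost_def .
    also have "conj_sum L1 + sconj e + (sconj e' + conj_sum L2)
        = conj_sum L1 + (sconj e + sconj e' + conj_sum L2)"
      by (simp add: add.assoc)
    also have "ce (2 * (2 * N + 1)\<^sup>2) \<dots> (conj_sum L1 + (0 + conj_sum L2))"
      unfolding cost_equiv_left cost_equiv_right by (rule opp)
    also have "conj_sum L1 + (0 + conj_sum L2) = conj_sum (L1 @ L2)" by simp
    also note IH
    finally have "ce (length L1 * K + 2 * (2 * N + 1)\<^sup>2
        + length (L1 @ L2) * (length (L1 @ L2) * K + 2 * (2 * N + 1)\<^sup>2)) (conj_sum L) 0"
      by (simp add: Cons L' add.assoc)
    then show ?thesis unfolding K_def[symmetric]
    proof (rule cost_equiv_mono)
      let ?l = "length L1 + length L2"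
      have "length L1 * K \<le> ?l * K" by simp
      moreover have "length L = ?l + 2" by (simp add: Cons L')
      ultimately show "length L1 * K + 2 * (2 * N + 1)\<^sup>2
        + length (L1 @ L2) * (length (L1 @ L2) * K + 2 * (2 * N + 1)\<^sup>2)
        \<le> length L * (length L * K + 2 * (2 * N + 1)\<^sup>2)"
        by (simp add: algebra_simps)
    qed
  qed simp
qed

section \<open>Expanding and collecting conjugates of \<open>a\<close>\<close>

definition u_count :: "nat word \<Rightarrow> nat"
  where "u_count v = length (filter (\<lambda>a. fst a \<notin> tlets) v)"

lemma u_count_simps [simp]: "u_count [] = 0" "u_count (a # v) = (if fst a \<in> tlets then 0 else 1) + u_count v"
  "u_count (v @ w) = u_count v + u_count w"
  by (simp_all add: u_count_def)

lemma u_count_remove1: "a \<in> set v \<Longrightarrow> fst a \<notin> tlets \<Longrightarrow> u_count v = Suc (u_count (remove1 a v))"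
  by (induction v) auto

lemma u_count_le: "u_count v \<le> length v"
  by (simp add: u_count_def)

lemma ulet_notin_tlets [simp]: "ulet j \<notin> tlets"
  by (auto simp: tlets_def)

text \<open>Moving a letter \<open>u_j\<close> next to \<open>a\<close> and applying its relator
  splits the conjugate by \<open>v' u_j\<close> into those by \<open>v'\<close> and
  \<open>v' t_j\<close>: a binary tree with at most \<open>2 ^ u_count v\<close> leaves and
  \<open>2 ^ u_count v - 1\<close> inner nodes. A letter \<open>u_j\<close> inverse cannot be
  expanded in this way; nonnegative exponents guarantee that it cancels against some
  \<open>u_j\<close>. Trading \<open>u_j\<close> for \<open>t_j\<close> keeps the length, hence the
  fixed bound \<open>N\<close>.\<close>

lemma conj_a_expand:
  "v \<in> words qlets \<Longrightarrow> length v \<le> N \<Longrightarrow> (\<And>j. j \<in> inf_idx \<Longrightarrow> 0 \<le> signed_count (ulet j) v) \<Longrightarrow>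
    \<exists>L. short_twords N L \<and> length L \<le> 2 ^ u_count v \<and>
      ce ((2 ^ u_count v - 1) * (2 * (2 * N + 1)\<^sup>2 + 1)) (conj_a v) (conj_sum L)"
proof (induction "u_count v" arbitrary: v rule: less_induct)
  case less
  define D where "D = 2 * (2 * N + 1)\<^sup>2"
  have Q: "ce D (conj_a w1) (conj_a w2)"
    if "w1 \<in> words qlets" "w2 \<in> words qlets" "\<And>i. signed_count i w1 = signed_count i w2"
      "length w1 + length w2 \<le> 2 * N" for w1 w2
    unfolding D_def by (rule cost_equiv_conj_arg, rule cost_qword) (use that in auto)
  consider "v \<in> words tlets" | j where "(ulet j, False) \<in> set v" "j \<in> inf_idx"
    | j where "(ulet j, True) \<in> set v" "j \<in> inf_idx" "\<And>i. (ulet i, False) \<notin> set v"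
  proof (cases "v \<in> words tlets")
    case False
    then obtain i s where i: "(i, s) \<in> set v" "i \<notin> tlets" "i \<in> qlets"
      using less.prems(1) unfolding words_def lists_eq_set by force
    then obtain j where j: "i = ulet j" "j \<in> inf_idx" by (auto simp: qlets_def)
    have inf: "j \<in> inf_idx" if "(ulet j, s) \<in> set v" for j s
      using that less.prems(1) by (auto simp: words_def qlets_def tlets_def)
    show ?thesis
    proof (cases "\<exists>j. (ulet j, False) \<in> set v")
      case True
      then show ?thesis using that(2) inf by blast
    next
      case False
      then have "(ulet j, True) \<in> set v" using i j by (cases s) auto
      then show ?thesis using that(3)[of j] j False by blast
    qed
  qed blast
  then show ?case
  proof cases
    case 1
    then have "short_twords N [(v, True)] \<and> length [(v, True)] \<le> 2 ^ u_count v \<and>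
        ce ((2 ^ u_count v - 1) * (2 * (2 * N + 1)\<^sup>2 + 1)) (conj_a v) (conj_sum [(v, True)])"
      using less.prems by (simp add: sconj_def)
    then show ?thesis by blast
  next
    case 2
    define v1 where "v1 = remove1 (ulet j, False) v"
    define v' where "v' = remove1 (ulet j, True) v1"
    have "0 < signed_count (ulet j) v1"
      using 2 less.prems(3)[of j] by (simp add: v1_def signed_count_remove1)
    then have in1: "(ulet j, True) \<in> set v1" using signed_count_nonpos[of "ulet j" v1] by fastforce
    have sc: "signed_count i v' = signed_count i v" for i
      using 2 in1 by (simp add: v'_def v1_def signed_count_remove1)
    have w: "v' \<in> words qlets" "length v' \<le> length v" "u_count v = Suc (Suc (u_count v'))"
      using less.prems(1) 2(1) in1 u_count_remove1[of "(ulet j, False)" v] u_count_remove1[of "(ulet j, True)" v1]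
      by (auto simp: v'_def v1_def words_remove1 length_remove1)
    obtain L where L: "short_twords N L" "length L \<le> 2 ^ u_count v'"
        "ce ((2 ^ u_count v' - 1) * (D + 1)) (conj_a v') (conj_sum L)"
      using less.hyps[of v'] less.prems w sc unfolding D_def by auto
    have "ce (D + (2 ^ u_count v' - 1) * (D + 1)) (conj_a v) (conj_sum L)"
      using cost_equiv_trans[OF Q L(3), of v] less.prems w sc by simp
    moreover have "D + (2 ^ u_count v' - 1) * (D + 1) \<le> (2 ^ u_count v - 1) * (D + 1)"
    proof -
      have "Suc (2 ^ u_count v' - 1) \<le> 2 ^ u_count v - 1" using w(3) by (simp add: le_diff_conv2 less_eq_Suc_le[symmetric])
      then have "Suc (2 ^ u_count v' - 1) * (D + 1) \<le> (2 ^ u_count v - 1) * (D + 1)"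
        by (rule mult_right_mono) simp
      then show ?thesis unfolding mult_Suc by linarith
    qed
    moreover have "length L \<le> 2 ^ u_count v" using L(2) w(3) by simp
    ultimately show ?thesis using L(1) cost_equiv_mono unfolding D_def by blast
  next
    case 3
    define v' where "v' = remove1 (ulet j, True) v"
    let ?w = "v' @ [(tlet j, True)]"
    have sc: "signed_count i v = signed_count i (v' @ [(ulet j, True)])" for i
      using 3(1) by (simp add: v'_def signed_count_remove1)
    have no: "(ulet i, False) \<notin> set v'" for i
      using 3(3) notin_set_remove1 unfolding v'_def by metis
    have tj: "tlet j \<in> tlets" using 3(2) by (simp add: tlets_def inf_idx_def)
    have v': "v' \<in> words qlets" using less.prems(1) by (simp add: v'_def words_remove1)
    have uv: "u_count v = Suc (u_count v')"
      using u_count_remove1[OF 3(1)] by (simp add: v'_def)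
    have "length v = Suc (length v')"
      using 3(1) length_pos_if_in_set[OF 3(1)] by (simp add: v'_def length_remove1)
    moreover have "tlet j \<in> qlets" "ulet j \<in> qlets" using tj 3(2) by (simp_all add: qlets_def)
    ultimately have w: "v' \<in> words qlets" "?w \<in> words qlets" "ulet j \<in> qlets"
        "length v = Suc (length v')" "u_count v = Suc (u_count v')" "u_count ?w = u_count v'"
      using v' uv tj by simp_all
    obtain L1 where L1: "short_twords N L1" "length L1 \<le> 2 ^ u_count v'"
        "ce ((2 ^ u_count v' - 1) * (D + 1)) (conj_a v') (conj_sum L1)"
      using less.hyps[of v'] less.prems w signed_count_nonneg[OF no] unfolding D_def by auto
    have "0 \<le> signed_count (ulet i) ?w" for i
      using no by (intro signed_count_nonneg) auto
    then obtain L2 where L2: "short_twords N L2" "length L2 \<le> 2 ^ u_count v'"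
        "ce ((2 ^ u_count v' - 1) * (D + 1)) (conj_a ?w) (conj_sum L2)"
      using less.hyps[of ?w] less.prems w unfolding D_def by auto
    have "ce D (conj_a v) (conj_a (v' @ [(ulet j, True)]))"
      by (rule Q) (use less.prems w sc in auto)
    also have "conj_a (v' @ [(ulet j, True)]) = fg v' + (gen (ulet j) + gen 0 - gen (ulet j)) - fg v'"
      by (rule conj_a_append)
    also have "ce 1 \<dots> (fg v' + (gen 0 + conj_a [(tlet j, True)]) - fg v')"
      by (rule cost_equiv_conj[OF cost_u[OF 3(2)]])
    also have "fg v' + (gen 0 + conj_a [(tlet j, True)]) - fg v' = conj_a v' + conj_a ?w"
      unfolding conj_a_append by (simp add: group_normalize del: add_uminus_conv_diff)
    also have "ce ((2 ^ u_count v' - 1) * (D + 1) + (2 ^ u_count v' - 1) * (D + 1)) \<dots> (conj_sum L1 + conj_sum L2)"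
      by (rule cost_equiv_add[OF L1(3) L2(3)])
    finally have "ce (D + 1 + ((2 ^ u_count v' - 1) * (D + 1) + (2 ^ u_count v' - 1) * (D + 1)))
        (conj_a v) (conj_sum (L1 @ L2))"
      by simp
    moreover have "D + 1 + ((2 ^ u_count v' - 1) * (D + 1) + (2 ^ u_count v' - 1) * (D + 1))
        = (2 ^ u_count v - 1) * (D + 1)"
    proof -
      have "2 ^ u_count v - 1 = 1 + ((2 ^ u_count v' - 1) + (2 ^ u_count v' - 1 :: nat))"
      proof -
        have "(2::nat) ^ u_count v = 2 * 2 ^ u_count v'" "(1::nat) \<le> 2 ^ u_count v'"
          using w(5) by simp_all
        then show ?thesis by linarith
      qed
      then show ?thesis by (simp only: distrib_right mult_1)
    qed
    moreover have "length (L1 @ L2) \<le> 2 ^ u_count v" using L1(2) L2(2) w(5) by simp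
    moreover have "short_twords N (L1 @ L2)" using L1 L2 by simp
    ultimately show ?thesis unfolding D_def by metis
  qed
qed

text \<open>Prefixed to a word of length at most \<open>n\<close>, it makes the exponent of every
  \<open>u_j\<close> nonnegative in front of each letter of that word.\<close>

definition uword :: "nat \<Rightarrow> nat word"
  where "uword n = concat (map (\<lambda>j. replicate n (ulet j, True)) (filter (\<lambda>j. m j = 0) [0..<k]))"

lemma length_uword: "length (uword n) \<le> k * n"
proof -
  have "length (uword n) = length (filter (\<lambda>j. m j = 0) [0..<k]) * n"
    by (simp add: uword_def length_concat o_def sum_list_triv)
  also have "\<dots> \<le> k * n" using length_filter_le[of _ "[0..<k]"] by (intro mult_right_mono) auto
  finally show ?thesis .
qed

lemma uword_words: "uword n \<in> words qlets"
  by (auto simp: uword_def words_def qlets_def inf_idx_def)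

lemma signed_count_uword: "j \<in> inf_idx \<Longrightarrow> signed_count (ulet j) (uword n) = int n"
proof -
  have *: "distinct js \<Longrightarrow> signed_count (ulet j) (concat (map (\<lambda>j. replicate n (ulet j, True)) js))
      = (if j \<in> set js then int n else 0)" for js
    by (induction js) (auto simp: signed_count_replicate)
  then show "j \<in> inf_idx \<Longrightarrow> signed_count (ulet j) (uword n) = int n"
    unfolding uword_def inf_idx_def by (subst *) auto
qed

definition qpart :: "nat word \<Rightarrow> nat word"
  where "qpart w = filter (\<lambda>a. fst a \<noteq> 0) w"

lemma length_qpart: "length (qpart w) \<le> length w"
  unfolding qpart_def by (rule length_filter_le)

lemma qpart_words: "w \<in> words lets \<Longrightarrow> qpart w \<in> words qlets"
  by (auto simp: qpart_def words_def lets_def)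

lemma signed_count_qpart: "i \<noteq> 0 \<Longrightarrow> signed_count i (qpart w) = signed_count i w"
  unfolding qpart_def by (induction i w rule: signed_count.induct) auto

lemma abs_signed_count_le: "\<bar>signed_count i w\<bar> \<le> int (length w)"
  using sum_abs_signed_count_le[of "{i}" w] by simp

text \<open>Each letter \<open>a\<close> of \<open>p\<close> is pulled to the left as a conjugate by
  \<open>uword n\<close> times the part of the preceding prefix without \<open>a\<close>. This
  conjugator has at most \<open>k * n + n\<close> letters, whence \<open>(k + 1) * n\<close>, and
  \<open>conj_a_expand\<close> applies to it.\<close>

lemma cost_collect:
  "p \<in> words lets \<Longrightarrow> length p \<le> n \<Longrightarrow> \<exists>L. short_twords ((k + 1) * n) L \<and>
     length L \<le> length p * 2 ^ ((k + 1) * n) \<and>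
     ce (length p * (2 ^ ((k + 1) * n) * (2 * (2 * ((k + 1) * n) + 1)\<^sup>2 + 1)))
       (fg (uword n @ p)) (conj_sum L + fg (uword n @ qpart p))"
proof (induction p rule: rev_induct)
  case Nil
  show ?case by (rule exI[of _ "[]"]) (simp add: qpart_def)
next
  case (snoc a p)
  define N where "N = (k + 1) * n"
  define D where "D = 2 * (2 * N + 1)\<^sup>2 + 1"
  obtain i s where a: "a = (i, s)" by force
  obtain L where L: "short_twords N L" "length L \<le> length p * 2 ^ N"
      "ce (length p * (2 ^ N * D)) (fg (uword n @ p)) (conj_sum L + fg (uword n @ qpart p))"
    using snoc unfolding N_def D_def by auto
  have "ce (length p * (2 ^ N * D)) (fg (uword n @ p) + fg [a]) (conj_sum L + fg (uword n @ qpart p) + fg [a])"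
    using L(3) by (simp only: cost_equiv_right)
  then have pa: "ce (length p * (2 ^ N * D)) (fg (uword n @ p @ [a])) (conj_sum L + (fg (uword n @ qpart p) + fg [a]))"
    by (simp only: fg_append add.assoc)
  show ?case
  proof (cases "i = 0")
    case False
    then have "fg (uword n @ qpart p) + fg [a] = fg (uword n @ qpart (p @ [a]))"
      by (simp add: qpart_def a flip: fg_append)
    then have "ce (length (p @ [a]) * (2 ^ N * D)) (fg (uword n @ p @ [a])) (conj_sum L + fg (uword n @ qpart (p @ [a])))"
      using pa by (auto elim: cost_equiv_mono)
    then show ?thesis using L unfolding N_def D_def
      by (intro exI[of _ L]) (auto intro: le_trans)
  next
    case True
    let ?v = "uword n @ qpart p"
    have v: "?v \<in> words qlets" using snoc.prems by (simp add: uword_words qpart_words)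
    have len: "length ?v \<le> N"
      using snoc.prems length_uword[of n] length_qpart[of p] unfolding N_def by simp
    have "0 \<le> signed_count (ulet j) ?v" if "j \<in> inf_idx" for j
      using that snoc.prems abs_signed_count_le[of "ulet j" p] by (simp add: signed_count_uword signed_count_qpart)
    then obtain L1 where L1: "short_twords N L1" "length L1 \<le> 2 ^ u_count ?v"
        "ce ((2 ^ u_count ?v - 1) * D) (conj_a ?v) (conj_sum L1)"
      using conj_a_expand[OF v len] unfolding D_def by blast
    have "u_count ?v \<le> N" using u_count_le[of ?v] len by linarith
    then have pow: "2 ^ u_count ?v \<le> (2::nat) ^ N" by (rule power_increasing) simp
    have c1: "ce (2 ^ N * D) (conj_a ?v) (conj_sum L1)"
      by (rule cost_equiv_mono[OF L1(3)], rule mult_right_mono) (use pow in linarith, simp)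
    define L2 where "L2 = (if s then L1 else flip L1)"
    have "ce (2 ^ N * D) (sconj (?v, s)) (conj_sum L2)"
      using c1 cost_equiv_minus[OF c1] by (simp add: sconj_def L2_def conj_sum_flip)
    moreover have "fg ?v + fg [a] = sconj (?v, s) + fg ?v"
      unfolding a True fg_letter[of 0 s] sconj_def by (simp add: group_normalize del: add_uminus_conv_diff)
    ultimately have "ce (2 ^ N * D) (conj_sum L + (fg ?v + fg [a])) (conj_sum L + (conj_sum L2 + fg ?v))"
      by (simp only: cost_equiv_left cost_equiv_right)
    from cost_equiv_trans[OF pa this]
    have "ce (length p * (2 ^ N * D) + 2 ^ N * D) (fg (uword n @ p @ [a])) (conj_sum (L @ L2) + fg (uword n @ qpart (p @ [a])))"
      by (simp add: qpart_def a True add.assoc)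
    moreover have "short_twords N (L @ L2)" using L(1) L1(1) by (simp add: L2_def)
    moreover have "length L1 \<le> 2 ^ N" using L1(2) pow by (rule le_trans)
    then have "length L2 \<le> 2 ^ N" by (simp add: L2_def)
    then have "length (L @ L2) \<le> length (p @ [a]) * 2 ^ N" using L(2) by simp
    ultimately show ?thesis unfolding N_def D_def
      by (intro exI[of _ "L @ L2"]) (simp add: add.commute)
  qed
qed

lemma cost_null_collect:
  assumes w: "w \<in> words lets" "length w \<le> n"
    and null: "\<And>i. i \<in> qlets \<Longrightarrow> int (modulus i) dvd signed_count i w"
  shows "\<exists>L. short_twords ((k + 1) * n) L \<and> length L \<le> n * 2 ^ ((k + 1) * n) \<and>
    ce (n * (2 ^ ((k + 1) * n) * (2 * (2 * ((k + 1) * n) + 1)\<^sup>2 + 1)) + (n + 1)\<^sup>2)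
      (fg (uword n) + fg w - fg (uword n)) (conj_sum L)"
proof -
  define N where "N = (k + 1) * n"
  define D where "D = 2 * (2 * N + 1)\<^sup>2 + 1"
  obtain L where L: "short_twords N L" "length L \<le> length w * 2 ^ N"
      "ce (length w * (2 ^ N * D)) (fg (uword n @ w)) (conj_sum L + fg (uword n @ qpart w))"
    using cost_collect[OF w] unfolding N_def D_def by blast
  have "0 \<notin> qlets" by (auto simp: qlets_def tlets_def)
  then have "ce ((length (qpart w) + 1)\<^sup>2) (fg (qpart w)) 0"
    using null by (intro cost_null_word qpart_words w) (metis signed_count_qpart)
  moreover have "(length (qpart w) + 1)\<^sup>2 \<le> (n + 1)\<^sup>2"
    using w(2) length_qpart[of w] by (intro power_mono) auto
  ultimately have q: "ce ((n + 1)\<^sup>2) (fg (qpart w)) 0" by (rule cost_equiv_mono)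
  have "ce (n * (2 ^ N * D)) (fg (uword n) + fg w) (conj_sum L + (fg (uword n) + fg (qpart w)))"
    using cost_equiv_mono[OF L(3), of "n * (2 ^ N * D)"] w(2) by (simp add: fg_append)
  also have "ce ((n + 1)\<^sup>2) \<dots> (conj_sum L + (fg (uword n) + 0))"
    unfolding cost_equiv_left by (rule q)
  finally have "ce (n * (2 ^ N * D) + (n + 1)\<^sup>2) (fg (uword n) + fg w) (conj_sum L + fg (uword n))"
    by simp
  then have "ce (n * (2 ^ N * D) + (n + 1)\<^sup>2) (fg (uword n) + fg w - fg (uword n)) (conj_sum L)"
    using cost_equiv_right[of _ _ "fg (uword n) + fg w - fg (uword n)" "fg (uword n)" "conj_sum L"]
    by simp
  moreover have "length L \<le> n * 2 ^ N" using L(2) w(2) by (meson le_trans mult_le_mono1)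
  ultimately show ?thesis using L(1) unfolding N_def D_def by blast
qed

end

section \<open>A faithful module\<close>

lemma signed_count_reduce [simp]: "signed_count i (reduce w) = signed_count i w"
proof (induction w)
  case (Cons a w)
  have "signed_count i (cancel_cons a v) = signed_count i (a # v)" for v
    by (cases v; cases a) (auto simp: cancel_cons_def inv_letter_def)
  then show ?case using Cons by (cases a) (simp add: reduce_def)
qed (simp add: reduce_def)

context presentation
begin

definition shift :: "nat \<Rightarrow> int \<Rightarrow> ((nat \<Rightarrow> int) \<Rightarrow> int) \<Rightarrow> (nat \<Rightarrow> int) \<Rightarrow> int"
  where "shift j c f = (\<lambda>x. f (x(j := x j - c)))"

text \<open>Laurent series, in the infinite directions, over the group ring: here \<open>1 + t\<^sub>j\<close> is invertible.\<close>

definition laurent :: "((nat \<Rightarrow> int) \<Rightarrow> int) set"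
  where "laurent = {f. (\<forall>x y. congr x y \<longrightarrow> f x = f y) \<and> (\<forall>j\<in>inf_idx. \<exists>N. \<forall>x. x j < N \<longrightarrow> f x = 0)}"

definition one_plus :: "nat \<Rightarrow> ((nat \<Rightarrow> int) \<Rightarrow> int) \<Rightarrow> (nat \<Rightarrow> int) \<Rightarrow> int"
  where "one_plus j f = (\<lambda>x. f x + shift j 1 f x)"

text \<open>The letter \<open>a\<close> acts as translation by the basis element at the origin, so
  the action is affine and the orbit of the zero series records coefficients. Since
  \<open>fgroup\<close> is free on all natural numbers, letters outside the presentation must act
  invertibly as well.\<close>

definition step :: "nat \<times> bool \<Rightarrow> ((nat \<Rightarrow> int) \<Rightarrow> int) \<Rightarrow> (nat \<Rightarrow> int) \<Rightarrow> int"
  where "step a f =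
    (if fst a = 0 then \<lambda>x. f x + delta ([], snd a) x
     else if odd (fst a) then shift ((fst a - 1) div 2) (if snd a then 1 else - 1) f
     else if (fst a - 1) div 2 \<in> inf_idx
       then (if snd a then one_plus else (\<lambda>j. inv_into laurent (one_plus j))) ((fst a - 1) div 2) f
     else f)"

lemma step_simps:
  "step (0, s) f = (\<lambda>x. f x + delta ([], s) x)"
  "step (tlet j, s) f = shift j (if s then 1 else - 1) f"
  "j \<in> inf_idx \<Longrightarrow> step (ulet j, True) f = one_plus j f"
  "j \<in> inf_idx \<Longrightarrow> step (ulet j, False) f = inv_into laurent (one_plus j) f"
  by (simp_all add: step_def tlet_def ulet_def)

lemma congr_inf_idx: "congr x y \<Longrightarrow> j \<in> inf_idx \<Longrightarrow> x j = y j"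
  by (fastforce simp: congr_def inf_idx_def)

lemma laurent_shift: "f \<in> laurent \<Longrightarrow> shift j c f \<in> laurent"
proof -
  assume f: "f \<in> laurent"
  have "\<exists>N. \<forall>x. x i < N \<longrightarrow> shift j c f x = 0" if i: "i \<in> inf_idx" for i
  proof -
    obtain N where "\<And>x. x i < N \<Longrightarrow> f x = 0" using f i unfolding laurent_def by blast
    note N = this
    have "shift j c f x = 0" if "x i < N - \<bar>c\<bar>" for x
      unfolding shift_def by (rule N) (use that in \<open>cases "i = j"; simp\<close>)
    then show ?thesis by blast
  qed
  moreover have "shift j c f x = shift j c f y" if "congr x y" for x y
  proof -
    have "congr (x(j := x j - c)) (y(j := y j - c))" using that by (auto simp: congr_def)
    then show ?thesis using f unfolding laurent_def shift_def by blast
  qed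
  ultimately show ?thesis unfolding laurent_def by blast
qed

lemma laurent_add: "f \<in> laurent \<Longrightarrow> g \<in> laurent \<Longrightarrow> (\<lambda>x. f x + g x) \<in> laurent"
proof -
  assume f: "f \<in> laurent" and g: "g \<in> laurent"
  have "\<exists>N. \<forall>x. x i < N \<longrightarrow> f x + g x = 0" if i: "i \<in> inf_idx" for i
  proof -
    obtain N N' where "\<And>x. x i < N \<Longrightarrow> f x = 0" "\<And>x. x i < N' \<Longrightarrow> g x = 0"
      using f g i unfolding laurent_def by blast
    then have "\<forall>x. x i < min N N' \<longrightarrow> f x + g x = 0" by auto
    then show ?thesis by blast
  qed
  moreover have "f x + g x = f y + g y" if "congr x y" for x y
  proof -
    have "f x = f y" "g x = g y" using f g that unfolding laurent_def by blast+
    then show ?thesis by simp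
  qed
  ultimately show ?thesis unfolding laurent_def by blast
qed

lemma laurent_delta: "delta e \<in> laurent"
proof -
  have "\<exists>N. \<forall>x. x i < N \<longrightarrow> delta e x = 0" if i: "i \<in> inf_idx" for i
  proof -
    have "delta e x = 0" if "x i < cvec (fst e) i" for x
      using that congr_inf_idx[OF _ i, of x "cvec (fst e)"] by (cases "congr x (cvec (fst e))") (simp_all add: delta_def)
    then show ?thesis by blast
  qed
  moreover have "delta e x = delta e y" if "congr x y" for x y
  proof -
    have "congr x (cvec (fst e)) \<longleftrightarrow> congr y (cvec (fst e))"
      using that congr_sym congr_trans by blast
    then show ?thesis by (simp add: delta_def)
  qed
  ultimately show ?thesis unfolding laurent_def by blast
qed

lemma laurent_zero: "(\<lambda>_. 0) \<in> laurent"
  by (simp add: laurent_def)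

lemma laurent_one_plus: "f \<in> laurent \<Longrightarrow> one_plus j f \<in> laurent"
  unfolding one_plus_def by (intro laurent_add laurent_shift)

text \<open>If \<open>f\<close> and \<open>g\<close> have the same image, \<open>f - g\<close>
  changes only its sign under a unit step in direction \<open>j\<close>, and far enough down both
  vanish.\<close>

lemma inj_one_plus:
  assumes j: "j \<in> inf_idx"
  shows "inj_on (one_plus j) laurent"
proof (rule inj_onI)
  fix f g assume f: "f \<in> laurent" and g: "g \<in> laurent" and eq: "one_plus j f = one_plus j g"
  obtain N N' where N: "\<And>x. x j < N \<Longrightarrow> f x = 0" "\<And>x. x j < N' \<Longrightarrow> g x = 0"
    using f g j unfolding laurent_def by blast
  have *: "f x - g x = - (f (x(j := x j - 1)) - g (x(j := x j - 1)))" for x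
    using fun_cong[OF eq, of x] by (simp add: one_plus_def shift_def)
  have iter: "\<bar>f x - g x\<bar> = \<bar>f (x(j := x j - int n)) - g (x(j := x j - int n))\<bar>" for x n
  proof (induction n)
    case (Suc n)
    have "x j - int n - 1 = x j - int (Suc n)" by simp
    then show ?case using Suc *[of "x(j := x j - int n)"] by (simp only: fun_upd_same fun_upd_upd abs_minus_cancel)
  qed simp
  show "f = g"
  proof
    fix x
    have "f (x(j := x j - int (nat (\<bar>x j - N\<bar> + \<bar>x j - N'\<bar> + 1)))) = 0"
         "g (x(j := x j - int (nat (\<bar>x j - N\<bar> + \<bar>x j - N'\<bar> + 1)))) = 0"
      by (rule N; simp)+
    then show "f x = g x" using iter[of x "nat (\<bar>x j - N\<bar> + \<bar>x j - N'\<bar> + 1)"] by simp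
  qed
qed

lemma surj_one_plus:
  assumes j: "j \<in> inf_idx" and g: "g \<in> laurent"
  shows "\<exists>f\<in>laurent. one_plus j f = g"
proof -
  obtain N where N: "\<And>x. x j < N \<Longrightarrow> g x = 0" using g j unfolding laurent_def by blast
  \<comment> \<open>The geometric series of \<open>1 / (1 + t_j)\<close>, finite at every point
    because \<open>g\<close> vanishes below \<open>N\<close>. The bound through \<open>nat\<close>
    makes the sum empty there.\<close>
  define f where "f x = (\<Sum>i<nat (x j - N + 1). (- 1) ^ i * g (x(j := x j - int i)))" for x
  have "f \<in> laurent" unfolding laurent_def
  proof (intro CollectI conjI ballI allI impI)
    fix x y assume xy: "congr x y"
    then have "x j = y j" using j by (rule congr_inf_idx)
    moreover have "g (x(j := x j - c)) = g (y(j := y j - c))" for c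
    proof -
      have "congr (x(j := x j - c)) (y(j := y j - c))" using xy by (auto simp: congr_def)
      then show ?thesis using g unfolding laurent_def by blast
    qed
    ultimately show "f x = f y" unfolding f_def by simp
  next
    fix i assume "i \<in> inf_idx"
    then obtain N' where N': "\<And>x. x i < N' \<Longrightarrow> g x = 0" using g unfolding laurent_def by blast
    have "f x = 0" if "x i < (if i = j then N else N')" for x
      using that N' by (auto simp: f_def split: if_splits)
    then show "\<exists>N. \<forall>x. x i < N \<longrightarrow> f x = 0" by blast
  qed
  moreover have "one_plus j f = g"
  proof
    fix x
    show "one_plus j f x = g x"
    proof (cases "x j < N")
      case True
      then show ?thesis using N[of x] by (simp add: one_plus_def shift_def f_def)
    next
      case False
      then have n: "nat (x j - N + 1) = Suc (nat (x j - N))" by simp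
      have "f x = g x + (\<Sum>i<nat (x j - N). (- 1) ^ Suc i * g (x(j := x j - int (Suc i))))"
        unfolding f_def n by (subst sum.lessThan_Suc_shift) simp
      moreover have "f (x(j := x j - 1)) = (\<Sum>i<nat (x j - N). (- 1) ^ i * g (x(j := x j - int (Suc i))))"
        unfolding f_def by (intro sum.cong) (auto simp: algebra_simps)
      ultimately show ?thesis by (simp add: one_plus_def shift_def sum_negf)
    qed
  qed
  ultimately show ?thesis by blast
qed

lemma inv_one_plus:
  assumes j: "j \<in> inf_idx" and f: "f \<in> laurent"
  shows "inv_into laurent (one_plus j) f \<in> laurent"
    "one_plus j (inv_into laurent (one_plus j) f) = f"
    "inv_into laurent (one_plus j) (one_plus j f) = f"
proof -
  have im: "f \<in> one_plus j ` laurent" using surj_one_plus[OF j f] by auto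
  show "inv_into laurent (one_plus j) f \<in> laurent" by (rule inv_into_into[OF im])
  show "one_plus j (inv_into laurent (one_plus j) f) = f" by (rule f_inv_into_f[OF im])
  show "inv_into laurent (one_plus j) (one_plus j f) = f"
    by (rule inv_into_f_f[OF inj_one_plus[OF j] f])
qed

lemma shift_shift: "shift j c (shift j d f) = shift j (c + d) f"
  by (auto simp: shift_def algebra_simps)

lemma shift_zero [simp]: "shift j 0 f = f"
  by (simp add: shift_def)

lemma delta_neg: "delta (v, \<not> s) x = - delta (v, s) x"
  by (simp add: delta_def)

lemma letter_action_laurent: "letter_action laurent step"
proof
  fix f a assume f: "f \<in> laurent"
  show "step a f \<in> laurent" unfolding step_def
    using f by (auto intro: laurent_add laurent_delta laurent_shift laurent_one_plus inv_one_plus)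
  obtain i s where a: "a = (i, s)" by force
  show "step a (step (inv_letter a) f) = f"
    unfolding step_def a inv_letter_def
    using f by (auto simp: delta_neg shift_shift inv_one_plus)
qed

end

sublocale presentation \<subseteq> M: letter_action laurent step
  by (rule letter_action_laurent)

context presentation
begin

section \<open>The action respects the relators\<close>

lemma foldr_step_tword:
  "v \<in> words tlets \<Longrightarrow> foldr step v f = (\<lambda>x. f (\<lambda>j. x j - signed_count (tlet j) v))"
proof (induction v)
  case (Cons a v)
  then obtain j s where a: "a = (tlet j, s)" by (cases a) (auto simp: tlets_def)
  have "(\<lambda>i. (x(j := x j - (if s then 1 else - 1))) i - signed_count (tlet i) v)
      = (\<lambda>i. x i - signed_count (tlet i) (a # v))" for x :: "nat \<Rightarrow> int"
    by (auto simp: a)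
  then show ?case using Cons by (simp add: a step_simps shift_def del: fun_upd_apply)
qed simp

lemma sconj_eq_fg: "sconj (v, s) = fg (v @ [(0, s)] @ inv_word v)"
  unfolding fg_append fg_inv_word fg_letter[of 0 s] sconj_def
  by (simp add: group_normalize del: add_uminus_conv_diff)

lemma act_sconj:
  assumes "v \<in> words tlets" "f \<in> laurent"
  shows "M.act (sconj (v, s)) f = (\<lambda>x. f x + delta (v, s) x)"
proof -
  have "congr (\<lambda>j. x j - signed_count (tlet j) v) (cvec []) \<longleftrightarrow> congr x (cvec v)" for x
    by (simp add: congr_def cvec_def)
  then have "delta ([], s) (\<lambda>j. x j - signed_count (tlet j) v) = delta (v, s) x" for x
    by (simp add: delta_def)
  then show ?thesis
    using assms by (simp add: sconj_eq_fg M.act_fg foldr_step_tword inv_words step_simps)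
qed

lemma act_conj_sum:
  "short_twords N L \<Longrightarrow> f \<in> laurent \<Longrightarrow> M.act (conj_sum L) f = (\<lambda>x. f x + total L x)"
proof (induction L)
  case (Cons e L)
  obtain v s where e: "e = (v, s)" by force
  have "(\<lambda>x. f x + total L x) \<in> laurent"
    using Cons M.act_closed by (metis short_twords_simps(2))
  then show ?case using Cons by (simp add: M.act_add e act_sconj ac_simps)
qed simp

lemma step_commute:
  assumes "i \<in> qlets" "j \<in> qlets"
  shows "step (i, True) (step (j, True) f) = step (j, True) (step (i, True) f)"
proof -
  have sh: "shift i 1 (shift j 1 f) = shift j 1 (shift i 1 f)" for i j f
    unfolding shift_def by (cases "i = j") (auto simp: fun_upd_twist)
  have so: "shift i 1 (one_plus j f) = one_plus j (shift i 1 f)" for i j f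
  proof -
    have "shift i 1 (one_plus j f) = (\<lambda>x. shift i 1 f x + shift i 1 (shift j 1 f) x)"
      by (simp add: one_plus_def shift_def)
    then show ?thesis unfolding one_plus_def sh[of i j] .
  qed
  have oo: "one_plus i (one_plus j f) = one_plus j (one_plus i f)" for i j f
  proof -
    have *: "one_plus i (one_plus j f) = (\<lambda>x. f x + shift j 1 f x + (shift i 1 f x + shift i 1 (shift j 1 f) x))" for i j
      by (simp add: one_plus_def shift_def)
    show ?thesis unfolding *[of i j] *[of j i] sh[of i j] by (simp add: ac_simps)
  qed
  consider a b where "i = tlet a" "j = tlet b"
    | a b where "i = tlet a" "j = ulet b" "b \<in> inf_idx"
    | a b where "i = ulet a" "j = tlet b" "a \<in> inf_idx"
    | a b where "i = ulet a" "j = ulet b" "a \<in> inf_idx" "b \<in> inf_idx"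
    using assms unfolding qlets_def tlets_def by blast
  then show ?thesis
  proof cases
    case 1 then show ?thesis using sh[of a b f] by (simp add: step_simps)
  next
    case 2 then show ?thesis using so[of a b f] by (simp add: step_simps)
  next
    case 3 then show ?thesis using so[of b a f] by (simp add: step_simps)
  next
    case 4 then show ?thesis using oo[of a b f] by (simp add: step_simps)
  qed
qed

lemma rels_cases [consumes 1, case_names comm power u box]:
  assumes "w \<in> rels"
  obtains i j where "i \<in> qlets" "j \<in> qlets" "w = [(i, True), (j, True), (i, False), (j, False)]"
    | i where "i \<in> qlets" "w = letter_power i (int (modulus i))"
    | j where "j \<in> inf_idx" "w = [(ulet j, True), (0, True), (ulet j, False)]
          @ inv_word [(0, True), (tlet j, True), (0, True), (tlet j, False)]"
    | \<alpha> where "w = [(0, True)] @ (tword \<alpha> @ [(0, True)] @ inv_word (tword \<alpha>))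
          @ [(0, False)] @ (tword \<alpha> @ [(0, False)] @ inv_word (tword \<alpha>))"
  using assms unfolding rels_def
proof (elim UnE)
  assume "w \<in> (\<lambda>(i, j). [(i, True), (j, True), (i, False), (j, False)]) ` (qlets \<times> qlets)"
  then show thesis using that(1) by auto
qed (elim imageE, erule (1) that(2) that(3), elim imageE, erule (1) that(3), elim imageE, erule that(4))

lemma act_relator:
  assumes r: "r \<in> fg ` R" and f: "f \<in> laurent"
  shows "M.act r f = f"
proof -
  have close: "step a g \<in> laurent" if "g \<in> laurent" for a g
    using that by (rule M.step_closed)
  have inv: "step (i, True) (step (i, False) g) = g" "step (i, False) (step (i, True) g) = g"
    if "g \<in> laurent" for i g
    using M.step_inverse[OF that, of "(i, True)"] M.step_inverse[OF that, of "(i, False)"]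
    by (simp_all add: inv_letter_def)
  obtain w where w: "w \<in> rels" "r = fg w" using r unfolding fg_R by blast
  from w(1) show ?thesis
  proof (cases rule: rels_cases)
    case (comm i j)
    have "step (i, True) (step (j, True) (step (i, False) (step (j, False) f))) = f"
      using f by (simp add: step_commute[OF comm(1,2)] inv close)
    then show ?thesis using f by (simp add: w comm M.act_fg)
  next
    case (power i)
    then consider j where "i = tlet j" | j where "i = ulet j"
      unfolding qlets_def tlets_def by blast
    then show ?thesis
    proof cases
      case 1
      have "foldr step (replicate n (tlet j, True)) f = shift j (int n) f" for n
        by (induction n) (simp_all add: step_simps shift_shift)
      moreover have "shift j (int (m j)) f = f"
      proof
        fix x
        have "congr (x(j := x j - int (m j))) x" by (auto simp: congr_def)
        then show "shift j (int (m j)) f x = f x" using f unfolding laurent_def shift_def by blast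
      qed
      ultimately show ?thesis using f by (simp add: w power 1 M.act_fg letter_power_def)
    next
      case 2
      then show ?thesis using f by (simp add: w power)
    qed
  next
    case (u j)
    let ?v = "[(ulet j, True), (0, True), (ulet j, False)]"
      and ?w = "[(0, True), (tlet j, True), (0, True), (tlet j, False)]"
    \<comment> \<open>The two sides of the relator are compared on \<open>h\<close>, the image of
      \<open>f\<close> under the inverse of the right side; this avoids computing with that
      inverse.\<close>
    have eq: "foldr step ?v h = foldr step ?w h" if h: "h \<in> laurent" for h
    proof -
      define g where "g = inv_into laurent (one_plus j) h"
      have hg: "h x = g x + g (x(j := x j - 1))" for x
        using fun_cong[OF inv_one_plus(2)[OF u(1) h], of x] by (simp add: g_def one_plus_def shift_def)
      have "foldr step ?v h = one_plus j (\<lambda>x. g x + delta ([], True) x)"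
        using u(1) by (simp add: step_simps g_def)
      moreover have "foldr step ?w h = (\<lambda>x. h x + delta ([], True) (x(j := x j - 1)) + delta ([], True) x)"
        by (simp add: step_simps shift_def)
      ultimately show ?thesis by (simp add: one_plus_def shift_def hg ac_simps)
    qed
    define h where "h = M.act (- fg ?w) f"
    have h: "h \<in> laurent" using f by (simp add: h_def M.act_closed)
    have "fg w = fg ?v + - fg ?w" using u(2) by (simp only: fg_append fg_inv_word)
    then have "M.act r f = M.act (fg ?v) h" using f by (simp only: w(2) M.act_add h_def)
    also have "\<dots> = M.act (fg ?w) h" using eq[OF h] by (simp only: M.act_fg[OF h])
    also have "\<dots> = f" using f by (simp only: h_def M.act_minus_cancel)
    finally show ?thesis .
  next
    case (box \<alpha>)
    \<comment> \<open>A box relator is itself a product of signed conjugates in which every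
      coefficient cancels.\<close>
    let ?L = "[([], True), (tword \<alpha>, True), ([], False), (tword \<alpha>, False)]"
    have "r = conj_sum ?L"
      by (simp add: w box sconj_eq_fg flip: fg_append)
    moreover have "short_twords (length (tword \<alpha>)) ?L" by (simp add: tword_words)
    then have "M.act (conj_sum ?L) f = (\<lambda>x. f x + total ?L x)" by (rule act_conj_sum[OF _ f])
    moreover have "total ?L x = 0" for x by (simp add: delta_def)
    ultimately show ?thesis by (simp only: add_0_right)
  qed
qed

lemma act_filling: "filling (fg ` R) l g \<Longrightarrow> f \<in> laurent \<Longrightarrow> M.act g f = f"
proof (induction arbitrary: f rule: filling.induct)
  case (filling_pos r l g h)
  then show ?case by (simp add: M.act_add M.act_closed act_relator M.act_minus_cancel)
next
  case (filling_neg r l g h)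
  have "M.act (- r) f = f" if "f \<in> laurent" for f
    using M.act_minus_cancel(1)[OF that, of r] act_relator[OF filling_neg.hyps(1) that] by simp
  then show ?case using filling_neg
    by (simp add: M.act_add M.act_closed M.act_minus_cancel del: add_uminus_conv_diff)
qed simp

text \<open>Acting on the zero series, a product of conjugates returns its coefficients, while a
  filled element fixes the series. This is the converse of
  \<open>cost_conj_sum_zero\<close>.\<close>

lemma total_filling:
  assumes "short_twords N L" "filling (fg ` R) l (conj_sum L)"
  shows "total L x = 0"
  using act_filling[OF assms(2) laurent_zero] act_conj_sum[OF assms(1) laurent_zero]
  by (simp add: fun_eq_iff)

section \<open>Exponent sums as invariants of the group\<close>

definition letter_count :: "nat \<Rightarrow> nat fgroup \<Rightarrow> int"
  where "letter_count i g = signed_count i (word_of g)"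

lemma letter_count_fg [simp]: "letter_count i (fg w) = signed_count i w"
  by (simp add: letter_count_def)

lemma letter_count_add [simp]: "letter_count i (g + h) = letter_count i g + letter_count i h"
  by (simp add: plus_fgroup_def) (simp add: letter_count_def)

lemma letter_count_minus [simp]: "letter_count i (- g) = - letter_count i g"
  by (simp add: uminus_fgroup_def) (simp add: letter_count_def)

lemma letter_count_filling:
  "filling (fg ` R) l g \<Longrightarrow> i \<in> qlets \<Longrightarrow> int (modulus i) dvd letter_count i g"
proof (induction rule: filling.induct)
  have rel: "int (modulus i) dvd letter_count i r" if i: "i \<in> qlets" and r: "r \<in> fg ` R" for r
  proof -
    have i0: "i \<noteq> 0" using i by (auto simp: qlets_def tlets_def tlet_def ulet_def)
    obtain w where w: "w \<in> rels" "r = fg w" using r unfolding fg_R by blast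
    from w(1) have "int (modulus i) dvd signed_count i w"
    proof (cases rule: rels_cases)
      case (u j)
      then have "signed_count i w = signed_count i [(tlet j, True), (tlet j, False)] "
        using i0 by (simp add: inv_letter_def)
      then show ?thesis by auto
    qed (use i0 in \<open>auto simp: inv_letter_def\<close>)
    then show ?thesis using w(2) by simp
  qed
  {
    case filling_zero
    then show ?case using letter_count_fg[of i "[]"] by simp
  next
    case (filling_pos r l g f)
    then show ?case using rel[of r] by simp
  next
    case (filling_neg r l g f)
    then show ?case using rel[of r] by (simp del: add_uminus_conv_diff)
  }
qed

section \<open>The exponential upper bound\<close>

text \<open>Conjugated by \<open>uword n\<close>, the word is equivalent to a product of conjugates
  by \<open>t\<close>-words, which is still null. Its coefficients vanish by
  \<open>total_filling\<close>, so \<open>cost_conj_sum_zero\<close> fills it at a bounded cost; the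
  filling known to exist enters only through these coefficients.\<close>

lemma cost_null:
  assumes w: "w \<in> words lets" "length w \<le> n" and null: "filling (fg ` R) l (fg w)"
  shows "\<exists>l \<le> (commute_const + 11) * 2 ^ (10 * (k + 1) * n). filling (fg ` R) l (fg w)"
proof -
  define N where "N = (k + 1) * n"
  define B :: nat where "B = 2 ^ N"
  define c1 where "c1 = n * (B * (2 * (2 * N + 1)\<^sup>2 + 1)) + (n + 1)\<^sup>2"
  have "int (modulus i) dvd signed_count i w" if "i \<in> qlets" for i
    using letter_count_filling[OF null that] by simp
  then obtain L where L: "short_twords N L" "length L \<le> n * B"
      "ce c1 (fg (uword n) + fg w - fg (uword n)) (conj_sum L)"
    using cost_null_collect[OF w] unfolding N_def B_def c1_def by blast
  have "\<exists>l. filling (fg ` R) l (fg (uword n) + fg w - fg (uword n))"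
    using filling_conj[OF null] by blast
  then have "\<exists>l. ce l (fg (uword n) + fg w - fg (uword n)) 0"
    unfolding cost_equiv_def by auto
  then have "\<exists>l. ce l (conj_sum L) 0"
    using cost_equiv_trans[OF cost_equiv_sym[OF L(3)]] by blast
  then have "\<exists>l. filling (fg ` R) l (conj_sum L)" unfolding cost_equiv_def by auto
  then have total: "total L x = 0" for x using total_filling[OF L(1)] by blast
  define c2 where "c2 = length L * (length L * (commute_const * 6 ^ (2 * N)) + 2 * (2 * N + 1)\<^sup>2)"
  have "ce c2 (conj_sum L) 0"
    unfolding c2_def by (rule cost_conj_sum_zero[OF L(1) total])
  with L(3) have "ce (c1 + c2) (fg (uword n) + fg w - fg (uword n)) 0"
    by (rule cost_equiv_trans)
  then have "ce (c1 + c2) (- fg (uword n) + (fg (uword n) + fg w - fg (uword n)) - - fg (uword n))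
      (- fg (uword n) + 0 - - fg (uword n))"
    by (rule cost_equiv_conj)
  then have "ce (c1 + c2) (fg w) 0" by (simp add: group_normalize del: add_uminus_conv_diff)
  \<comment> \<open>All factors are measured in powers of \<open>B = 2 ^ N\<close>: the list has at
    most \<open>n * B\<close>, hence at most \<open>B * B\<close> terms, and
    \<open>6 ^ (2 * N)\<close> is at most \<open>B ^ 6\<close> because 6 is below 8. Cancelling is
    quadratic in the list, so the exponent is \<open>4 + 6 = 10\<close>; 11 is the 7 from
    \<open>c1\<close> plus the 4 from sorting in \<open>c2\<close>.\<close>
  moreover have "c1 + c2 \<le> (commute_const + 11) * B ^ 10"
  proof -
    have "n \<le> N" by (simp add: N_def)
    moreover have "n < 2 ^ n" by simp
    moreover have "(2::nat) ^ n \<le> B" unfolding B_def using \<open>n \<le> N\<close> by (simp add: power_increasing)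
    ultimately have n: "n \<le> B" by linarith
    have B1: "1 \<le> B" by (simp add: B_def)
    have Bp: "B ^ i \<le> B ^ 10" if "i \<le> 10" for i using power_increasing[OF that B1] .
    have "(6::nat) ^ N \<le> 8 ^ N" by (rule power_mono) simp_all
    also have "(8::nat) ^ N = (2 ^ 3) ^ N" by simp
    also have "\<dots> = B ^ 3" by (simp only: B_def power_mult[symmetric] mult.commute)
    finally have six: "6 ^ N \<le> B ^ 3" .
    then have sq: "(2 * N + 1)\<^sup>2 \<le> 2 * B ^ 3" using square_le_six_power[of N] by linarith
    have "(6::nat) ^ (2 * N) = (6 ^ N)\<^sup>2" by (rule power_even_eq)
    also have "\<dots> \<le> (B ^ 3)\<^sup>2" by (rule power_mono[OF six]) simp
    finally have six2: "6 ^ (2 * N) \<le> B ^ 6" by (simp flip: power_mult)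
    have l: "length L \<le> B * B" using L(2) n by (meson le_trans mult_le_mono1)
    have "(n + 1)\<^sup>2 \<le> (2 * N + 1)\<^sup>2" using \<open>n \<le> N\<close> by (intro power_mono) auto
    moreover have "n * (B * (2 * (2 * N + 1)\<^sup>2 + 1)) \<le> B * (B * (2 * (2 * B ^ 3) + B ^ 3))"
      using n sq B1 by (intro mult_le_mono add_le_mono order_refl) (auto intro: one_le_power)
    ultimately have "c1 \<le> B * (B * (2 * (2 * B ^ 3) + B ^ 3)) + 2 * B ^ 3"
      unfolding c1_def using sq by linarith
    also have "\<dots> = 5 * B ^ 5 + 2 * B ^ 3"
    proof -
      have "B ^ 5 = B * B * B ^ 3" by (simp add: eval_nat_numeral)
      then show ?thesis by (simp add: algebra_simps)
    qed
    also have "\<dots> \<le> 7 * B ^ 10" using Bp[of 5] Bp[of 3] by linarith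
    finally have 1: "c1 \<le> 7 * B ^ 10" .
    have "c2 \<le> B * B * (B * B * (commute_const * B ^ 6) + 2 * (2 * B ^ 3))"
      unfolding c2_def using l six2 sq by (intro mult_le_mono add_le_mono order_refl)
    also have "\<dots> = commute_const * B ^ 10 + 4 * B ^ 5"
    proof -
      have "B ^ 10 = B * B * (B * B * B ^ 6)" "B ^ 5 = B * B * B ^ 3"
        by (simp_all add: eval_nat_numeral)
      then show ?thesis by (simp add: algebra_simps)
    qed
    also have "\<dots> \<le> commute_const * B ^ 10 + 4 * B ^ 10" using Bp[of 5] by linarith
    finally show ?thesis using 1 by (simp add: algebra_simps)
  qed
  moreover have "B ^ 10 = 2 ^ (10 * (k + 1) * n)"
    by (simp only: B_def N_def power_mult[symmetric] ac_simps)
  ultimately have "ce ((commute_const + 11) * 2 ^ (10 * (k + 1) * n)) (fg w) 0"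
    using cost_equiv_mono by metis
  then show ?thesis by (simp add: cost_equiv_def)
qed

lemma area_le:
  assumes "w \<in> null_words lets R" "length w \<le> n"
  shows "area lets R w \<le> (commute_const + 11) * 2 ^ (10 * (k + 1) * n)"
proof -
  have w: "w \<in> words lets" "\<exists>l. filling (fg ` R) l (fg w)"
    using assms(1) by (simp_all add: null_words_iff[OF R_carrier])
  then obtain l where "l \<le> (commute_const + 11) * 2 ^ (10 * (k + 1) * n)" "filling (fg ` R) l (fg w)"
    using cost_null[OF w(1) assms(2)] by blast
  then show ?thesis
    using area_eq_Least_filling[OF R_carrier w(1)] Least_le[of "\<lambda>l. filling (fg ` R) l (fg w)" l] by simp
qed

lemma null_words_Nil: "[] \<in> null_words lets R"
  using filling_zero by (auto simp: null_words_iff[OF R_carrier])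

lemma dehn_function_le: "dehn_function lets R n \<le> (commute_const + 11) * 2 ^ (10 * (k + 1) * n)"
  unfolding dehn_function_def
  by (rule cSUP_least, use null_words_Nil in force, use area_le in blast)

lemma area_le_dehn_function:
  "w \<in> null_words lets R \<Longrightarrow> length w \<le> n \<Longrightarrow> area lets R w \<le> dehn_function lets R n"
  unfolding dehn_function_def
  by (rule cSUP_upper) (auto intro!: bdd_aboveI2 area_le)

lemma dehn_function_upper: "dehn_function lets R \<preceq> (\<lambda>n. 2 ^ n)"
proof -
  define C where "C = commute_const + 11 + 10 * (k + 1)"
  have "dehn_function lets R n \<le> C * 2 ^ (C * n) + C * n + C" for n
  proof -
    have "(commute_const + 11) * 2 ^ (10 * (k + 1) * n) \<le> C * (2 ^ (C * n) :: nat)"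
      by (intro mult_le_mono power_increasing) (simp_all add: C_def)
    then show ?thesis using dehn_function_le[of n] by linarith
  qed
  then show ?thesis unfolding growth_le_def by (intro exI[of _ C]) (simp add: C_def)
qed

end

section \<open>The exponential lower bound\<close>

text \<open>Sending \<open>a\<close> to \<open>a\<close>, all \<open>u\<^sub>j\<close> to \<open>u\<close> and all \<open>t\<^sub>j\<close> to \<open>1\<close> maps the group to the Baumslag--Solitar group
  \<open>u a u\<^sup>-\<^sup>1 = a\<^sup>2\<close>. It acts on pairs \<open>(b, h)\<close> (the vertices of its Cayley complex); the third
  component accumulates a potential along \<open>a\<close>-edges whose coboundary is bounded by \<open>1\<close> on every cell.\<close>

definition potential :: "rat \<Rightarrow> int \<Rightarrow> int"
  where "potential b h = (if h < 0 \<and> (\<exists>i. b = of_int (2 * i)) then 2 ^ nat (- h - 1) else 0)"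

definition bs_step :: "nat \<times> bool \<Rightarrow> rat \<times> int \<times> int \<Rightarrow> rat \<times> int \<times> int"
  where "bs_step a s = (case s of (b, h, c) \<Rightarrow>
    if fst a = 0 then
      (if snd a then (b + 2 powi (- h), h, c + potential b h)
       else (b - 2 powi (- h), h, c - potential (b - 2 powi (- h)) h))
    else if odd (fst a) then s
    else (b, if snd a then h + 1 else h - 1, c))"

lemma bs_step_simps:
  "bs_step (0, True) (b, h, c) = (b + 2 powi (- h), h, c + potential b h)"
  "bs_step (0, False) (b, h, c) = (b - 2 powi (- h), h, c - potential (b - 2 powi (- h)) h)"
  "bs_step (tlet j, s) x = x"
  "bs_step (ulet j, s) (b, h, c) = (b, if s then h + 1 else h - 1, c)"
  by (auto simp: bs_step_def tlet_def ulet_def split: prod.splits)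

interpretation BS: letter_action UNIV bs_step
  by unfold_locales (auto simp: bs_step_def inv_letter_def split: prod.splits)

text \<open>The change of the third component along a word depends only on the vertex where the word
  starts. This lets the contributions of the relators in a filling be added up.\<close>

lemma foldr_bs_step_add:
  "foldr bs_step w (b, h, c + d) = (case foldr bs_step w (b, h, c) of (b', h', c') \<Rightarrow> (b', h', c' + d))"
  by (induction w) (auto simp: bs_step_def split: prod.splits)

lemma powi_one_minus: "2 powi (1 - h) = 2 * (2 powi (- h) :: rat)"
  by (simp add: power_int_diff power_int_minus divide_inverse)

text \<open>A cell has one edge at level \<open>h - 1\<close> above two consecutive edges at level
  \<open>h\<close>. For \<open>h < 0\<close> the step \<open>2 powi (- h)\<close> is an even
  integer, so all three edges satisfy the same parity condition and the upper potential is exactly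
  twice the lower one. For \<open>h > 0\<close> everything vanishes, and at \<open>h = 0\<close> the
  value is 0 or 1.\<close>

lemma potential_coboundary:
  "\<bar>potential b (h - 1) - (potential b h + potential (b + 2 powi (- h)) h)\<bar> \<le> 1"
proof -
  consider "h \<ge> 1" | "h = 0" | n where "h = - int (Suc n)"
    using int_cases3[of h] by (metis not_less_eq_eq of_nat_0_less_iff int_one_le_iff_zero_less Suc_pred' linorder_not_less nle_le of_nat_le_0_iff)
  then show ?thesis
  proof cases
    case 3
    have pw: "2 powi (- h) = (of_int (2 * 2 ^ n) :: rat)" unfolding 3 by (simp add: power_int_def nat_add_distrib)
    have "(\<exists>i. b + 2 powi (- h) = of_int (2 * i)) \<longleftrightarrow> (\<exists>i. b = of_int (2 * i))"
    proof
      assume "\<exists>i. b + 2 powi (- h) = of_int (2 * i)"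
      then obtain i where "b + 2 powi (- h) = of_int (2 * i)" by blast
      then have "b = of_int (2 * (i - 2 ^ n))" unfolding pw by simp
      then show "\<exists>i. b = of_int (2 * i)" by blast
    next
      assume "\<exists>i. b = of_int (2 * i)"
      then obtain i where "b = of_int (2 * i)" by blast
      then have "b + 2 powi (- h) = of_int (2 * (i + 2 ^ n))" unfolding pw by simp
      then show "\<exists>i. b + 2 powi (- h) = of_int (2 * i)" by blast
    qed
    moreover have "nat (- (h - 1) - 1) = Suc n" "nat (- h - 1) = n" using 3 by auto
    ultimately show ?thesis using 3 by (simp add: potential_def)
  qed (auto simp: potential_def)
qed

context presentation
begin

lemma foldr_bs_step_tword: "v \<in> words tlets \<Longrightarrow> foldr bs_step v s = s"
  by (induction v) (auto simp: tlets_def bs_step_simps)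

lemma bs_step_qlets_commute:
  "i \<in> qlets \<Longrightarrow> j \<in> qlets \<Longrightarrow> bs_step (i, x) (bs_step (j, y) s) = bs_step (j, y) (bs_step (i, x) s)"
  by (cases s) (auto simp: qlets_def tlets_def bs_step_simps)

lemma bs_relator:
  assumes "w \<in> rels"
  shows "\<exists>d. \<bar>d\<bar> \<le> 1 \<and> foldr bs_step w (b, h, c) = (b, h, c + d)"
  using assms
proof (cases rule: rels_cases)
  case (comm i j)
  have inv: "bs_step (i, True) (bs_step (i, False) s) = s" for i s
    using BS.step_inverse[of s "(i, True)"] by (simp add: inv_letter_def)
  have "foldr bs_step w (b, h, c) = (b, h, c)"
    using bs_step_qlets_commute[OF comm(2,1)] by (simp add: comm(3) inv)
  then show ?thesis by (intro exI[of _ 0]) simp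
next
  case (power i)
  then consider j where "i = tlet j" | j where "i = ulet j"
    unfolding qlets_def tlets_def by blast
  then show ?thesis
  proof cases
    case 1
    have "foldr bs_step (replicate n (tlet j, s)) x = x" for n s x
      by (induction n) (simp_all add: bs_step_simps)
    then show ?thesis by (intro exI[of _ 0]) (simp add: power 1 letter_power_def)
  qed (auto simp: power intro: exI[of _ 0])
next
  case (u j)
  \<comment> \<open>Letters act from the right end of the word, so the two inverse letters
    \<open>a\<close> come first and lead to the left corner \<open>b'\<close> of the cell.\<close>
  define b' where "b' = b - 2 * 2 powi (- h)"
  have b': "b = b' + 2 * 2 powi (- h)" by (simp add: b'_def)
  have "foldr bs_step w (b, h, c)
      = (b, h, c + (potential b' (h - 1) - (potential b' h + potential (b' + 2 powi (- h)) h)))"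
    unfolding u(2) by (simp add: inv_letter_def bs_step_simps b' powi_one_minus algebra_simps)
  then show ?thesis using potential_coboundary[of b' h] by blast
next
  case (box \<alpha>)
  have "foldr bs_step w (b, h, c) = (b, h, c)"
    by (simp add: box foldr_bs_step_tword tword_words inv_words bs_step_simps)
  then show ?thesis by (intro exI[of _ 0]) simp
qed

text \<open>Each conjugated relator leads back to its starting vertex and changes the potential by
  at most 1, the value for the relator at the vertex to which its conjugator leads. Hence the
  potential of a loop is a lower bound for its area.\<close>

lemma bs_filling:
  "filling (fg ` R) l g \<Longrightarrow> \<exists>d. \<bar>d\<bar> \<le> int l \<and> BS.act g (b, h, c) = (b, h, c + d)"
proof (induction arbitrary: b h c rule: filling.induct)
  have shift: "BS.act g (b, h, c + d) = (case BS.act g (b, h, c) of (b', h', c') \<Rightarrow> (b', h', c' + d))" for g b h c d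
    unfolding BS.act_def by (rule foldr_bs_step_add)
  have rel: "\<exists>d. \<bar>d\<bar> \<le> 1 \<and> BS.act r (b, h, c) = (b, h, c + d)" if "r \<in> fg ` R" for r b h c
    using that bs_relator unfolding fg_R by (auto simp: BS.act_fg)
  have rel_minus: "\<exists>d. \<bar>d\<bar> \<le> 1 \<and> BS.act (- r) (b, h, c) = (b, h, c + d)" if r: "r \<in> fg ` R" for r b h c
  proof -
    obtain d where d: "\<bar>d\<bar> \<le> 1" "BS.act r (b, h, c) = (b, h, c + d)" using rel[OF r] by blast
    then have "BS.act r (b, h, c + - d) = (b, h, c)" unfolding shift by simp
    then have "BS.act (- r) (b, h, c) = (b, h, c + - d)"
      using BS.act_minus_cancel(1)[of "(b, h, c + - d)" r] by simp
    then show ?thesis using d(1) by (intro exI[of _ "- d"]) simp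
  qed
  have conj: "\<exists>d. \<bar>d\<bar> \<le> int (Suc l) \<and> BS.act (- f + r + f + g) (b, h, c) = (b, h, c + d)"
    if r: "\<And>b h c. \<exists>d. \<bar>d\<bar> \<le> 1 \<and> BS.act r (b, h, c) = (b, h, c + d)"
      and g: "\<exists>d. \<bar>d\<bar> \<le> int l \<and> BS.act g (b, h, c) = (b, h, c + d)" for r f g l b h c
  proof -
    obtain d where d: "\<bar>d\<bar> \<le> int l" "BS.act g (b, h, c) = (b, h, c + d)" using g by blast
    obtain b' h' c' where f: "BS.act f (b, h, c + d) = (b', h', c')" by (metis prod_cases3)
    obtain e where e: "\<bar>e\<bar> \<le> 1" "BS.act r (b', h', c') = (b', h', c' + e)" using r by blast
    have "BS.act (- f) (b', h', c') = (b, h, c + d)"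
      using BS.act_minus_cancel(1)[of "(b, h, c + d)" f] f by simp
    then have "BS.act (- f) (b', h', c' + e) = (b, h, c + d + e)" unfolding shift by simp
    then have "BS.act (- f + r + f + g) (b, h, c) = (b, h, c + (d + e))"
      by (simp add: BS.act_add d f e add.assoc)
    then show ?thesis using d(1) e(1) by (intro exI[of _ "d + e"]) linarith
  qed
  {
    case filling_zero
    then show ?case by (intro exI[of _ 0]) simp
  next
    case (filling_pos r l g f)
    show ?case by (rule conj[OF rel[OF filling_pos.hyps(1)] filling_pos.IH])
  next
    case (filling_neg r l g f)
    show ?case by (rule conj[OF rel_minus[OF filling_neg.hyps(1)] filling_neg.IH])
  }
qed

section \<open>Loops of exponential area\<close>

definition long_word :: "nat \<Rightarrow> nat \<Rightarrow> nat word"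
  where "long_word j n =
    replicate n (ulet j, True) @ [(0, True)] @ replicate n (ulet j, False) @ [(0, True)]
      @ replicate n (ulet j, True) @ [(0, False)] @ replicate n (ulet j, False) @ [(0, False)]"

lemma length_long_word: "length (long_word j n) = 4 * n + 4"
  by (simp add: long_word_def)

lemma foldr_bs_step_ulets:
  "foldr bs_step (replicate n (ulet j, s)) (b, h, c) = (b, if s then h + int n else h - int n, c)"
  by (induction n) (auto simp: bs_step_simps)

text \<open>The word is the commutator of \<open>u^N a u^-N\<close> with \<open>a\<close>, where
  \<open>N = n + 1\<close>. Its loop runs along level \<open>-N\<close> twice: back from
  \<open>-1\<close> to \<open>-1 - 2^N\<close>, an edge that starts at an odd integer and has
  potential 0, and forward from \<open>-2^N\<close> to \<open>0\<close>, with potential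
  \<open>2 ^ n\<close>. The parity condition in \<open>potential\<close> keeps these two passages
  from cancelling.\<close>

lemma foldr_bs_step_long_word:
  "foldr bs_step (long_word j (Suc n)) (0, 0, 0) = (0, 0, 2 ^ n)"
proof -
  define N where "N = int (Suc n)"
  have pw: "2 powi N = (of_int (2 * 2 ^ n) :: rat)"
    by (simp add: N_def power_int_def nat_add_distrib)
  have odd: "- 1 - 2 powi N \<noteq> (of_int (2 * i) :: rat)" for i
  proof
    assume "- 1 - 2 powi N = (of_int (2 * i) :: rat)"
    then have "of_int (- 1 - 2 * 2 ^ n) = (of_int (2 * i) :: rat)" unfolding pw by simp
    then have "- 1 - 2 * 2 ^ n = 2 * i" by (simp only: of_int_eq_iff)
    then show False by presburger
  qed
  have even: "\<exists>i. - (2 powi N) = (of_int (2 * i) :: rat)"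
    unfolding pw by (rule exI[of _ "- (2 ^ n)"]) simp
  have p0: "potential b 0 = 0" for b by (simp add: potential_def)
  have p1: "potential (- 1 - 2 powi N) (- N) = 0"
    unfolding potential_def using odd by auto
  have p2: "potential (- (2 powi N)) (- N) = 2 ^ n"
    unfolding potential_def using even by (simp add: N_def)
  show ?thesis
    unfolding long_word_def
    by (simp add: bs_step_simps foldr_bs_step_ulets N_def[symmetric] p0 p1 p2
        del: of_nat_Suc replicate.simps foldr_replicate)
qed

text \<open>By \<open>conj_a_expand\<close> the conjugate of \<open>a\<close> by a power of
  \<open>u_j\<close> is a product of conjugates by \<open>t\<close>-words, all of which commute with
  \<open>a\<close>.\<close>

lemma long_word_null:
  assumes j: "j \<in> inf_idx"
  shows "long_word j n \<in> null_words lets R"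
proof -
  let ?u = "replicate n (ulet j, True)"
  have inv: "replicate n (ulet j, False) = inv_word ?u"
    by (simp add: inv_letter_def rev_replicate map_replicate)
  have uw: "?u \<in> words qlets" using j by (auto simp: words_def qlets_def)
  obtain L where L: "short_twords n L" "\<exists>l. ce l (conj_a ?u) (conj_sum L)"
    using conj_a_expand[OF uw, of n] by (fastforce simp: signed_count_replicate simp del: One_nat_def)
  obtain l where "cc l (conj_sum L) (sconj ([], True))"
    using commute_cost_sym[OF sconj_conj_sum_commute[OF _ L(1), of "([], True)"]] by auto
  moreover have "sconj ([], True) = gen 0" by (simp add: sconj_def)
  ultimately have "\<exists>l. cc l (gen 0) (conj_a ?u)"
    using L(2) commute_cost_cong commute_cost_sym by metis
  then obtain l where "ce l (conj_a ?u + gen 0 - (gen 0 + conj_a ?u)) 0"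
    using commute_cost_sym cost_equiv_cancel(1) unfolding commute_cost_def by metis
  moreover have "fg (long_word j n) = conj_a ?u + gen 0 - (gen 0 + conj_a ?u)"
    unfolding long_word_def inv fg_append fg_inv_word fg_False
    by (simp add: group_normalize del: add_uminus_conv_diff)
  ultimately have "\<exists>l. filling (fg ` R) l (fg (long_word j n))"
    unfolding cost_equiv_def by auto
  moreover have "long_word j n \<in> words lets"
    using j by (auto simp: long_word_def words_def lets_def qlets_def)
  ultimately show ?thesis by (simp add: null_words_iff[OF R_carrier])
qed

lemma area_long_word:
  assumes "j \<in> inf_idx"
  shows "2 ^ n \<le> area lets R (long_word j (Suc n))"
proof -
  let ?w = "long_word j (Suc n)"
  have w: "?w \<in> words lets" "\<exists>l. filling (fg ` R) l (fg ?w)"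
    using long_word_null[OF assms] by (simp_all add: null_words_iff[OF R_carrier])
  then have "filling (fg ` R) (area lets R ?w) (fg ?w)"
    unfolding area_eq_Least_filling[OF R_carrier w(1)] by (metis (mono_tags) LeastI_ex)
  from bs_filling[OF this, of 0 0 0]
  have "2 ^ n \<le> int (area lets R ?w)"
    by (auto simp: BS.act_fg foldr_bs_step_long_word)
  then show ?thesis by (metis of_nat_le_iff of_nat_numeral of_nat_power)
qed

lemma dehn_function_lower:
  assumes "j \<in> inf_idx"
  shows "(\<lambda>n. 2 ^ n) \<preceq> dehn_function lets R"
proof -
  \<comment> \<open>The witness has length \<open>4 * (n + 1) + 4\<close>, at most
    \<open>12 * n\<close> for positive \<open>n\<close>; the additive 12 takes care of
    \<open>n = 0\<close>.\<close>
  have "2 ^ n \<le> 12 * dehn_function lets R (12 * n) + 12 * n + 12" for n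
  proof (cases n)
    case (Suc p)
    have "2 ^ n \<le> area lets R (long_word j (Suc n))" by (rule area_long_word[OF assms])
    also have "\<dots> \<le> dehn_function lets R (12 * n)"
      by (rule area_le_dehn_function[OF long_word_null[OF assms]]) (simp add: length_long_word Suc)
    finally show ?thesis by linarith
  qed simp
  then show ?thesis unfolding growth_le_def by (intro exI[of _ 12]) simp
qed

end

section \<open>The group\<close>

lemma metabelianI:
  assumes G: "group G" and K: "subgroup K G"
    and comm: "\<And>x y. x \<in> carrier G \<Longrightarrow> y \<in> carrier G \<Longrightarrow> x \<otimes>\<^bsub>G\<^esub> y \<otimes>\<^bsub>G\<^esub> inv\<^bsub>G\<^esub> x \<otimes>\<^bsub>G\<^esub> inv\<^bsub>G\<^esub> y \<in> K"
    and abel: "\<And>x y. x \<in> K \<Longrightarrow> y \<in> K \<Longrightarrow> x \<otimes>\<^bsub>G\<^esub> y = y \<otimes>\<^bsub>G\<^esub> x"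
  shows "metabelian G"
proof -
  interpret group G by (rule G)
  have DK: "derived G (carrier G) \<subseteq> K"
    unfolding derived_def by (rule generate_subgroup_incl[OF _ K]) (use comm in auto)
  have "h = \<one>\<^bsub>G\<^esub>" if hK: "h \<in> (\<Union>x\<in>K. \<Union>y\<in>K. {x \<otimes>\<^bsub>G\<^esub> y \<otimes>\<^bsub>G\<^esub> inv\<^bsub>G\<^esub> x \<otimes>\<^bsub>G\<^esub> inv\<^bsub>G\<^esub> y})" for h
  proof -
    obtain x y where h: "x \<in> K" "y \<in> K" "h = x \<otimes>\<^bsub>G\<^esub> y \<otimes>\<^bsub>G\<^esub> inv\<^bsub>G\<^esub> x \<otimes>\<^bsub>G\<^esub> inv\<^bsub>G\<^esub> y"
      using hK by blast
    have c: "x \<in> carrier G" "y \<in> carrier G" using h subgroup.subset[OF K] by auto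
    have "h = y \<otimes>\<^bsub>G\<^esub> x \<otimes>\<^bsub>G\<^esub> inv\<^bsub>G\<^esub> x \<otimes>\<^bsub>G\<^esub> inv\<^bsub>G\<^esub> y" using h abel by simp
    also have "\<dots> = \<one>\<^bsub>G\<^esub>" using c by (simp add: m_assoc)
    finally show ?thesis .
  qed
  then have "derived G K \<subseteq> {\<one>\<^bsub>G\<^esub>}"
    unfolding derived_def by (intro generate_subgroup_incl triv_subgroup) blast
  then have "derived G (derived G (carrier G)) \<subseteq> {\<one>\<^bsub>G\<^esub>}"
    using mono_derived[OF DK] by blast
  moreover have "\<one>\<^bsub>G\<^esub> \<in> derived G (derived G (carrier G))"
    unfolding derived_def by (rule generate.one)
  ultimately show ?thesis unfolding metabelian_def using G by blast
qed

lemma metabelian_iso: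
  assumes "metabelian G" "group H" "h \<in> iso G H"
  shows "metabelian H"
proof -
  have h: "group_hom G H h"
    using assms by (auto simp: metabelian_def group_hom_def group_hom_axioms_def iso_def)
  have im: "h ` carrier G = carrier H" using assms(3) by (simp add: Group.iso_iff)
  interpret group_hom G H h by (rule h)
  have "derived H (derived H (carrier H)) = h ` derived G (derived G (carrier G))"
    using derived_img[of "carrier G"] derived_img[of "derived G (carrier G)"] im
    by (simp add: G.derived_in_carrier)
  also have "\<dots> = {\<one>\<^bsub>H\<^esub>}" using assms(1) by (simp add: metabelian_def)
  finally show ?thesis using assms(2) by (simp add: metabelian_def)
qed

lemma group_copy:
  assumes "group H" and inj: "inj_on f (carrier H)"
  shows "\<exists>G :: 'b monoid. group G \<and> f \<in> iso H G"
proof -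
  interpret group H by fact
  define g where "g = inv_into (carrier H) f"
  have g: "g (f x) = x" if "x \<in> carrier H" for x
    using that inj by (simp add: g_def)
  define G where "G = \<lparr>carrier = f ` carrier H, monoid.mult = (\<lambda>x y. f (g x \<otimes>\<^bsub>H\<^esub> g y)), one = f \<one>\<^bsub>H\<^esub>\<rparr>"
  have iso: "f \<in> iso H G"
    using inj by (auto simp: Group.iso_iff hom_def G_def g)
  have "G\<lparr>one := f \<one>\<^bsub>H\<^esub>\<rparr> = G" by (simp add: G_def)
  then have "group G" using iso_imp_img_group[OF iso] by simp
  with iso show ?thesis by blast
qed

section \<open>The presented group is metabelian\<close>

context presentation
begin

abbreviation F :: "nat word monoid" where "F \<equiv> free_group lets"
abbreviation NR :: "nat word set" where "NR \<equiv> normal_closure F R"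
abbreviation quotient :: "nat word set monoid" where "quotient \<equiv> F Mod NR"

definition elt :: "nat word \<Rightarrow> nat word set"
  where "elt w = NR #>\<^bsub>F\<^esub> reduce w"

lemma normal_NR: "NR \<lhd> F"
  by (rule normal_normal_closure[OF R_carrier])

lemma group_quotient: "group quotient"
  using normal_NR by (rule normal.factorgroup_is_group)

lemma reduce_carrier: "w \<in> words lets \<Longrightarrow> reduce w \<in> carrier F"
  by (simp add: carrier_free_group reduce_words)

lemma elt_carrier: "w \<in> words lets \<Longrightarrow> elt w \<in> carrier quotient"
  unfolding carrier_FactGroup elt_def by (blast intro: reduce_carrier)

lemma quotient_elt: "x \<in> carrier quotient \<Longrightarrow> \<exists>w\<in>words lets. x = elt w"
  unfolding carrier_FactGroup elt_def by (auto simp: carrier_free_group) (metis reduce_id)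

lemma elt_append:
  "u \<in> words lets \<Longrightarrow> v \<in> words lets \<Longrightarrow> elt (u @ v) = elt u \<otimes>\<^bsub>quotient\<^esub> elt v"
  unfolding elt_def
  by (simp add: normal.rcos_sum[OF normal_NR] reduce_carrier) (simp add: mult_free_group)

lemma elt_Nil: "elt [] = \<one>\<^bsub>quotient\<^esub>"
  using group.coset_mult_one[OF group_free_group, of NR lets] normal_imp_subgroup[OF normal_NR]
  by (simp add: elt_def reduce_id one_free_group subgroup.subset)

lemma elt_inv: "w \<in> words lets \<Longrightarrow> elt (inv_word w) = inv\<^bsub>quotient\<^esub> (elt w)"
proof (rule group.inv_equality[OF group_quotient, symmetric])
  assume w: "w \<in> words lets"
  then have "elt (inv_word w) \<otimes>\<^bsub>quotient\<^esub> elt w = elt (inv_word w @ w)"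
    by (simp add: elt_append inv_words)
  also have "\<dots> = \<one>\<^bsub>quotient\<^esub>"
    unfolding elt_Nil[symmetric] by (simp add: elt_def reduce_inverse reduce_id)
  finally show "elt (inv_word w) \<otimes>\<^bsub>quotient\<^esub> elt w = \<one>\<^bsub>quotient\<^esub>" .
qed (simp_all add: elt_carrier inv_words)

lemma elt_eq_iff:
  assumes "u \<in> words lets" "v \<in> words lets"
  shows "elt u = elt v \<longleftrightarrow> (\<exists>l. ce l (fg u) (fg v))"
proof -
  interpret F: group F by (rule group_free_group)
  have sg: "subgroup NR F" using normal_NR by (rule normal_imp_subgroup)
  have "elt u = elt v \<longleftrightarrow> reduce u \<in> NR #>\<^bsub>F\<^esub> reduce v"
    unfolding elt_def using assms F.repr_independence[OF _ _ sg] F.rcos_self[OF _ sg] reduce_carrier by metis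
  also have "\<dots> \<longleftrightarrow> reduce u \<otimes>\<^bsub>F\<^esub> inv\<^bsub>F\<^esub> reduce v \<in> NR"
    using subgroup.rcos_module[OF sg group_free_group] assms reduce_carrier by blast
  also have "\<dots> \<longleftrightarrow> (\<exists>l. filling (fg ` R) l (fg (reduce u \<otimes>\<^bsub>F\<^esub> inv\<^bsub>F\<^esub> reduce v)))"
    by (rule normal_closure_iff_filling[OF R_carrier]) (simp add: assms reduce_carrier)
  also have "fg (reduce u \<otimes>\<^bsub>F\<^esub> inv\<^bsub>F\<^esub> reduce v) = fg u - fg v"
    using assms by (simp add: fg_mult fg_inv reduce_carrier)
  finally show ?thesis unfolding cost_equiv_def by auto
qed

lemma conj_sum_eq:
  assumes "short_twords N L" "short_twords N' L'" "total L = total L'"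
  shows "\<exists>l. ce l (conj_sum L) (conj_sum L')"
proof -
  have "short_twords (max N N') L" "short_twords (max N N') L'"
    using assms by (auto simp: short_twords_def le_max_iff_disj)
  then have "\<exists>l. ce l (conj_sum (L @ flip L')) 0"
    using cost_conj_sum_zero[of "max N N'" "L @ flip L'"] assms(3) by auto
  then obtain l where "ce l (conj_sum L - conj_sum L') 0" by (auto simp: conj_sum_flip)
  then have "ce l (conj_sum L - conj_sum L' + conj_sum L') (0 + conj_sum L')"
    by (simp only: cost_equiv_right)
  then show ?thesis by auto
qed

lemma conj_sum_total:
  assumes "short_twords N L" "short_twords N' L'" "ce l (conj_sum L) (conj_sum L')"
  shows "total L = total L'"
proof -
  have "short_twords (max N N') (L @ flip L')"
    using assms by (auto simp: short_twords_def flip_def le_max_iff_disj)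
  moreover have "\<exists>l. filling (fg ` R) l (conj_sum (L @ flip L'))"
    using cost_equiv_cancel(1)[OF assms(3)] by (auto simp: conj_sum_flip cost_equiv_def)
  ultimately have "total (L @ flip L') x = 0" for x using total_filling by blast
  then show ?thesis by (auto simp: fun_eq_iff)
qed

lemma letter_count_ce: "ce l g h \<Longrightarrow> i \<in> qlets \<Longrightarrow> int (modulus i) dvd letter_count i g - letter_count i h"
  unfolding cost_equiv_def using letter_count_filling letter_count_add[of i g "- h"] by fastforce

text \<open>The words that become trivial when \<open>a\<close> is killed; they represent the normal
  closure of \<open>a\<close>.\<close>

definition balanced :: "nat word set"
  where "balanced = {w \<in> words lets. \<forall>i\<in>qlets. int (modulus i) dvd signed_count i w}"

text \<open>A single conjugation by \<open>uword n\<close> turns both words into products of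
  conjugates by \<open>t\<close>-words. These commute because coefficients do not see the order of
  the factors.\<close>

lemma balanced_commute:
  assumes "u \<in> balanced" "v \<in> balanced"
  shows "elt (u @ v) = elt (v @ u)"
proof -
  define n where "n = max (length u) (length v)"
  have w: "u \<in> words lets" "v \<in> words lets" using assms by (auto simp: balanced_def)
  obtain L l L' l' N where L: "short_twords N L" "ce l (fg (uword n) + fg u - fg (uword n)) (conj_sum L)"
      "short_twords N L'" "ce l' (fg (uword n) + fg v - fg (uword n)) (conj_sum L')"
    using cost_null_collect[of u n] cost_null_collect[of v n] assms
    unfolding balanced_def n_def by (metis (no_types, lifting) max.cobounded1 max.cobounded2 mem_Collect_eq)
  let ?u = "fg (uword n) + fg u - fg (uword n)" and ?v = "fg (uword n) + fg v - fg (uword n)"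
  have "ce (l + l') (?u + ?v) (conj_sum (L @ L'))"
    using cost_equiv_add[OF L(2,4)] by simp
  moreover obtain l'' where "ce l'' (conj_sum (L @ L')) (conj_sum (L' @ L))"
    using conj_sum_eq[of N "L @ L'" N "L' @ L"] L by (auto simp: fun_eq_iff)
  moreover have "ce (l' + l) (conj_sum (L' @ L)) (?v + ?u)"
    using cost_equiv_sym[OF cost_equiv_add[OF L(4,2)]] by simp
  ultimately have "cc (l + l' + l'' + (l' + l)) ?u ?v"
    unfolding commute_cost_def by (meson cost_equiv_trans)
  then have "cc (l + l' + l'' + (l' + l)) (fg u) (fg v)" by (simp only: commute_cost_conj)
  then show ?thesis
    using w by (auto simp: elt_eq_iff commute_cost_def fg_append)
qed

lemma metabelian_quotient: "metabelian quotient"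
proof (rule metabelianI[OF group_quotient])
  interpret Q: group quotient by (rule group_quotient)
  show "subgroup (elt ` balanced) quotient"
  proof (rule Q.subgroupI)
    show "elt ` balanced \<subseteq> carrier quotient" by (auto simp: balanced_def elt_carrier)
    show "elt ` balanced \<noteq> {}" by (auto simp: balanced_def intro: exI[of _ "[]"])
    fix x assume "x \<in> elt ` balanced"
    then obtain w where w: "w \<in> balanced" "x = elt w" by blast
    then have "inv_word w \<in> balanced" by (auto simp: balanced_def inv_words)
    moreover have "inv\<^bsub>quotient\<^esub> x = elt (inv_word w)"
      using w by (simp only: elt_inv balanced_def mem_Collect_eq)
    ultimately show "inv\<^bsub>quotient\<^esub> x \<in> elt ` balanced" by blast
    fix y assume "y \<in> elt ` balanced"
    then obtain v where v: "v \<in> balanced" "y = elt v" by blast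
    then have "w @ v \<in> balanced" using w by (auto simp: balanced_def)
    moreover have "x \<otimes>\<^bsub>quotient\<^esub> y = elt (w @ v)"
      using w v by (simp only: elt_append balanced_def mem_Collect_eq)
    ultimately show "x \<otimes>\<^bsub>quotient\<^esub> y \<in> elt ` balanced" by blast
  qed
next
  fix x y assume "x \<in> carrier quotient" "y \<in> carrier quotient"
  then obtain u v where uv: "u \<in> words lets" "x = elt u" "v \<in> words lets" "y = elt v"
    using quotient_elt by metis
  then have "x \<otimes>\<^bsub>quotient\<^esub> y \<otimes>\<^bsub>quotient\<^esub> inv\<^bsub>quotient\<^esub> x \<otimes>\<^bsub>quotient\<^esub> inv\<^bsub>quotient\<^esub> y
      = elt (u @ v @ inv_word u @ inv_word v)"
    by (simp only: elt_append elt_inv inv_words words_append simp_thms append_assoc[symmetric])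
  moreover have "u @ v @ inv_word u @ inv_word v \<in> balanced"
    using uv by (simp add: balanced_def inv_words)
  ultimately show "x \<otimes>\<^bsub>quotient\<^esub> y \<otimes>\<^bsub>quotient\<^esub> inv\<^bsub>quotient\<^esub> x \<otimes>\<^bsub>quotient\<^esub> inv\<^bsub>quotient\<^esub> y \<in> elt ` balanced"
    by blast
next
  fix x y assume "x \<in> elt ` balanced" "y \<in> elt ` balanced"
  then obtain u v where uv: "u \<in> balanced" "x = elt u" "v \<in> balanced" "y = elt v" by blast
  then have "u \<in> words lets" "v \<in> words lets" by (auto simp: balanced_def)
  then show "x \<otimes>\<^bsub>quotient\<^esub> y = y \<otimes>\<^bsub>quotient\<^esub> x"
    using balanced_commute[OF uv(1,3)] unfolding uv by (simp only: elt_append)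
qed

section \<open>A criterion for embedding a group\<close>

definition conj_word :: "(nat word \<times> bool) list \<Rightarrow> nat word"
  where "conj_word L = concat (map (\<lambda>(v, s). v @ [(0, s)] @ inv_word v) L)"

lemma fg_conj_word: "fg (conj_word L) = conj_sum L"
  by (induction L) (auto simp: conj_word_def sconj_eq_fg fg_append)

lemma conj_word_words: "short_twords N L \<Longrightarrow> conj_word L \<in> words lets"
proof (induction L)
  case (Cons e L)
  obtain v s where e: "e = (v, s)" by force
  have "v \<in> words lets" using Cons.prems words_mono[of tlets lets v] by (auto simp: e lets_def qlets_def)
  then show ?case using Cons by (simp add: conj_word_def e inv_words) (simp add: lets_def)
qed (simp add: conj_word_def)

lemma cvec_tword: "congr (cvec (tword \<alpha>)) \<alpha>"
  by (simp add: congr_def cvec_def)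

lemma congr_add: "congr x y \<Longrightarrow> congr x' y' \<Longrightarrow> congr (\<lambda>j. x j + x' j) (\<lambda>j. y j + y' j)"
  unfolding congr_def by (simp add: add_diff_add)

text \<open>The data describe \<open>W\<close> as a group of affine maps: \<open>\<sigma>\<close> is
  the translational part modulo \<open>m\<close>, and \<open>f\<close> is a crossed homomorphism
  into the group ring. An element is sent to a product of conjugates with coefficients
  \<open>f x\<close> followed by the \<open>t\<close>-word of \<open>\<sigma> x\<close>.\<close>

lemma embedding_quotient:
  assumes series: "\<And>x. x \<in> carrier W \<Longrightarrow> \<exists>N L. short_twords N L \<and> total L = f x"
    and f_mult: "\<And>x y p. x \<in> carrier W \<Longrightarrow> y \<in> carrier W \<Longrightarrow>
      f (x \<otimes>\<^bsub>W\<^esub> y) p = f x p + f y (\<lambda>j. p j - \<sigma> x j)"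
    and \<sigma>_mult: "\<And>x y. x \<in> carrier W \<Longrightarrow> y \<in> carrier W \<Longrightarrow>
      congr (\<sigma> (x \<otimes>\<^bsub>W\<^esub> y)) (\<lambda>j. \<sigma> x j + \<sigma> y j)"
    and closed: "\<And>x y. x \<in> carrier W \<Longrightarrow> y \<in> carrier W \<Longrightarrow> x \<otimes>\<^bsub>W\<^esub> y \<in> carrier W"
    and inj: "\<And>x y. x \<in> carrier W \<Longrightarrow> y \<in> carrier W \<Longrightarrow> f x = f y \<Longrightarrow> congr (\<sigma> x) (\<sigma> y) \<Longrightarrow> x = y"
  shows "\<exists>h. h \<in> mon W quotient"
proof -
  obtain N L where L: "\<And>x. x \<in> carrier W \<Longrightarrow> short_twords (N x) (L x)"
      "\<And>x. x \<in> carrier W \<Longrightarrow> total (L x) = f x"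
    using series by metis
  define wd where "wd x = conj_word (L x) @ tword (\<sigma> x)" for x
  have wd: "wd x \<in> words lets" if "x \<in> carrier W" for x
    using conj_word_words[OF L(1)[OF that]] tword_lets by (simp add: wd_def)
  have fg_wd: "fg (wd x) = conj_sum (L x) + fg (tword (\<sigma> x))" for x
    by (simp add: wd_def fg_append fg_conj_word)
  have mult: "elt (wd (x \<otimes>\<^bsub>W\<^esub> y)) = elt (wd x) \<otimes>\<^bsub>quotient\<^esub> elt (wd y)"
    if x: "x \<in> carrier W" and y: "y \<in> carrier W" for x y
  proof -
    let ?t = "tword (\<sigma> x)" and ?z = "x \<otimes>\<^bsub>W\<^esub> y"
    \<comment> \<open>The list of \<open>y\<close> with all conjugators moved by the
      \<open>t\<close>-word of \<open>x\<close>; its coefficients are the shifted summand in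
      \<open>f_mult\<close>.\<close>
    let ?M = "map (\<lambda>(v, s). (?t @ v, s)) (L y)"
    have sM: "conj_sum (map (\<lambda>(v, s). (?t @ v, s)) K) = fg ?t + conj_sum K - fg ?t" for K
    proof (induction K)
      case (Cons e K)
      obtain v s where e: "e = (v, s)" by force
      have "sconj (?t @ v, s) = fg ?t + sconj (v, s) - fg ?t"
        by (simp add: sconj_def fg_append group_normalize del: add_uminus_conv_diff)
      then show ?case using Cons by (simp add: e group_normalize del: add_uminus_conv_diff)
    qed simp
    have short: "short_twords (length ?t + N y) ?M"
      using L(1)[OF y] by (auto simp: short_twords_def tword_words)
    have "congr p (cvec (?t @ v)) \<longleftrightarrow> congr (\<lambda>j. p j - \<sigma> x j) (cvec v)" for p v
      by (simp add: congr_def cvec_def algebra_simps)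
    then have "total (map (\<lambda>(v, s). (?t @ v, s)) K) p = total K (\<lambda>j. p j - \<sigma> x j)" for K p
      by (induction K) (auto simp: delta_def)
    then have tot: "total (L x @ ?M) = total (L ?z)"
      using L(2) x y closed f_mult by (auto simp: fun_eq_iff)
    have "short_twords (N x + (length ?t + N y)) (L x @ ?M)"
      using L(1)[OF x] short by (auto simp: short_twords_def)
    then obtain l where l: "ce l (conj_sum (L x @ ?M)) (conj_sum (L ?z))"
      using conj_sum_eq[OF _ L(1)[OF closed[OF x y]] tot] by blast
    let ?s = "?t @ tword (\<sigma> y)"
    have "congr (cvec ?s) (\<sigma> ?z)"
    proof (rule congr_trans[OF _ congr_sym[OF \<sigma>_mult[OF x y]]])
      have "cvec ?s = (\<lambda>j. cvec ?t j + cvec (tword (\<sigma> y)) j)" by (simp add: fun_eq_iff cvec_def)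
      then show "congr (cvec ?s) (\<lambda>j. \<sigma> x j + \<sigma> y j)"
        using congr_add[OF cvec_tword cvec_tword] by simp
    qed
    then have d: "int (m j) dvd signed_count (tlet j) ?s - signed_count (tlet j) (tword (\<sigma> ?z))" if "j < k" for j
      using that by (simp add: congr_def cvec_def)
    have "?s \<in> words tlets" by (simp add: tword_words)
    from cost_tword_eq[OF this tword_words d order_refl]
    obtain l' where "ce l' (fg ?s) (fg (tword (\<sigma> ?z)))" by blast
    with l have "ce (l + l') (conj_sum (L x @ ?M) + fg ?s) (fg (wd ?z))"
      unfolding fg_wd by (rule cost_equiv_add)
    moreover have "conj_sum (L x @ ?M) + fg ?s = fg (wd x @ wd y)"
      unfolding fg_append[of "wd x"] fg_wd conj_sum_simps sM
      by (simp add: fg_append group_normalize del: add_uminus_conv_diff)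
    ultimately have "elt (wd x @ wd y) = elt (wd ?z)"
      using wd x y closed by (auto simp: elt_eq_iff)
    then show ?thesis using wd x y by (simp add: elt_append)
  qed
  have "inj_on (\<lambda>x. elt (wd x)) (carrier W)"
  proof (rule inj_onI)
    fix x y assume x: "x \<in> carrier W" and y: "y \<in> carrier W" and "elt (wd x) = elt (wd y)"
    then obtain l where l: "ce l (conj_sum (L x) + fg (tword (\<sigma> x))) (conj_sum (L y) + fg (tword (\<sigma> y)))"
      using wd by (auto simp: elt_eq_iff fg_wd)
    \<comment> \<open>Equality in the group determines the exponents of the letters
      \<open>t\<close>, since conjugates of \<open>a\<close> contribute none. With the
      \<open>t\<close>-words cancelled, \<open>conj_sum_total\<close> determines
      \<open>f\<close>.\<close>
    have "int (m j) dvd \<sigma> x j - \<sigma> y j" if j: "j < k" for j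
    proof -
      have "letter_count (tlet j) (conj_sum K) = 0" for K
        by (induction K) (auto simp: sconj_eq_fg letter_count_def[of _ 0])
      then show ?thesis
        using letter_count_ce[OF l, of "tlet j"] j by (auto simp: qlets_def tlets_def)
    qed
    then have c: "congr (\<sigma> x) (\<sigma> y)" by (simp add: congr_def)
    have "int (m j) dvd signed_count (tlet j) (tword (\<sigma> y)) - signed_count (tlet j) (tword (\<sigma> x))" if "j < k" for j
      using congr_sym[OF c] that by (simp add: congr_def)
    from cost_tword_eq[OF tword_words tword_words this order_refl]
    obtain l' where "ce l' (fg (tword (\<sigma> y))) (fg (tword (\<sigma> x)))" by blast
    then have "ce l' (conj_sum (L y) + fg (tword (\<sigma> y))) (conj_sum (L y) + fg (tword (\<sigma> x)))"
      by (simp only: cost_equiv_left)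
    with l have "ce (l + l') (conj_sum (L x) + fg (tword (\<sigma> x))) (conj_sum (L y) + fg (tword (\<sigma> x)))"
      by (rule cost_equiv_trans)
    then have "total (L x) = total (L y)"
      using conj_sum_total[OF L(1)[OF x] L(1)[OF y]] by (simp add: cost_equiv_right)
    then show "x = y" using inj[OF x y _ c] L(2) x y by simp
  qed
  then have "(\<lambda>x. elt (wd x)) \<in> mon W quotient"
    using mult wd by (auto simp: mon_def hom_def elt_carrier)
  then show ?thesis by blast
qed

lemma nat_group_with_embedding:
  assumes "inf_idx \<noteq> {}" and "\<exists>h. h \<in> mon W quotient"
  shows "\<exists>G :: nat monoid. metabelian G \<and> finitely_presented G \<and> exponential_dehn_function G \<and>
    (\<exists>h. h \<in> mon W G)"
proof -
  \<comment> \<open>Words are countable, so the code of a chosen representative carries the group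
    over to the natural numbers.\<close>
  define f where "f x = to_nat (SOME w. w \<in> words lets \<and> x = elt w)" for x
  have rep: "x = elt (SOME w. w \<in> words lets \<and> x = elt w)" if "x \<in> carrier quotient" for x
    using someI_ex[of "\<lambda>w. w \<in> words lets \<and> x = elt w"] quotient_elt[OF that] by blast
  have "inj_on f (carrier quotient)"
  proof (rule inj_onI)
    fix x y assume xy: "x \<in> carrier quotient" "y \<in> carrier quotient" and "f x = f y"
    then have "(SOME w. w \<in> words lets \<and> x = elt w) = (SOME w. w \<in> words lets \<and> y = elt w)"
      by (simp only: f_def inj_eq[OF inj_to_nat])
    then show "x = y" using rep[OF xy(1)] rep[OF xy(2)] by (simp only:)
  qed
  then obtain G :: "nat monoid" where G: "group G" "f \<in> iso quotient G"
    using group_copy[OF group_quotient] by blast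
  have "metabelian G" by (rule metabelian_iso[OF metabelian_quotient G])
  moreover have "G \<cong> quotient"
    by (rule group.iso_sym[OF group_quotient is_isoI[OF G(2)]])
  then have "finite_presentation lets R G"
    using finite_lets finite_R R_carrier unfolding finite_presentation_def by blast
  moreover have "growth_equiv (dehn_function lets R) (\<lambda>n. 2 ^ n)"
    unfolding growth_equiv_def using dehn_function_upper dehn_function_lower assms(1) by blast
  moreover have "\<exists>h. h \<in> mon W G"
  proof -
    obtain h where "h \<in> mon W quotient" using assms(2) by blast
    moreover have "f \<in> mon quotient G" using G(2) by (simp only: iso_iff_mon_epi)
    ultimately have "f \<circ> h \<in> mon W G" by (rule mon_compose)
    then show ?thesis by blast
  qed
  ultimately show ?thesis
    unfolding finitely_presented_def exponential_dehn_function_def by blast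
qed

end

section \<open>Coordinates on finitely generated abelian groups\<close>

text \<open>An embedding of \<open>H\<close> into a product of \<open>k\<close> cyclic groups of
  orders \<open>m j\<close>, 0 standing for the integers, given by integer representatives: both
  additivity and injectivity hold modulo \<open>m j\<close>.\<close>

definition residue_coordinates ::
    "('t, 'c) monoid_scheme \<Rightarrow> 't set \<Rightarrow> nat \<Rightarrow> (nat \<Rightarrow> nat) \<Rightarrow> ('t \<Rightarrow> nat \<Rightarrow> int) \<Rightarrow> bool"
  where "residue_coordinates T H k m \<chi> \<longleftrightarrow>
    (\<forall>x\<in>H. \<forall>y\<in>H. \<forall>j<k. int (m j) dvd \<chi> (x \<otimes>\<^bsub>T\<^esub> y) j - (\<chi> x j + \<chi> y j)) \<and>
    (\<forall>x\<in>H. \<forall>y\<in>H. (\<forall>j<k. int (m j) dvd \<chi> x j - \<chi> y j) \<longrightarrow> x = y)"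

context comm_group
begin

lemma exists_relative_order:
  assumes H: "subgroup H G" and t: "t \<in> carrier G"
  shows "\<exists>d::nat. \<forall>i::int. t [^] i \<in> H \<longleftrightarrow> int d dvd i"
proof -
  define P where "P n \<longleftrightarrow> n > 0 \<and> t [^] int n \<in> H" for n
  define d where "d = (if \<exists>n. P n then LEAST n. P n else 0)"
  have dH: "t [^] int d \<in> H"
  proof (cases "\<exists>n. P n")
    case True
    then show ?thesis using LeastI_ex[of P] by (simp add: d_def P_def)
  next
    case False
    then show ?thesis using subgroup.one_closed[OF H] by (auto simp: d_def int_pow_int)
  qed
  have small: "i = 0" if i: "0 \<le> i" "t [^] i \<in> H" "d > 0 \<Longrightarrow> i < int d" for i
  proof (rule ccontr)
    assume "i \<noteq> 0"
    then have P: "P (nat i)" using i by (simp add: P_def)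
    then have "d = (LEAST n. P n)" by (auto simp: d_def)
    moreover have "P (LEAST n. P n)" using P by (rule LeastI)
    ultimately have "d > 0" by (simp add: P_def)
    moreover have "d \<le> nat i" using P \<open>d = (LEAST n. P n)\<close> by (simp add: Least_le)
    ultimately show False using i by linarith
  qed
  have mult: "t [^] (int d * q) \<in> H" for q
    using subgroup_int_pow_closed[OF H dH, of q] t by (simp add: int_pow_pow)
  have "int d dvd i" if i: "t [^] i \<in> H" for i
  proof -
    have *: "t [^] (i mod int d) \<in> H"
    proof -
      have "t [^] (i mod int d) = t [^] i \<otimes> inv (t [^] (int d * (i div int d)))"
        using t by (simp add: int_pow_diff minus_mult_div_eq_mod[symmetric])
      then show ?thesis using H i mult by (simp add: subgroup.m_closed subgroup.m_inv_closed)
    qed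
    show ?thesis
    proof (cases "d = 0")
      case True
      have "t [^] \<bar>i\<bar> \<in> H"
        using i t subgroup.m_inv_closed[OF H i] by (auto simp: abs_if int_pow_neg)
      then show ?thesis using small[of "\<bar>i\<bar>"] True by simp
    next
      case False
      then show ?thesis using small[OF _ *] by (simp add: dvd_eq_mod_eq_0)
    qed
  qed
  then show ?thesis using mult by (intro exI[of _ d]) (auto elim: dvdE)
qed

text \<open>Let \<open>d\<close> be the order of \<open>t\<close> modulo \<open>H\<close>, with 0
  for infinite order. For \<open>d > 0\<close> write \<open>y = \<rho> y * t^i\<close>; the
  \<open>d\<close>-th power of \<open>y\<close> lies in \<open>H\<close>, and its coordinates are
  \<open>d * \<chi> (\<rho> y) + i * \<chi> (t^d)\<close>. Reading these modulo
  \<open>d * m j\<close> adjoins \<open>d\<close>-th roots in the cyclic factors; a new coordinate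
  \<open>i\<close> modulo \<open>d\<close> restores injectivity. For \<open>d = 0\<close> the new
  coordinate splits off. This takes the place of the classification of finitely generated abelian
  groups.\<close>

lemma residue_coordinates_extend:
  assumes H: "subgroup H G" and t: "t \<in> carrier G" and coords: "residue_coordinates G H k m \<chi>"
  shows "\<exists>k' m' \<chi>'. residue_coordinates G {y \<in> carrier G. \<exists>i::int. y \<otimes> t [^] i \<in> H} k' m' \<chi>'"
proof -
  let ?U = "{y \<in> carrier G. \<exists>i::int. y \<otimes> t [^] i \<in> H}"
  have Hc: "x \<in> carrier G" if "x \<in> H" for x using that subgroup.subset[OF H] by blast
  obtain d :: nat where d: "\<And>i::int. t [^] i \<in> H \<longleftrightarrow> int d dvd i"
    using exists_relative_order[OF H t] by blast
  \<comment> \<open>The exponent of \<open>t\<close> in \<open>y\<close> relative to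
    \<open>H\<close>: the sign is reversed because \<open>y * t^i\<close> lies in \<open>H\<close>.
    For \<open>d = 0\<close> the reduction is the identity and the exponent is already
    unique.\<close>
  define \<iota> where "\<iota> y = (- (SOME i. y \<otimes> t [^] i \<in> H)) mod int d" for y
  define \<rho> where "\<rho> y = y \<otimes> t [^] (- \<iota> y)" for y
  have change: "y \<otimes> t [^] j \<in> H" if "y \<in> carrier G" "y \<otimes> t [^] i \<in> H" "int d dvd j - i" for y and i j :: int
  proof -
    have "y \<otimes> t [^] j = y \<otimes> t [^] i \<otimes> t [^] (j - i)"
      using that(1) t int_pow_mult[OF t, of i "j - i"] by (simp add: m_assoc)
    then show ?thesis using that d H by (simp add: subgroup.m_closed)
  qed
  have unique: "int d dvd j - i" if "y \<in> carrier G" "y \<otimes> t [^] i \<in> H" "y \<otimes> t [^] j \<in> H" for y and i j :: int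
  proof -
    have "inv y \<otimes> (y \<otimes> t [^] j) = t [^] j"
      using that(1) t by (simp add: m_assoc[symmetric])
    then have "inv (y \<otimes> t [^] i) \<otimes> (y \<otimes> t [^] j) = inv (t [^] i) \<otimes> t [^] j"
      using that(1) t by (simp add: inv_mult_group m_assoc)
    also have "\<dots> = t [^] (j - i)"
      using t int_pow_mult[OF t, of "- i" j] by (simp add: int_pow_neg)
    finally have "t [^] (j - i) \<in> H"
      using subgroup.m_closed[OF H subgroup.m_inv_closed[OF H that(2)] that(3)] by simp
    then show ?thesis using d by simp
  qed
  have \<rho>H: "\<rho> y \<in> H" if y: "y \<in> ?U" for y
  proof -
    define i where "i = (SOME i::int. y \<otimes> t [^] i \<in> H)"
    have "\<exists>i::int. y \<otimes> t [^] i \<in> H" using y by blast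
    then have i: "y \<otimes> t [^] i \<in> H" unfolding i_def by (rule someI_ex)
    have "int d dvd - \<iota> y - i"
    proof -
      have "\<iota> y = (- i) mod int d" by (simp add: \<iota>_def i_def)
      then have "- \<iota> y - i = int d * ((- i) div int d)"
        using mult_div_mod_eq[of "int d" "- i"] by linarith
      then show ?thesis by simp
    qed
    moreover have "y \<in> carrier G" using y by blast
    ultimately show ?thesis using change[OF _ i] unfolding \<rho>_def by blast
  qed
  have \<iota>: "\<iota> y = e mod int d" if "y \<in> ?U" "y \<otimes> t [^] (- e) \<in> H" for y e
  proof -
    have "y \<in> carrier G" using that(1) by blast
    from unique[OF this \<rho>H[OF that(1), unfolded \<rho>_def] that(2)]
    have "int d dvd \<iota> y - e" by (simp add: algebra_simps)
    then have "\<iota> y mod int d = e mod int d" unfolding mod_eq_dvd_iff .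
    moreover have "\<iota> y mod int d = \<iota> y" unfolding \<iota>_def by (rule mod_mod_trivial)
    ultimately show ?thesis by (simp only:)
  qed
  have \<rho>_inj: "\<rho> y \<otimes> t [^] \<iota> y = y" if "y \<in> carrier G" for y
    using that t by (simp add: \<rho>_def int_pow_neg m_assoc)
  define c where "c = (if d = 0 then 1 else int d)"
  define \<tau> where "\<tau> = t [^] int d"
  have \<tau>H: "\<tau> \<in> H" using d by (simp add: \<tau>_def)
  \<comment> \<open>For \<open>d = 0\<close> the element \<open>\<tau>\<close> is the identity,
    whose coordinates are 0 modulo \<open>m j\<close>; the formula is then
    \<open>\<chi> (\<rho> y)\<close> up to multiples of \<open>m j\<close>.\<close>
  define \<chi>' where "\<chi>' y j = (if j < k then c * \<chi> (\<rho> y) j + \<iota> y * \<chi> \<tau> j else \<iota> y)" for y j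
  define m' where "m' j = (if j < k then nat c * m j else d)" for j
  have c0: "c > 0" by (simp add: c_def)
  have hom: "int (m j) dvd \<chi> (x \<otimes> y) j - (\<chi> x j + \<chi> y j)" if "x \<in> H" "y \<in> H" "j < k" for x y j
    using coords that unfolding residue_coordinates_def by blast
  have "int (m' j) dvd \<chi>' (x \<otimes> y) j - (\<chi>' x j + \<chi>' y j)"
    if x: "x \<in> ?U" and y: "y \<in> ?U" and j: "j < Suc k" for x y j
  proof -
    define e where "e = \<iota> x + \<iota> y"
    have xy: "x \<otimes> y \<otimes> t [^] (- e) = \<rho> x \<otimes> \<rho> y"
    proof -
      have "t [^] (- e) = t [^] (- \<iota> x) \<otimes> t [^] (- \<iota> y)"
        using int_pow_mult[OF t, of "- \<iota> x" "- \<iota> y"] by (simp add: e_def)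
      then show ?thesis using x y t by (simp add: \<rho>_def m_ac)
    qed
    have inH: "\<rho> x \<otimes> \<rho> y \<in> H" using \<rho>H x y H by (simp add: subgroup.m_closed)
    then have U: "x \<otimes> y \<in> ?U" using x y xy by (auto intro!: exI[of _ "- e"])
    have \<iota>xy: "\<iota> (x \<otimes> y) = e mod int d" using \<iota>[OF U] xy inH by simp
    \<comment> \<open>\<open>q\<close> is the carry in adding the two residues modulo
      \<open>d\<close>; it puts a factor \<open>\<tau>\<close> into
      \<open>\<rho> (x * y)\<close>.\<close>
    obtain q where q: "q = 0 \<or> q = 1 \<and> d > 0" "\<iota> (x \<otimes> y) = e - q * int d"
    proof (cases "d = 0")
      case True
      then show ?thesis using that[of 0] \<iota>xy by simp
    next
      case False
      then have range: "0 \<le> \<iota> z \<and> \<iota> z < int d" for z by (simp add: \<iota>_def)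
      show ?thesis
      proof (cases "e < int d")
        case True
        then have "e mod int d = e" using range[of x] range[of y] by (simp add: e_def)
        then show ?thesis using that[of 0] \<iota>xy by simp
      next
        case ge: False
        have "(e - int d) mod int d = e - int d"
          using ge range[of x] range[of y] e_def by (intro mod_pos_pos_trivial) linarith+
        then have "e mod int d = e - int d" by (metis minus_mod_self2)
        then show ?thesis using that[of 1] \<iota>xy False by simp
      qed
    qed
    show ?thesis
    proof (cases "j < k")
      case True
      have "int (m j) dvd \<chi> (\<rho> (x \<otimes> y)) j - (\<chi> (\<rho> x) j + \<chi> (\<rho> y) j + q * \<chi> \<tau> j)"
      proof (cases "q = 0")
        case True
        then have "\<rho> (x \<otimes> y) = \<rho> x \<otimes> \<rho> y" using xy q by (simp add: \<rho>_def)
        then show ?thesis using hom[OF \<rho>H[OF x] \<rho>H[OF y] \<open>j < k\<close>] True by simp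
      next
        case False
        then have q1: "q = 1" using q by simp
        have "\<rho> (x \<otimes> y) = x \<otimes> y \<otimes> t [^] (- e + int d)"
          unfolding \<rho>_def q(2) q1 by simp
        also have "\<dots> = \<rho> x \<otimes> \<rho> y \<otimes> \<tau>"
          unfolding xy[symmetric] \<tau>_def using x y t int_pow_mult[OF t, of "- e" "int d"] by (simp add: m_assoc)
        finally have eq: "\<rho> (x \<otimes> y) = \<rho> x \<otimes> \<rho> y \<otimes> \<tau>" .
        from dvd_add[OF hom[OF inH \<tau>H True] hom[OF \<rho>H[OF x] \<rho>H[OF y] True]]
        show ?thesis unfolding eq q1 by (simp add: algebra_simps)
      qed
      then have "c * int (m j) dvd c * (\<chi> (\<rho> (x \<otimes> y)) j - (\<chi> (\<rho> x) j + \<chi> (\<rho> y) j + q * \<chi> \<tau> j))"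
        by (rule mult_dvd_mono[OF dvd_refl])
      moreover have "q * int d = q * c" using q(1) by (auto simp: c_def)
      then have \<iota>q: "\<iota> (x \<otimes> y) = \<iota> x + \<iota> y - q * c" using q(2) e_def by linarith
      \<comment> \<open>The carry adds \<open>c * \<chi> \<tau>\<close> through
        \<open>\<rho>\<close> and takes away the same amount through \<open>\<iota>\<close>.\<close>
      have "c * (\<chi> (\<rho> (x \<otimes> y)) j - (\<chi> (\<rho> x) j + \<chi> (\<rho> y) j + q * \<chi> \<tau> j))
          = \<chi>' (x \<otimes> y) j - (\<chi>' x j + \<chi>' y j)"
        unfolding \<chi>'_def \<iota>q using True by (simp add: algebra_simps)
      moreover have "int (m' j) = c * int (m j)" using True c0 by (simp add: m'_def)
      ultimately show ?thesis by (simp only:)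
    next
      case False
      then show ?thesis using q(2) by (simp add: \<chi>'_def m'_def e_def)
    qed
  qed
  moreover have "x = y" if x: "x \<in> ?U" and y: "y \<in> ?U"
    and eq: "\<forall>j<Suc k. int (m' j) dvd \<chi>' x j - \<chi>' y j" for x y
  proof -
    have "int d dvd \<iota> x - \<iota> y" using eq[rule_format, of k] by (simp add: \<chi>'_def m'_def)
    then have "\<iota> x mod int d = \<iota> y mod int d" by (simp add: mod_eq_dvd_iff)
    then have \<iota>eq: "\<iota> x = \<iota> y" by (simp add: \<iota>_def)
    have "int (m j) dvd \<chi> (\<rho> x) j - \<chi> (\<rho> y) j" if "j < k" for j
    proof -
      have "c * int (m j) dvd c * (\<chi> (\<rho> x) j - \<chi> (\<rho> y) j)"
        using eq[rule_format, of j] that c0 by (simp add: \<chi>'_def m'_def \<iota>eq algebra_simps)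
      then show ?thesis using c0 by simp
    qed
    then have "\<rho> x = \<rho> y"
      using coords \<rho>H[OF x] \<rho>H[OF y] unfolding residue_coordinates_def by blast
    then have "\<rho> x \<otimes> t [^] \<iota> x = \<rho> y \<otimes> t [^] \<iota> y" using \<iota>eq by (simp only:)
    moreover have "x \<in> carrier G" "y \<in> carrier G" using x y by blast+
    ultimately show ?thesis by (simp only: \<rho>_inj)
  qed
  ultimately have "residue_coordinates G ?U (Suc k) m' \<chi>'"
    unfolding residue_coordinates_def by blast
  then show ?thesis by blast
qed

lemma subgroup_extend:
  assumes H: "subgroup H G" and t: "t \<in> carrier G"
  shows "subgroup {y \<in> carrier G. \<exists>i::int. y \<otimes> t [^] i \<in> H} G"
proof (rule subgroupI)
  show "{y \<in> carrier G. \<exists>i::int. y \<otimes> t [^] i \<in> H} \<noteq> {}"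
    using subgroup.one_closed[OF H] by (auto intro!: exI[of _ \<one>] exI[of _ "0::int"])
next
  fix y assume "y \<in> {y \<in> carrier G. \<exists>i::int. y \<otimes> t [^] i \<in> H}"
  then obtain i :: int where y: "y \<in> carrier G" and i: "y \<otimes> t [^] i \<in> H" by blast
  have "inv (y \<otimes> t [^] i) = inv y \<otimes> t [^] (- i)"
    using y t by (simp add: inv_mult int_pow_neg)
  then have "inv y \<otimes> t [^] (- i) \<in> H" using subgroup.m_inv_closed[OF H i] by simp
  then show "inv y \<in> {y \<in> carrier G. \<exists>i::int. y \<otimes> t [^] i \<in> H}" using y by blast
next
  fix x y assume "x \<in> {y \<in> carrier G. \<exists>i::int. y \<otimes> t [^] i \<in> H}" "y \<in> {y \<in> carrier G. \<exists>i::int. y \<otimes> t [^] i \<in> H}"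
  then obtain i j :: int where xy: "x \<in> carrier G" "y \<in> carrier G"
    and ij: "x \<otimes> t [^] i \<in> H" "y \<otimes> t [^] j \<in> H" by blast
  have "x \<otimes> t [^] i \<otimes> (y \<otimes> t [^] j) = x \<otimes> y \<otimes> t [^] (i + j)"
    using xy t by (simp add: int_pow_mult m_ac)
  then have "x \<otimes> y \<otimes> t [^] (i + j) \<in> H" using subgroup.m_closed[OF H ij] by simp
  then show "x \<otimes> y \<in> {y \<in> carrier G. \<exists>i::int. y \<otimes> t [^] i \<in> H}" using xy by blast
qed auto

lemma exists_residue_coordinates_subgroup:
  "finite S \<Longrightarrow> S \<subseteq> carrier G \<Longrightarrow>
    \<exists>H k m \<chi>. subgroup H G \<and> S \<subseteq> H \<and> residue_coordinates G H k m \<chi>"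
proof (induction rule: finite_induct)
  case empty
  have "residue_coordinates G {\<one>} 0 (\<lambda>_. 0) (\<lambda>_ _. 0)"
    by (simp add: residue_coordinates_def)
  then show ?case using triv_subgroup by blast
next
  case (insert t S)
  then obtain H k m \<chi> where H: "subgroup H G" "S \<subseteq> H" "residue_coordinates G H k m \<chi>" by auto
  have t: "t \<in> carrier G" using insert.prems by simp
  let ?U = "{y \<in> carrier G. \<exists>i::int. y \<otimes> t [^] i \<in> H}"
  have "t \<otimes> t [^] (- 1 :: int) \<in> H"
    using t subgroup.one_closed[OF H(1)] by (simp add: int_pow_neg)
  then have "t \<in> ?U" using t by blast
  moreover have "S \<subseteq> ?U"
  proof
    fix s assume s: "s \<in> S"
    then have "s \<in> carrier G" "s \<in> H" using H insert.prems by auto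
    then have "s \<in> carrier G" "s \<otimes> t [^] (0::int) \<in> H" by simp_all
    then show "s \<in> ?U" by blast
  qed
  ultimately show ?case
    using subgroup_extend[OF H(1) t] residue_coordinates_extend[OF H(1) t H(3)] by blast
qed

lemma exists_residue_coordinates:
  assumes "finitely_generated G"
  shows "\<exists>k m \<chi>. residue_coordinates G (carrier G) k m \<chi>"
proof -
  obtain S where S: "finite S" "S \<subseteq> carrier G" "generate G S = carrier G"
    using assms unfolding finitely_generated_def by blast
  obtain H k m \<chi> where H: "subgroup H G" "S \<subseteq> H" "residue_coordinates G H k m \<chi>"
    using exists_residue_coordinates_subgroup[OF S(1,2)] by blast
  have "H = carrier G"
    using generate_subgroup_incl[OF H(2,1)] S(3) subgroup.subset[OF H(1)] by blast
  then show ?thesis using H(3) by blast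
qed

end

section \<open>Embedding wreath products\<close>

context presentation
begin

lemma delta_tword: "delta (tword q, True) p = of_bool (congr p q)"
proof -
  have "congr p (cvec (tword q)) \<longleftrightarrow> congr p q"
    using cvec_tword congr_sym congr_trans by blast
  then show ?thesis by (simp add: delta_def)
qed

text \<open>Membership in the group ring, among all functions on integer vectors.\<close>

definition is_total :: "((nat \<Rightarrow> int) \<Rightarrow> int) \<Rightarrow> bool"
  where "is_total f \<longleftrightarrow> (\<exists>N L. short_twords N L \<and> total L = f)"

lemma is_total_zero: "is_total (\<lambda>_. 0)"
  unfolding is_total_def by (rule exI[of _ 0], rule exI[of _ "[]"]) (simp add: fun_eq_iff)

lemma is_total_add:
  assumes "is_total f" "is_total g"
  shows "is_total (\<lambda>p. f p + g p)"
proof -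
  obtain N L N' L' where L: "short_twords N L" "total L = f" "short_twords N' L'" "total L' = g"
    using assms unfolding is_total_def by blast
  have "short_twords (max N N') (L @ L')"
    using L by (auto simp: short_twords_def le_max_iff_disj)
  moreover have "total (L @ L') = (\<lambda>p. f p + g p)" using L by (auto simp: fun_eq_iff)
  ultimately show ?thesis unfolding is_total_def by blast
qed

lemma is_total_neg: "is_total f \<Longrightarrow> is_total (\<lambda>p. - f p)"
  unfolding is_total_def by (metis ext short_twords_flip total_flip)

lemma is_total_scale:
  assumes "is_total f"
  shows "is_total (\<lambda>p. c * f p)"
proof (induction c rule: int_induct[where k = 0])
  case base
  show ?case using is_total_zero by simp
next
  case (step1 c)
  then show ?case using is_total_add[OF step1.IH assms] by (simp add: distrib_right)
next
  case (step2 c)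
  then show ?case using is_total_add[OF step2.IH is_total_neg[OF assms]] by (simp add: left_diff_distrib)
qed

lemma is_total_sum: "finite I \<Longrightarrow> is_total (\<lambda>p. \<Sum>e\<in>I. c e * of_bool (congr p (q e)))"
proof (induction rule: finite_induct)
  case (insert e I)
  have "short_twords (length (tword (q e))) [(tword (q e), True)]" by (simp add: tword_words)
  moreover have "total [(tword (q e), True)] = (\<lambda>p. of_bool (congr p (q e)))"
    by (simp add: fun_eq_iff delta_tword)
  ultimately have "is_total (\<lambda>p. of_bool (congr p (q e)))" unfolding is_total_def by blast
  from is_total_add[OF is_total_scale[OF this, of "c e"] insert.IH]
  show ?case by (simp only: sum.insert[OF insert.hyps])
qed (simp add: is_total_zero)

end

lemma wreath_product_simps:
  "carrier (wreath_product A T) = carrier (sum_group (carrier T) (\<lambda>_. A)) \<times> carrier T"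
  "(f, s) \<otimes>\<^bsub>wreath_product A T\<^esub> (g, t) = ((\<lambda>y\<in>carrier T. f y \<otimes>\<^bsub>A\<^esub> translate T s g y), s \<otimes>\<^bsub>T\<^esub> t)"
  by (simp_all add: wreath_product_def semidirect_product_def)

text \<open>The copy of \<open>\<int>\<^sup>n\<close> at \<open>y\<close> is spread over the \<open>n\<close> translates of \<open>y\<close> by an additional infinite
  coordinate \<open>k\<close>; this coordinate also makes the Dehn function exponential when \<open>T\<close> is finite.\<close>

lemma wreath_product_embeds:
  fixes A :: "('a, 'b) monoid_scheme" and T :: "('t, 'c) monoid_scheme"
  assumes A: "free_abelian_of_rank n A" and T: "comm_group T" "finitely_generated T"
  shows "\<exists>G :: nat monoid. metabelian G \<and> finitely_presented G \<and> exponential_dehn_function G \<and>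
    (\<exists>h. h \<in> mon (wreath_product A T) G)"
proof -
  interpret A: comm_group A using A by (simp add: free_abelian_of_rank_def)
  interpret T: comm_group T by (rule T)
  interpret W: group "wreath_product A T" by (rule group_wreath_product[OF A.group_axioms T.group_axioms])
  obtain \<phi> where \<phi>: "\<phi> \<in> iso A (free_Abelian_group {..<n})"
    using A unfolding free_abelian_of_rank_def is_iso_def by blast
  have \<phi>_mult: "\<phi> (a \<otimes>\<^bsub>A\<^esub> b) = \<phi> a + \<phi> b" if "a \<in> carrier A" "b \<in> carrier A" for a b
    using \<phi> that by (simp add: iso_def hom_def)
  have \<phi>_keys: "Poly_Mapping.keys (\<phi> a) \<subseteq> {..<n}" if "a \<in> carrier A" for a
    using \<phi> that unfolding iso_def hom_def by (auto simp: Pi_iff)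
  have \<phi>_inj: "a = b" if "a \<in> carrier A" "b \<in> carrier A" "\<phi> a = \<phi> b" for a b
    using \<phi> that by (auto simp: Group.iso_iff dest: inj_onD)
  have \<phi>_one: "\<phi> \<one>\<^bsub>A\<^esub> = 0" using \<phi>_mult[of "\<one>\<^bsub>A\<^esub>" "\<one>\<^bsub>A\<^esub>"] by simp
  obtain k m \<chi> where coords: "residue_coordinates T (carrier T) k m \<chi>"
    using T.exists_residue_coordinates[OF T(2)] by blast
  have hom: "int (m j) dvd \<chi> (x \<otimes>\<^bsub>T\<^esub> y) j - (\<chi> x j + \<chi> y j)"
    if "x \<in> carrier T" "y \<in> carrier T" "j < k" for x y j
    using coords that unfolding residue_coordinates_def by blast
  have sep: "x = y" if "x \<in> carrier T" "y \<in> carrier T" "\<And>j. j < k \<Longrightarrow> int (m j) dvd \<chi> x j - \<chi> y j" for x y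
    using coords that unfolding residue_coordinates_def by blast
  interpret presentation "Suc k" "m(k := 0)" .
  have congr_iff: "congr p q \<longleftrightarrow> (\<forall>j<k. int (m j) dvd p j - q j) \<and> p k = q k" for p q
    unfolding congr_def by (auto simp: less_Suc_eq)
  have k_inf: "inf_idx \<noteq> {}" unfolding inf_idx_def by auto
  \<comment> \<open>\<open>p\<close> lies over \<open>y\<close>. As \<open>T\<close> is only a
    subgroup of the product of cyclic groups, some vectors lie over no element;
    \<open>series\<close> vanishes there.\<close>
  define near where "near p y \<longleftrightarrow> y \<in> carrier T \<and> (\<forall>j<k. int (m j) dvd p j - \<chi> y j)" for p y
  have near_unique: "y = y'" if "near p y" "near p y'" for p y y'
  proof (rule sep)
    fix j assume "j < k"
    then show "int (m j) dvd \<chi> y j - \<chi> y' j"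
      using that dvd_diff[of "int (m j)" "p j - \<chi> y' j" "p j - \<chi> y j"] by (simp add: near_def)
  qed (use that in \<open>simp_all add: near_def\<close>)
  \<comment> \<open>\<open>T\<close> leaves coordinate \<open>k\<close> fixed, so the basis index of
    \<open>A\<close> stored there survives translation.\<close>
  define \<sigma> where "\<sigma> x j = (if j < k then \<chi> (snd x) j else 0)" for x :: "('t \<Rightarrow> 'a) \<times> 't" and j
  define series where "series f p = (if (\<exists>y. near p y) \<and> 0 \<le> p k
      then Poly_Mapping.lookup (\<phi> (f (THE y. near p y))) (nat (p k)) else 0)"
    for f :: "'t \<Rightarrow> 'a" and p :: "nat \<Rightarrow> int"
  have series_near: "series f p = (if 0 \<le> p k then Poly_Mapping.lookup (\<phi> (f y)) (nat (p k)) else 0)"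
    if "near p y" for f p y
  proof -
    have "(THE y. near p y) = y" using that near_unique by blast
    then show ?thesis using that by (auto simp: series_def)
  qed
  have series_far: "series f p = 0" if "\<nexists>y. near p y" for f p
    using that by (simp add: series_def)
  have near_shift: "near p (s \<otimes>\<^bsub>T\<^esub> z) \<longleftrightarrow> near (\<lambda>j. p j - \<sigma> (f, s) j) z"
    if "s \<in> carrier T" "z \<in> carrier T" for p s z f
  proof -
    have "int (m j) dvd p j - \<chi> (s \<otimes>\<^bsub>T\<^esub> z) j \<longleftrightarrow> int (m j) dvd p j - \<chi> s j - \<chi> z j" if j: "j < k" for j
      using hom[OF \<open>s \<in> carrier T\<close> \<open>z \<in> carrier T\<close> j]
        dvd_add_right_iff[of "int (m j)" "\<chi> (s \<otimes>\<^bsub>T\<^esub> z) j - (\<chi> s j + \<chi> z j)" "p j - \<chi> (s \<otimes>\<^bsub>T\<^esub> z) j"]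
      by (simp add: algebra_simps)
    then show ?thesis using that by (auto simp: near_def \<sigma>_def)
  qed
  let ?W = "wreath_product A T"
  have carrierD: "f y \<in> carrier A" if "(f, s) \<in> carrier ?W" "y \<in> carrier T" for f s y
    using that by (auto simp: wreath_product_simps carrier_sum_group A.group_axioms)
  have "\<exists>h. h \<in> mon ?W quotient"
  proof (rule embedding_quotient[where f = "\<lambda>x. series (fst x)" and \<sigma> = \<sigma>])
    fix x assume x: "x \<in> carrier ?W"
    obtain f s where fs: "x = (f, s)" by force
    define I where "I = {y \<in> carrier T. f y \<noteq> \<one>\<^bsub>A\<^esub>} \<times> {..<n}"
    define c where "c = (\<lambda>(y, i). Poly_Mapping.lookup (\<phi> (f y)) i)"
    define q where "q = (\<lambda>(y, i) j. if j < k then \<chi> y j else int i)"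
    have fin: "finite I"
      using x by (auto simp: I_def fs wreath_product_simps carrier_sum_group A.group_axioms)
    have "series f p = (\<Sum>e\<in>I. c e * of_bool (congr p (q e)))" for p
    proof (cases "(\<exists>y. near p y) \<and> 0 \<le> p k")
      case True
      then obtain y where y: "near p y" by blast
      have yT: "y \<in> carrier T" using y by (simp add: near_def)
      have "congr p (q e) \<longleftrightarrow> e = (y, nat (p k))" if "e \<in> I" for e
      proof -
        obtain z i where e: "e = (z, i)" by force
        have "congr p (q e) \<longleftrightarrow> near p z \<and> p k = int i"
          using that by (auto simp: e congr_iff q_def near_def I_def)
        also have "\<dots> \<longleftrightarrow> z = y \<and> i = nat (p k)"
          using y near_unique True by auto
        finally show ?thesis by (simp add: e)
      qed
      then have "(\<Sum>e\<in>I. c e * of_bool (congr p (q e))) = (\<Sum>e\<in>I. if e = (y, nat (p k)) then c e else 0)"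
        by (intro sum.cong) auto
      also have "\<dots> = (if (y, nat (p k)) \<in> I then c (y, nat (p k)) else 0)"
        using fin by simp
      also have "\<dots> = Poly_Mapping.lookup (\<phi> (f y)) (nat (p k))"
      proof (cases "(y, nat (p k)) \<in> I")
        case False
        then have "f y = \<one>\<^bsub>A\<^esub> \<or> nat (p k) \<notin> {..<n}" using yT by (auto simp: I_def)
        then have "nat (p k) \<notin> Poly_Mapping.keys (\<phi> (f y))"
          using \<phi>_one \<phi>_keys[OF carrierD[OF x[unfolded fs] yT]] by auto
        then show ?thesis using False by (simp add: in_keys_iff)
      qed (simp add: c_def)
      finally show ?thesis using series_near[OF y] True by simp
    next
      case False
      have "\<not> congr p (q e)" if "e \<in> I" for e
        using that False by (auto simp: congr_iff q_def near_def I_def)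
      then have "(\<Sum>e\<in>I. c e * of_bool (congr p (q e))) = 0" by (intro sum.neutral) simp
      then show ?thesis by (simp only: series_def if_not_P[OF False])
    qed
    then have "series f = (\<lambda>p. \<Sum>e\<in>I. c e * of_bool (congr p (q e)))" by blast
    then show "\<exists>N L. short_twords N L \<and> total L = series (fst x)"
      using is_total_sum[OF fin, of c q] by (simp add: is_total_def fs)
  next
    fix x y p assume x: "x \<in> carrier ?W" and y: "y \<in> carrier ?W"
    obtain f s g t where fs: "x = (f, s)" "y = (g, t)" by force
    have s: "s \<in> carrier T" using x by (simp add: fs wreath_product_simps)
    let ?p = "\<lambda>j. p j - \<sigma> x j"
    have pk: "?p k = p k" by (simp add: \<sigma>_def)
    show "series (fst (x \<otimes>\<^bsub>?W\<^esub> y)) p = series (fst x) p + series (fst y) ?p"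
    proof (cases "\<exists>z. near p z")
      case True
      then obtain z where z: "near p z" by blast
      have zT: "z \<in> carrier T" using z by (simp add: near_def)
      have z': "inv\<^bsub>T\<^esub> s \<otimes>\<^bsub>T\<^esub> z \<in> carrier T" "s \<otimes>\<^bsub>T\<^esub> (inv\<^bsub>T\<^esub> s \<otimes>\<^bsub>T\<^esub> z) = z"
        using s zT by (simp_all add: T.m_assoc[symmetric])
      have near': "near ?p (inv\<^bsub>T\<^esub> s \<otimes>\<^bsub>T\<^esub> z)"
        using near_shift[OF s z'(1), of p f] z z'(2) by (simp add: fs)
      have "\<phi> (f z \<otimes>\<^bsub>A\<^esub> g (inv\<^bsub>T\<^esub> s \<otimes>\<^bsub>T\<^esub> z)) = \<phi> (f z) + \<phi> (g (inv\<^bsub>T\<^esub> s \<otimes>\<^bsub>T\<^esub> z))"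
        using \<phi>_mult carrierD x y zT z'(1) by (simp add: fs)
      then show ?thesis
        using zT by (simp add: series_near[OF z] series_near[OF near'[unfolded fs]] pk[unfolded fs] fs wreath_product_simps
          translate_def Poly_Mapping.lookup_add)
    next
      case False
      have "\<not> near ?p z" for z
      proof
        assume z: "near ?p z"
        then have "z \<in> carrier T" by (simp add: near_def)
        then show False using near_shift[OF s, of z p f] z False by (simp add: fs)
      qed
      then have "\<nexists>z. near ?p z" by blast
      then show ?thesis using False by (simp add: series_far)
    qed
  next
    fix x y assume "x \<in> carrier ?W" "y \<in> carrier ?W"
    then show "congr (\<sigma> (x \<otimes>\<^bsub>?W\<^esub> y)) (\<lambda>j. \<sigma> x j + \<sigma> y j)"
      using hom by (cases x; cases y) (auto simp: congr_iff \<sigma>_def wreath_product_simps)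
  next
    fix x y assume "x \<in> carrier ?W" "y \<in> carrier ?W"
    then show "x \<otimes>\<^bsub>?W\<^esub> y \<in> carrier ?W" by simp
  next
    fix x y assume x: "x \<in> carrier ?W" and y: "y \<in> carrier ?W"
      and eq: "series (fst x) = series (fst y)" and c: "congr (\<sigma> x) (\<sigma> y)"
    obtain f s g t where fs: "x = (f, s)" "y = (g, t)" by force
    have "s = t"
    proof (rule sep)
      show "int (m j) dvd \<chi> s j - \<chi> t j" if "j < k" for j
        using c that by (simp add: congr_iff \<sigma>_def fs)
    qed (use x y in \<open>simp_all add: fs wreath_product_simps\<close>)
    moreover have "f z = g z" if z: "z \<in> carrier T" for z
    proof -
      have "Poly_Mapping.lookup (\<phi> (f z)) i = Poly_Mapping.lookup (\<phi> (g z)) i" for i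
      proof -
        \<comment> \<open>The point over \<open>z\<close> with last coordinate \<open>i\<close>,
          where the series shows the \<open>i\<close>-th coefficient of
          \<open>\<phi> (f z)\<close>.\<close>
        define p where "p j = (if j < k then \<chi> z j else int i)" for j
        have "near p z" using z by (simp add: near_def p_def)
        from series_near[OF this, of f] series_near[OF this, of g] show ?thesis
          using fun_cong[OF eq, of p] by (simp add: fs p_def)
      qed
      then have "\<phi> (f z) = \<phi> (g z)" by (rule poly_mapping_eqI)
      then show ?thesis using \<phi>_inj carrierD x y z by (simp add: fs)
    qed
    then have "f = g"
      using x y by (auto simp: fs wreath_product_simps carrier_sum_group A.group_axioms intro: PiE_ext)
    ultimately show "x = y" by (simp add: fs)
  qed
  from nat_group_with_embedding[OF k_inf this] show ?thesis .
qed

section \<open>The Magnus embedding\<close>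

context group
begin

definition eval_word :: "('x \<Rightarrow> 'a) \<Rightarrow> 'x word \<Rightarrow> 'a"
  where "eval_word g w = foldr (\<lambda>(x, s) y. (if s then g x else inv (g x)) \<otimes> y) w \<one>"

lemma eval_word_simps [simp]: "eval_word g [] = \<one>"
  "eval_word g ((x, s) # w) = (if s then g x else inv (g x)) \<otimes> eval_word g w"
  by (simp_all add: eval_word_def)

lemma eval_word_closed: "g \<in> X \<rightarrow> carrier G \<Longrightarrow> w \<in> words X \<Longrightarrow> eval_word g w \<in> carrier G"
  by (induction w) (auto simp: Pi_iff)

lemma eval_word_append:
  "g \<in> X \<rightarrow> carrier G \<Longrightarrow> u \<in> words X \<Longrightarrow> v \<in> words X \<Longrightarrow>
    eval_word g (u @ v) = eval_word g u \<otimes> eval_word g v"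
proof (induction u)
  case (Cons a u)
  obtain x s where "a = (x, s)" by force
  then show ?case using Cons by (auto simp: eval_word_closed Pi_iff m_assoc)
qed (simp add: eval_word_closed)

lemma eval_word_inv_word:
  assumes "g \<in> X \<rightarrow> carrier G" "w \<in> words X"
  shows "eval_word g (inv_word w) = inv (eval_word g w)"
  using assms(2)
proof (induction w)
  case (Cons a w)
  obtain x s where a: "a = (x, s)" by force
  have g: "g x \<in> carrier G" using assms(1) Cons.prems a by auto
  have w: "w \<in> words X" and x: "x \<in> X" using Cons.prems by (auto simp: a)
  have "inv_word (a # w) = inv_word w @ [inv_letter a]" by simp
  moreover have "[inv_letter a] \<in> words X" using x by (simp add: a inv_letter_def)
  ultimately have "eval_word g (inv_word (a # w)) = eval_word g (inv_word w) \<otimes> eval_word g [inv_letter a]"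
    using w by (simp only: eval_word_append[OF assms(1)] inv_words)
  moreover have "eval_word g [inv_letter a] = inv (eval_word g [a])"
    using g by (simp add: a inv_letter_def)
  moreover have "eval_word g (a # w) = eval_word g [a] \<otimes> eval_word g w" "eval_word g [a] \<in> carrier G"
    using g by (simp_all add: a)
  ultimately show ?case
    using Cons.IH[OF w] eval_word_closed[OF assms(1) w] by (simp only: inv_mult_group)
qed simp

text \<open>The leading letter has an inverse occurrence further on; in an abelian subgroup the two
  meet and cancel, leaving a shorter balanced word.\<close>

lemma eval_word_balanced:
  assumes K: "subgroup K G" and comm: "\<And>x y. x \<in> K \<Longrightarrow> y \<in> K \<Longrightarrow> x \<otimes> y = y \<otimes> x"
    and g: "g \<in> X \<rightarrow> K"
  shows "w \<in> words X \<Longrightarrow> (\<And>x. signed_count x w = 0) \<Longrightarrow> eval_word g w = \<one>"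
proof (induction "length w" arbitrary: w rule: less_induct)
  case less
  have gc: "g \<in> X \<rightarrow> carrier G" using g subgroup.subset[OF K] by auto
  have inK: "eval_word g u \<in> K" if "u \<in> words X" for u
    using that
  proof (induction u)
    case (Cons a u)
    obtain x s where a: "a = (x, s)" by force
    then have "g x \<in> K" using Cons.prems g by auto
    then show ?case using Cons K by (auto simp: a intro: subgroup.m_closed subgroup.m_inv_closed)
  qed (simp add: subgroup.one_closed[OF K])
  show ?case
  proof (cases w)
    case (Cons a w')
    obtain x s where a: "a = (x, s)" by force
    have "(x, \<not> s) \<in> set w'"
    proof (rule ccontr)
      assume "(x, \<not> s) \<notin> set w'"
      then show False
        using less.prems(2)[of x] signed_count_nonneg[of x w'] signed_count_nonpos[of x w']
        by (cases s) (auto simp: Cons a)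
    qed
    then obtain w1 w2 where w': "w' = w1 @ (x, \<not> s) # w2" by (auto dest: split_list)
    have ws: "w1 \<in> words X" "w2 \<in> words X" "x \<in> X" using less.prems(1) by (auto simp: Cons a w')
    define b where "b = (if s then g x else inv (g x))"
    have b: "b \<in> K" "(if s then inv (g x) else g x) = inv b"
    proof -
      have "g x \<in> K" "g x \<in> carrier G" using g gc ws by auto
      then show "b \<in> K" "(if s then inv (g x) else g x) = inv b"
        using K by (auto simp: b_def intro: subgroup.m_inv_closed)
    qed
    have c: "b \<in> carrier G" "eval_word g w1 \<in> carrier G" "eval_word g w2 \<in> carrier G"
      using b(1) inK ws subgroup.subset[OF K] by auto
    have "eval_word g w = b \<otimes> eval_word g (w1 @ (x, \<not> s) # w2)" by (simp add: Cons a w' b_def)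
    also have "eval_word g (w1 @ (x, \<not> s) # w2) = eval_word g w1 \<otimes> eval_word g ((x, \<not> s) # w2)"
      using ws by (intro eval_word_append[OF gc]) simp_all
    also have "eval_word g ((x, \<not> s) # w2) = inv b \<otimes> eval_word g w2"
      using b(2) by (cases s) simp_all
    finally have "eval_word g w = b \<otimes> (eval_word g w1 \<otimes> (inv b \<otimes> eval_word g w2))" .
    also have "\<dots> = (b \<otimes> eval_word g w1) \<otimes> (inv b \<otimes> eval_word g w2)"
      using c by (simp add: m_assoc)
    also have "b \<otimes> eval_word g w1 = eval_word g w1 \<otimes> b"
      using comm[OF b(1) inK[OF ws(1)]] .
    also have "eval_word g w1 \<otimes> b \<otimes> (inv b \<otimes> eval_word g w2) = eval_word g w1 \<otimes> eval_word g w2"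
      using c by (simp add: m_assoc) (simp add: m_assoc[symmetric])
    also have "\<dots> = eval_word g (w1 @ w2)"
      using ws by (simp add: eval_word_append[OF gc])
    also have "\<dots> = \<one>"
    proof (rule less.hyps)
      fix y
      have "signed_count y w = signed_count y (w1 @ w2)" by (cases s) (auto simp: Cons a w')
      then show "signed_count y (w1 @ w2) = 0" using less.prems(2) by simp
    qed (use ws in \<open>auto simp: Cons w'\<close>)
    finally show ?thesis .
  qed simp
qed

lemma eval_word_quotient:
  assumes N: "N \<lhd> G" and g: "g \<in> X \<rightarrow> carrier G" and w: "w \<in> words X"
  shows "group.eval_word (G Mod N) (\<lambda>x. N #> g x) w = N #> eval_word g w"
proof -
  interpret Q: group "G Mod N" by (rule normal.factorgroup_is_group[OF N])
  interpret N: normal N G by (rule N)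
  show ?thesis using w
  proof (induction w)
    case Nil
    then show ?case by (simp add: coset_mult_one[OF N.subset])
  next
    case (Cons a w)
    obtain x s where a: "a = (x, s)" by force
    have c: "g x \<in> carrier G" "eval_word g w \<in> carrier G"
      using Cons.prems g eval_word_closed[OF g] by (auto simp: a)
    have "N #> g x \<in> carrier (G Mod N)" using c by (auto simp: carrier_FactGroup)
    then have "inv\<^bsub>G Mod N\<^esub> (N #> g x) = N #> inv (g x)"
      using N.inv_FactGroup N.rcos_inv c by simp
    then show ?case using Cons c by (simp add: a N.rcos_sum)
  qed
qed

text \<open>In the abelianization the value of a word depends only on its exponent sums.\<close>

lemma eval_word_same_counts:
  assumes g: "g \<in> X \<rightarrow> carrier G" and w: "u \<in> words X" "v \<in> words X"
    and eq: "\<And>x. signed_count x u = signed_count x v"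
  shows "eval_word g u \<otimes> inv (eval_word g v) \<in> derived G (carrier G)"
proof -
  let ?N = "derived G (carrier G)"
  interpret Q: comm_group "G Mod ?N" by (rule derived_quot_is_comm_group)
  have w': "u @ inv_word v \<in> words X" using w by (simp add: inv_words)
  have "?N #> eval_word g (u @ inv_word v) = Q.eval_word (\<lambda>x. ?N #> g x) (u @ inv_word v)"
    by (rule eval_word_quotient[OF derived_self_is_normal g w', symmetric])
  also have "\<dots> = ?N"
    using Q.eval_word_balanced[OF Q.subgroup_self Q.m_comm, of "\<lambda>x. ?N #> g x" X "u @ inv_word v"] w' g eq
    by (auto simp: carrier_FactGroup Pi_iff)
  finally have "eval_word g (u @ inv_word v) \<in> ?N"
    using coset_join1 derived_is_subgroup[of "carrier G"] eval_word_closed[OF g w'] by blast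
  then show ?thesis using w by (simp add: eval_word_append[OF g] eval_word_inv_word[OF g] inv_words)
qed

end

text \<open>The path read off \<open>w\<close> in the Cayley graph of the lattice. An edge is keyed
  by its lower end also when it is traversed backwards, so \<open>signed_count\<close> on this list
  of edges is the flow through an edge.\<close>

fun edges :: "('x \<Rightarrow> 'v::ab_group_add) \<Rightarrow> 'v \<Rightarrow> 'x word \<Rightarrow> ('v \<times> 'x) word" where
  "edges e p [] = []"
| "edges e p ((i, s) # w) =
    (if s then ((p, i), True) # edges e (p + e i) w else ((p - e i, i), False) # edges e (p - e i) w)"

fun endpoint :: "('x \<Rightarrow> 'v::ab_group_add) \<Rightarrow> 'x word \<Rightarrow> 'v" where
  "endpoint e [] = 0"
| "endpoint e ((i, s) # w) = (if s then e i else - e i) + endpoint e w"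

lemma endpoint_append [simp]: "endpoint e (u @ v) = endpoint e u + endpoint e v"
  by (induction e u rule: endpoint.induct) (auto simp: add.assoc)

lemma edges_append: "edges e p (u @ v) = edges e p u @ edges e (p + endpoint e u) v"
  by (induction e p u rule: edges.induct) (auto simp: algebra_simps)

lemma signed_count_edges_translate:
  "signed_count (p, i) (edges e (q + q') w) = signed_count (p - q, i) (edges e q' w)"
  by (induction e q' w rule: edges.induct) (auto simp: algebra_simps)

lemma lookup_endpoint: "Poly_Mapping.lookup (endpoint frag_of w) i = signed_count i w"
  by (induction i w rule: signed_count.induct) (auto simp: lookup_add lookup_single)

text \<open>The loop \<open>w\<close> is a product of the elements \<open>s(p, i) = \<sigma>(p) x\<^sub>i \<sigma>(p + e\<^sub>i)\<^sup>-\<^sup>1\<close> of the derived subgroup,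
  one for each edge that it traverses; here \<open>\<sigma>\<close> is any section over the lattice points.\<close>

lemma (in group) metabelian_eval_word:
  assumes meta: "metabelian G" and g: "g \<in> X \<rightarrow> carrier G" and w: "w \<in> words X"
    and closed: "endpoint frag_of w = 0"
    and flow: "\<And>key. signed_count key (edges frag_of 0 w) = 0"
  shows "eval_word g w = \<one>"
proof -
  let ?e = "frag_of :: 'x \<Rightarrow> 'x \<Rightarrow>\<^sub>0 int"
  let ?K = "derived G (carrier G)"
  have K: "subgroup ?K G" by (rule derived_is_subgroup) simp
  define P where "P = endpoint ?e ` words X"
  define rep where "rep p = (SOME v. v \<in> words X \<and> endpoint ?e v = p)" for p
  have rep: "rep p \<in> words X" "endpoint ?e (rep p) = p" if "p \<in> P" for p
    using someI_ex[of "\<lambda>v. v \<in> words X \<and> endpoint ?e v = p"] that unfolding rep_def P_def by blast+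
  define \<sigma> where "\<sigma> p = eval_word g (rep p)" for p
  have \<sigma>: "\<sigma> p \<in> carrier G" if "p \<in> P" for p
    unfolding \<sigma>_def by (rule eval_word_closed[OF g rep(1)[OF that]])
  define s where "s = (\<lambda>(p, i). \<sigma> p \<otimes> g i \<otimes> inv (\<sigma> (p + ?e i)))"
  have P0: "0 \<in> P" unfolding P_def by (rule image_eqI[of _ _ "[]"]) simp_all
  have step: "p + ?e i \<in> P" "p - ?e i \<in> P" if "p \<in> P" "i \<in> X" for p i
  proof -
    have "rep p @ [(i, True)] \<in> words X" "rep p @ [(i, False)] \<in> words X"
      using that rep(1) by simp_all
    moreover have "endpoint ?e (rep p @ [(i, True)]) = p + ?e i" "endpoint ?e (rep p @ [(i, False)]) = p - ?e i"
      using that rep(2) by simp_all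
    ultimately show "p + ?e i \<in> P" "p - ?e i \<in> P" unfolding P_def by (metis imageI)+
  qed
  have sK: "s (p, i) \<in> ?K" if "p \<in> P" "i \<in> X" for p i
  proof -
    have gi: "g i \<in> carrier G" using that g by auto
    \<comment> \<open>Both words lead to the same lattice point, which is to say that they have the
      same exponent sums.\<close>
    have "signed_count x (rep p @ [(i, True)]) = signed_count x (rep (p + ?e i))" for x
      using rep[OF that(1)] rep[OF step(1)[OF that]]
      by (simp add: lookup_endpoint[symmetric] lookup_add del: signed_count_append)
    then have "eval_word g (rep p @ [(i, True)]) \<otimes> inv (eval_word g (rep (p + ?e i))) \<in> ?K"
      using rep[OF that(1)] rep[OF step(1)[OF that]] that by (intro eval_word_same_counts[OF g]) auto
    then show ?thesis
      using rep[OF that(1)] that gi by (simp add: eval_word_append[OF g] s_def \<sigma>_def)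
  qed
  have sX: "s \<in> P \<times> X \<rightarrow> ?K" using sK by auto
  have telescope: "\<sigma> p \<otimes> eval_word g v \<otimes> inv (\<sigma> (p + endpoint ?e v)) = eval_word s (edges ?e p v)
      \<and> edges ?e p v \<in> words (P \<times> X)"
    if "p \<in> P" "v \<in> words X" for p v
    using that
  proof (induction v arbitrary: p)
    case Nil
    then show ?case using \<sigma> by simp
  next
    case (Cons a v)
    obtain i b where a: "a = (i, b)" by force
    have i: "i \<in> X" and v: "v \<in> words X" using Cons.prems by (auto simp: a)
    have gi: "g i \<in> carrier G" using i g by auto
    have vc: "eval_word g v \<in> carrier G" using eval_word_closed[OF g v] .
    let ?q = "p + endpoint ?e (a # v)"
    have "?q = endpoint ?e (rep p @ a # v)" using rep[OF Cons.prems(1)] by simp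
    moreover have "rep p @ a # v \<in> words X"
      using rep(1)[OF Cons.prems(1)] Cons.prems(2) by (simp only: words_append)
    ultimately have "?q \<in> P" unfolding P_def by (rule image_eqI)
    then have q: "\<sigma> ?q \<in> carrier G" by (rule \<sigma>)
    have cancel: "inv y \<otimes> (y \<otimes> z) = z" "y \<otimes> (inv y \<otimes> z) = z" if "y \<in> carrier G" "z \<in> carrier G" for y z
      using that by (simp_all add: m_assoc[symmetric])
    show ?case
    proof (cases b)
      case True
      let ?p = "p + ?e i"
      have p': "?p \<in> P" using step Cons.prems i by blast
      have q': "?p + endpoint ?e v = ?q" by (simp add: a True add.assoc)
      have IH: "\<sigma> ?p \<otimes> eval_word g v \<otimes> inv (\<sigma> ?q) = eval_word s (edges ?e ?p v)"
          "edges ?e ?p v \<in> words (P \<times> X)"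
        using Cons.IH[OF p' v] unfolding q' by blast+
      have "eval_word s (edges ?e p (a # v)) = s (p, i) \<otimes> (\<sigma> ?p \<otimes> eval_word g v \<otimes> inv (\<sigma> ?q))"
        using IH by (simp add: a True)
      also have "\<dots> = \<sigma> p \<otimes> eval_word g (a # v) \<otimes> inv (\<sigma> ?q)"
        using \<sigma>[OF Cons.prems(1)] \<sigma>[OF p'] gi vc q by (simp add: a True s_def m_assoc cancel)
      finally show ?thesis using IH(2) i Cons.prems(1) by (simp add: a True)
    next
      case False
      let ?p = "p - ?e i"
      have p': "?p \<in> P" using step Cons.prems i by blast
      have q': "?p + endpoint ?e v = ?q" by (simp add: a False)
      have IH: "\<sigma> ?p \<otimes> eval_word g v \<otimes> inv (\<sigma> ?q) = eval_word s (edges ?e ?p v)"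
          "edges ?e ?p v \<in> words (P \<times> X)"
        using Cons.IH[OF p' v] unfolding q' by blast+
      have "eval_word s (edges ?e p (a # v)) = inv (s (?p, i)) \<otimes> (\<sigma> ?p \<otimes> eval_word g v \<otimes> inv (\<sigma> ?q))"
        using IH by (simp add: a False)
      also have "\<dots> = \<sigma> p \<otimes> eval_word g (a # v) \<otimes> inv (\<sigma> ?q)"
        using \<sigma>[OF Cons.prems(1)] \<sigma>[OF p'] gi vc q
        by (simp add: a False s_def m_assoc inv_mult_group cancel)
      finally show ?thesis using IH(2) i p' by (simp add: a False)
    qed
  qed
  have "?K \<subseteq> carrier G" using subgroup.subset[OF K] .
  have comm: "x \<otimes> y = y \<otimes> x" if "x \<in> ?K" "y \<in> ?K" for x y
  proof -
    have c: "x \<in> carrier G" "y \<in> carrier G" using that \<open>?K \<subseteq> carrier G\<close> by auto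
    have "x \<otimes> y \<otimes> inv x \<otimes> inv y \<in> derived G ?K"
      using that unfolding derived_def[of G ?K] by (intro generate.incl) blast
    then have "x \<otimes> y \<otimes> inv x \<otimes> inv y = \<one>" using meta by (simp add: metabelian_def)
    then have "x \<otimes> y \<otimes> inv x \<otimes> inv y \<otimes> (y \<otimes> x) = y \<otimes> x" using c by simp
    moreover have "x \<otimes> y \<otimes> inv x \<otimes> inv y \<otimes> (y \<otimes> x) = x \<otimes> y \<otimes> (inv x \<otimes> ((inv y \<otimes> y) \<otimes> x))"
      using c by (simp only: m_assoc m_closed inv_closed)
    moreover have "\<dots> = x \<otimes> y" using c by simp
    ultimately show ?thesis by simp
  qed
  have "\<sigma> 0 \<otimes> eval_word g w \<otimes> inv (\<sigma> 0) = eval_word s (edges ?e 0 w)" "edges ?e 0 w \<in> words (P \<times> X)"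
    using telescope[OF P0 w] closed by simp_all
  moreover have "eval_word s (edges ?e 0 w) = \<one>"
    by (rule eval_word_balanced[OF K comm sX]) (use calculation(2) flow in auto)
  ultimately have "\<sigma> 0 \<otimes> eval_word g w \<otimes> inv (\<sigma> 0) = \<one>" by simp
  then have "\<sigma> 0 \<otimes> eval_word g w = \<sigma> 0"
    using \<sigma>[OF P0] eval_word_closed[OF g w] by (metis inv_closed inv_inv inv_equality inv_unique m_closed)
  then show ?thesis using \<sigma>[OF P0] eval_word_closed[OF g w] by (metis l_cancel_one)
qed

section \<open>The Magnus homomorphism and its kernel\<close>

lemma endpoint_reduce: "endpoint e (reduce w) = endpoint e w"
proof (induction w)
  case (Cons a w)
  have "endpoint e (cancel_cons a v) = endpoint e (a # v)" for v
    by (cases v; cases a) (auto simp: cancel_cons_def inv_letter_def)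
  then show ?case using Cons by (cases a) (simp add: reduce_def)
qed (simp add: reduce_def)

lemma signed_count_edges_reduce: "signed_count key (edges e p (reduce w)) = signed_count key (edges e p w)"
proof (induction w arbitrary: p)
  case (Cons a w)
  obtain i s where a: "a = (i, s)" by force
  have "signed_count key (edges e p (cancel_cons a v)) = signed_count key (edges e p (a # v))" for v
    by (cases v) (auto simp: cancel_cons_def inv_letter_def a)
  then show ?case using Cons by (simp add: reduce_def a)
qed (simp add: reduce_def)

text \<open>The Fox derivatives of \<open>w\<close> with values in the group ring of the lattice:
  coordinate \<open>i\<close> at \<open>p\<close> is the coefficient of \<open>p\<close> in the
  derivative by the \<open>i\<close>-th generator.\<close>

definition flow :: "nat \<Rightarrow> nat word \<Rightarrow> (nat \<Rightarrow>\<^sub>0 int) \<Rightarrow> nat \<Rightarrow>\<^sub>0 int"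
  where "flow r w = (\<lambda>p\<in>carrier (free_Abelian_group {..<r}).
    \<Sum>i<r. frag_cmul (signed_count (p, i) (edges frag_of 0 w)) (frag_of i))"

definition magnus :: "nat \<Rightarrow> nat word \<Rightarrow> ((nat \<Rightarrow>\<^sub>0 int) \<Rightarrow> nat \<Rightarrow>\<^sub>0 int) \<times> (nat \<Rightarrow>\<^sub>0 int)"
  where "magnus r w = (flow r w, endpoint frag_of w)"

lemma lookup_flow:
  assumes "p \<in> carrier (free_Abelian_group {..<r})" "i < r"
  shows "Poly_Mapping.lookup (flow r w p) i = signed_count (p, i) (edges frag_of 0 w)"
proof -
  have "Poly_Mapping.lookup (flow r w p) i
      = (\<Sum>j<r. signed_count (p, j) (edges frag_of 0 w) * (if i = j then 1 else 0))"
    using assms(1) by (simp add: flow_def lookup_sum lookup_single when_def)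
  also have "\<dots> = signed_count (p, i) (edges frag_of 0 w)"
    using assms(2) by (simp add: if_distrib cong: if_cong)
  finally show ?thesis .
qed

lemma endpoint_carrier:
  "w \<in> words {..<r} \<Longrightarrow> endpoint frag_of w \<in> carrier (free_Abelian_group {..<r})"
proof (induction w)
  case (Cons a w)
  obtain i s where a: "a = (i, s)" by force
  have "Poly_Mapping.keys (endpoint frag_of w) \<subseteq> {..<r}" "i < r" using Cons by (auto simp: a)
  then show ?case
    using keys_add[of "frag_of i" "endpoint frag_of w"] keys_diff[of "endpoint frag_of w" "frag_of i"]
    by (auto simp: a split: if_splits)
qed simp

lemma edges_words:
  "w \<in> words {..<r} \<Longrightarrow> p \<in> carrier (free_Abelian_group {..<r}) \<Longrightarrow>
    edges frag_of p w \<in> words (carrier (free_Abelian_group {..<r}) \<times> {..<r})"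
proof (induction w arbitrary: p)
  case (Cons a w)
  obtain i s where a: "a = (i, s)" by force
  have i: "i < r" using Cons.prems by (simp add: a)
  have "p + frag_of i \<in> carrier (free_Abelian_group {..<r})" "p - frag_of i \<in> carrier (free_Abelian_group {..<r})"
    using Cons.prems(2) i keys_add[of p "frag_of i"] keys_diff[of p "frag_of i"] by auto
  then show ?case using Cons i by (auto simp: a)
qed simp

lemma group_lattice_wreath:
  "group (wreath_product (free_Abelian_group {..<r :: nat}) (free_Abelian_group {..<r}))"
  by (rule group_wreath_product) simp_all

lemma magnus_hom:
  "magnus r \<in> hom (free_group {..<r}) (wreath_product (free_Abelian_group {..<r}) (free_Abelian_group {..<r}))"
proof -
  let ?Z = "free_Abelian_group {..<r}"
  have flow_closed: "flow r w \<in> carrier (sum_group (carrier ?Z) (\<lambda>_. ?Z))" if "w \<in> words {..<r}" for w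
  proof -
    have "flow r w p \<in> carrier ?Z" if "p \<in> carrier ?Z" for p
    proof -
      have "(\<Sum>i<r. frag_cmul (signed_count (p, i) (edges frag_of 0 w)) (frag_of i)) \<in> carrier ?Z"
        using keys_cmul by (intro sum_closed_free_Abelian_group) fastforce
      then show ?thesis using that by (simp add: flow_def)
    qed
    moreover have "{p \<in> carrier ?Z. flow r w p \<noteq> 0} \<subseteq> (fst \<circ> fst) ` set (edges frag_of 0 w)"
    proof
      fix p assume "p \<in> {p \<in> carrier ?Z. flow r w p \<noteq> 0}"
      then have p: "p \<in> carrier ?Z" "flow r w p \<noteq> 0" by auto
      then obtain i where "signed_count (p, i) (edges frag_of 0 w) \<noteq> 0"
        by (auto simp: flow_def intro!: sum.neutral split: if_splits) (metis frag_cmul_zero sum.neutral)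
      then have "(p, i) \<in> fst ` set (edges frag_of 0 w)" using signed_count_notin by metis
      then show "p \<in> (fst \<circ> fst) ` set (edges frag_of 0 w)" by force
    qed
    then have "finite {p \<in> carrier ?Z. flow r w p \<noteq> 0}" by (rule finite_subset) simp
    ultimately show ?thesis
      by (auto simp: carrier_sum_group flow_def)
  qed
  have mult: "magnus r (u @ v) = magnus r u \<otimes>\<^bsub>wreath_product ?Z ?Z\<^esub> magnus r v"
    if u: "u \<in> words {..<r}" for u v
  proof -
    \<comment> \<open>The product rule for Fox derivatives: the path of \<open>u @ v\<close> is that
      of \<open>u\<close> followed by that of \<open>v\<close> translated by the endpoint of
      \<open>u\<close>.\<close>
    have "flow r (u @ v) p = flow r u p + flow r v (- endpoint frag_of u + p)" if p: "p \<in> carrier ?Z" for p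
    proof -
      have "signed_count (p, i) (edges frag_of (endpoint frag_of u) v)
          = signed_count (- endpoint frag_of u + p, i) (edges frag_of 0 v)" for i
        using signed_count_edges_translate[of p i frag_of "endpoint frag_of u" 0 v] by simp
      moreover have "- endpoint frag_of u + p \<in> carrier ?Z"
        using p endpoint_carrier[OF u] keys_diff[of p "endpoint frag_of u"] by auto
      ultimately show ?thesis
        using p by (simp add: flow_def edges_append frag_cmul_distrib sum.distrib)
    qed
    moreover have "translate ?Z (endpoint frag_of u) f p = f (- endpoint frag_of u + p)"
      if "p \<in> carrier ?Z" for f :: "(nat \<Rightarrow>\<^sub>0 int) \<Rightarrow> nat \<Rightarrow>\<^sub>0 int" and p
      using that endpoint_carrier[OF u] by (simp add: translate_def)
    ultimately show ?thesis
      by (auto simp: magnus_def wreath_product_simps flow_def)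
  qed
  have red: "magnus r (reduce w) = magnus r w" for w
    by (simp add: magnus_def flow_def endpoint_reduce signed_count_edges_reduce)
  show ?thesis
  proof (rule homI)
    fix w assume "w \<in> carrier (free_group {..<r})"
    then have "w \<in> words {..<r}" by (simp add: carrier_free_group)
    then show "magnus r w \<in> carrier (wreath_product ?Z ?Z)"
      unfolding magnus_def wreath_product_simps using flow_closed endpoint_carrier by blast
  next
    fix u v assume "u \<in> carrier (free_group {..<r})"
    then have "u \<in> words {..<r}" by (simp add: carrier_free_group)
    then show "magnus r (u \<otimes>\<^bsub>free_group {..<r}\<^esub> v) = magnus r u \<otimes>\<^bsub>wreath_product ?Z ?Z\<^esub> magnus r v"
      unfolding mult_free_group red by (rule mult)
  qed
qed

text \<open>A word with trivial image is a closed path without flow, and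
  \<open>metabelian_eval_word\<close> makes it trivial in every metabelian group, in particular in
  the quotient by the second derived subgroup.\<close>

lemma magnus_kernel:
  assumes w: "w \<in> carrier (free_group {..<r})"
    and one: "magnus r w = \<one>\<^bsub>wreath_product (free_Abelian_group {..<r}) (free_Abelian_group {..<r})\<^esub>"
  shows "w \<in> derived (free_group {..<r}) (derived (free_group {..<r}) (carrier (free_group {..<r})))"
proof -
  let ?Z = "free_Abelian_group {..<r}" and ?F = "free_group {..<r}"
  interpret F: group ?F by (rule group_free_group)
  let ?N = "derived ?F (derived ?F (carrier ?F))"
  have N: "?N \<lhd> ?F" by (intro F.derived_is_normal F.normal_self)
  interpret N: normal ?N ?F by (rule N)
  interpret Q: group "?F Mod ?N" by (rule N.factorgroup_is_group)
  interpret \<pi>: group_hom ?F "?F Mod ?N" "\<lambda>x. ?N #>\<^bsub>?F\<^esub> x"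
    by unfold_locales (rule N.r_coset_hom_Mod)
  have onto: "(\<lambda>x. ?N #>\<^bsub>?F\<^esub> x) ` carrier ?F = carrier (?F Mod ?N)"
    by (simp add: carrier_FactGroup)
  \<comment> \<open>Derived subgroups commute with the projection, and the projection kills the
    second one.\<close>
  have "derived (?F Mod ?N) (derived (?F Mod ?N) (carrier (?F Mod ?N))) = (\<lambda>x. ?N #>\<^bsub>?F\<^esub> x) ` ?N"
    using \<pi>.derived_img[of "carrier ?F"] \<pi>.derived_img[of "derived ?F (carrier ?F)"] F.derived_in_carrier[of "carrier ?F"]
    by (simp add: onto)
  also have "\<dots> = (\<lambda>x. ?N) ` ?N"
    using F.coset_join2[OF _ N.subgroup_axioms] N.subset by (intro image_cong) auto
  also have "\<dots> = {\<one>\<^bsub>?F Mod ?N\<^esub>}"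
    unfolding one_FactGroup by (rule image_constant[OF N.one_closed])
  finally have meta: "metabelian (?F Mod ?N)"
    unfolding metabelian_def using Q.group_axioms by blast
  define g where "g i = ?N #>\<^bsub>?F\<^esub> [(i, True)]" for i
  have letter: "[(i, True)] \<in> carrier ?F" if "i < r" for i
    using that by (simp add: carrier_free_group reduced_Cons)
  have g: "(\<lambda>i. [(i, True)]) \<in> {..<r} \<rightarrow> carrier ?F" using letter by auto
  have ww: "w \<in> words {..<r}" "reduce w = w" using w by (auto simp: carrier_free_group reduce_id)
  have ev: "F.eval_word (\<lambda>i. [(i, True)]) v = reduce v" if "v \<in> words {..<r}" for v
    using that
  proof (induction v)
    case Nil
    then show ?case by (simp add: one_free_group reduce_def)
  next
    case (Cons a v)
    obtain i s where a: "a = (i, s)" by force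
    have "inv\<^bsub>?F\<^esub> [(i, True)] = [(i, False)]"
      using letter[of i] Cons.prems by (simp add: a inv_free_group inv_letter_def reduce_id reduced_Cons)
    then show ?case using Cons by (auto simp: a mult_free_group)
  qed
  have zero: "flow r w p = 0" if "p \<in> carrier ?Z" for p
    using fun_cong[of "flow r w" "\<lambda>y\<in>carrier ?Z. 0" p] one that
    by (simp add: magnus_def wreath_product_def semidirect_product_def)
  have "signed_count key (edges frag_of 0 w) = 0" for key
  proof (cases "key \<in> carrier ?Z \<times> {..<r}")
    case True
    then show ?thesis using lookup_flow[of "fst key" r "snd key" w] zero[of "fst key"] by auto
  next
    case False
    moreover have "edges frag_of 0 w \<in> words (carrier ?Z \<times> {..<r})"
      by (rule edges_words[OF ww(1)]) simp
    ultimately show ?thesis by (intro signed_count_notin) (auto simp: words_def)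
  qed
  moreover have "endpoint frag_of w = 0"
    using one by (simp add: magnus_def wreath_product_def semidirect_product_def)
  ultimately have "Q.eval_word (\<lambda>i. ?N #>\<^bsub>?F\<^esub> [(i, True)]) w = \<one>\<^bsub>?F Mod ?N\<^esub>"
    using letter by (intro Q.metabelian_eval_word[OF meta _ ww(1)]) (auto simp: carrier_FactGroup)
  then have "?N #>\<^bsub>?F\<^esub> w = ?N"
    using F.eval_word_quotient[OF N g ww(1)] ev[OF ww(1)] ww(2) by simp
  then show ?thesis using F.coset_join1[OF _ w N.subgroup_axioms] by simp
qed

lemma finitely_generated_free_Abelian_group: "finitely_generated (free_Abelian_group {..<r :: nat})"
proof -
  let ?Z = "free_Abelian_group {..<r}"
  interpret Z: group ?Z by simp
  have "x \<in> generate ?Z (frag_of ` {..<r})" if "Poly_Mapping.keys x \<subseteq> {..<r}" for x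
    using that
  proof (rule free_Abelian_group_induct)
    show "0 \<in> generate ?Z (frag_of ` {..<r})" using generate.one[of ?Z] by simp
  next
    fix x y assume xy: "Poly_Mapping.keys x \<subseteq> {..<r}" "Poly_Mapping.keys y \<subseteq> {..<r}"
      "x \<in> generate ?Z (frag_of ` {..<r})" "y \<in> generate ?Z (frag_of ` {..<r})"
    have "x \<otimes>\<^bsub>?Z\<^esub> inv\<^bsub>?Z\<^esub> y \<in> generate ?Z (frag_of ` {..<r})"
      by (intro generate.eng xy Z.generate_m_inv_closed) auto
    then show "x - y \<in> generate ?Z (frag_of ` {..<r})" using xy(2) by simp
  qed (auto intro: generate.incl)
  moreover have "frag_of ` {..<r} \<subseteq> carrier ?Z" by auto
  moreover from this have "generate ?Z (frag_of ` {..<r}) \<subseteq> carrier ?Z" by (rule Z.generate_incl)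
  ultimately have "generate ?Z (frag_of ` {..<r}) = carrier ?Z" by auto
  then show ?thesis
    unfolding finitely_generated_def using \<open>frag_of ` {..<r} \<subseteq> carrier ?Z\<close>
    by (intro exI[of _ "frag_of ` {..<r}"]) simp
qed

text \<open>The Magnus map followed by the embedding of the wreath product has the second derived
  subgroup as its kernel: it kills that subgroup because \<open>G\<close> is metabelian, and nothing
  else by \<open>magnus_kernel\<close>.\<close>

lemma free_metabelian_embeds:
  fixes M :: "('m, 'b) monoid_scheme"
  assumes "free_metabelian_of_rank r M"
  shows "\<exists>G :: nat monoid. metabelian G \<and> finitely_presented G \<and> exponential_dehn_function G \<and>
    (\<exists>H. subgroup H G \<and> M \<cong> G\<lparr>carrier := H\<rparr>)"
proof -
  let ?Z = "free_Abelian_group {..<r}" and ?F = "free_group {..<r}"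
  let ?W = "wreath_product ?Z ?Z" and ?N = "derived ?F (derived ?F (carrier ?F))"
  have M: "M \<cong> ?F Mod ?N" "group M" using assms by (simp_all add: free_metabelian_of_rank_def Let_def)
  have "free_abelian_of_rank r ?Z"
    by (simp add: free_abelian_of_rank_def abelian_free_Abelian_group iso_refl)
  then obtain G :: "nat monoid" and h where G: "metabelian G" "finitely_presented G" "exponential_dehn_function G"
    and h: "h \<in> mon ?W G"
    using wreath_product_embeds[OF _ abelian_free_Abelian_group finitely_generated_free_Abelian_group] by blast
  interpret F: group ?F by (rule group_free_group)
  interpret W: group ?W by (rule group_lattice_wreath)
  interpret G: group G using G(1) by (simp add: metabelian_def)
  define \<Phi> where "\<Phi> = h \<circ> magnus r"
  have hom: "\<Phi> \<in> hom ?F G"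
    unfolding \<Phi>_def using hom_compose[OF magnus_hom] h by (auto simp: mon_def)
  interpret \<Phi>: group_hom ?F G \<Phi> by unfold_locales (rule hom)
  let ?H = "\<Phi> ` carrier ?F"
  have "\<Phi> ` ?N = derived G (derived G ?H)"
    using \<Phi>.derived_img[of "carrier ?F"] \<Phi>.derived_img[of "derived ?F (carrier ?F)"] F.derived_in_carrier[of "carrier ?F"]
    by simp
  also have "\<dots> \<subseteq> derived G (derived G (carrier G))"
    by (intro G.mono_derived) auto
  also have "\<dots> = {\<one>\<^bsub>G\<^esub>}" using G(1) by (simp add: metabelian_def)
  finally have "?N \<subseteq> kernel ?F G \<Phi>"
    using F.derived_in_carrier[OF F.derived_in_carrier[of "carrier ?F"]] by (auto simp: kernel_def)
  moreover have "kernel ?F G \<Phi> \<subseteq> ?N"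
  proof
    fix w assume "w \<in> kernel ?F G \<Phi>"
    then have w: "w \<in> carrier ?F" "h (magnus r w) = \<one>\<^bsub>G\<^esub>" by (auto simp: kernel_def \<Phi>_def)
    have "magnus r w \<in> carrier ?W" using magnus_hom w(1) by (rule hom_in_carrier)
    moreover have "h \<one>\<^bsub>?W\<^esub> = \<one>\<^bsub>G\<^esub>"
      using h by (intro hom_one[OF _ W.group_axioms G.group_axioms]) (simp add: mon_def)
    ultimately have "magnus r w = \<one>\<^bsub>?W\<^esub>"
      using h w(2) W.one_closed inj_onD[of h "carrier ?W" "magnus r w" "\<one>\<^bsub>?W\<^esub>"] by (simp add: mon_def)
    then show "w \<in> ?N" by (rule magnus_kernel[OF w(1)])
  qed
  ultimately have ker: "kernel ?F G \<Phi> = ?N" by blast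
  have sub: "subgroup ?H G" by (rule \<Phi>.img_is_subgroup)
  interpret \<Psi>: group_hom ?F "G\<lparr>carrier := ?H\<rparr>" \<Phi>
    using hom G.subgroup_imp_group[OF sub] by (auto simp: group_hom_def group_hom_axioms_def hom_def F.group_axioms)
  have "?F Mod kernel ?F (G\<lparr>carrier := ?H\<rparr>) \<Phi> \<cong> G\<lparr>carrier := ?H\<rparr>"
    by (rule \<Psi>.FactGroup_iso) simp
  moreover have "kernel ?F (G\<lparr>carrier := ?H\<rparr>) \<Phi> = ?N" using ker by (simp add: kernel_def)
  ultimately have "M \<cong> G\<lparr>carrier := ?H\<rparr>" using M(1) iso_trans by metis
  then show ?thesis using G sub by blast
qed

theorem theorem1p5:
  shows "(\<forall>(A :: 'a monoid) (T :: 't monoid) n.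
            free_abelian_of_rank n A \<and> comm_group T \<and> finitely_generated T \<longrightarrow>
            (\<exists>G :: nat monoid. metabelian G \<and> finitely_presented G \<and> exponential_dehn_function G \<and>
               (\<exists>h. h \<in> mon (wreath_product A T) G))) \<and>
         (\<forall>(M :: 'm monoid) r.
            free_metabelian_of_rank r M \<longrightarrow>
            (\<exists>G :: nat monoid. metabelian G \<and> finitely_presented G \<and> exponential_dehn_function G \<and>
               (\<exists>H. subgroup H G \<and> M \<cong> G\<lparr>carrier := H\<rparr>)))"
  using wreath_product_embeds free_metabelian_embeds by blast

end
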